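(* Let $L$ be a CW complex of finite type which has a finite fundamental group and which is not finitely dominated, and let $K = L \vee S^{2}$. Then $K$ is not finitely dominated, and every separable metrizable space $X$ with $K \in \mathrm{AE}(X)$ admits a metrizable compactification $\widetilde{X}$ with $K \in \mathrm{AE}(\widetilde{X})$.
   Context: For spaces $X$ and $K$, the notation $K \in \mathrm{AE}(X)$ means that every continuous map $f \colon A \to K$ defined on a closed subspace $A$ of $X$ admits a continuous extension $\widetilde{f} \colon X \to K$. A CW complex has finite type if it has only finitely many cells in every dimension. A CW complex $K$ is finitely dominated (homotopy dominated by a finite CW complex) if there exist a finite CW complex $F$ and maps $i \colon K \to F$ and $r \colon F \to K$ with $r \circ i$ homotopic to $\mathrm{id}_{K}$. A complex with a finite fundamental group is understood to be connected. $L \vee S^{2}$ denotes the wedge (one-point union) of $L$ and the 2-sphere. A metrizable compactification of $X$ is a compact metrizable space containing a homeomorphic copy of $X$ as a dense subspace. *)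

theory Defs
  imports "HOL-Analysis.Analysis" "HOL-Algebra.Group"
begin

no_notation eq_closure_of (\<open>closure'_of\<index>\<close>)

section \<open>CW complexes\<close>

definition disk :: "nat \<Rightarrow> (nat \<Rightarrow> real) topology"
  where "disk n \<equiv> subtopology (Euclidean_space n) {x. (\<Sum>i<n. x i ^ 2) \<le> 1}"

definition disk_interior :: "nat \<Rightarrow> (nat \<Rightarrow> real) set"
  where "disk_interior n \<equiv> {x \<in> topspace (disk n). (\<Sum>i<n. x i ^ 2) < 1}"

definition disk_boundary :: "nat \<Rightarrow> (nat \<Rightarrow> real) set"
  where "disk_boundary n \<equiv> {x \<in> topspace (disk n). (\<Sum>i<n. x i ^ 2) = 1}"

text \<open>Whitehead's definition; \<open>E n\<close> is the set of open \<open>n\<close>-cells of \<open>X\<close>.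
  For \<open>n = 0\<close> the disk is a point with empty boundary.\<close>

definition characteristic_map ::
    "'a topology \<Rightarrow> (nat \<Rightarrow> 'a set set) \<Rightarrow> nat \<Rightarrow> 'a set \<Rightarrow> ((nat \<Rightarrow> real) \<Rightarrow> 'a) \<Rightarrow> bool"
  where "characteristic_map X E n e \<Phi> \<longleftrightarrow>
     continuous_map (disk n) X \<Phi> \<and>
     homeomorphic_map (subtopology (disk n) (disk_interior n)) (subtopology X e) \<Phi> \<and>
     \<Phi> ` disk_boundary n \<subseteq> (\<Union>m<n. \<Union>(E m))"

definition CW_complex :: "'a topology \<Rightarrow> (nat \<Rightarrow> 'a set set) \<Rightarrow> bool"
  where "CW_complex X E \<longleftrightarrow>
     Hausdorff_space X \<and>
     (\<Union>n. \<Union>(E n)) = topspace X \<and>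
     (\<forall>n. {} \<notin> E n) \<and>
     (\<forall>m n. \<forall>c \<in> E m. \<forall>e \<in> E n. (m, c) \<noteq> (n, e) \<longrightarrow> c \<inter> e = {}) \<and>
     (\<forall>n. \<forall>e \<in> E n. \<exists>\<Phi>. characteristic_map X E n e \<Phi>) \<and>
     (\<forall>n. \<forall>e \<in> E n. finite {(m, c). c \<in> E m \<and> c \<inter> X closure_of e \<noteq> {}}) \<and>
     (\<forall>S \<subseteq> topspace X. closedin X S \<longleftrightarrow> (\<forall>n. \<forall>e \<in> E n. closedin X (S \<inter> X closure_of e)))"

definition finite_type :: "(nat \<Rightarrow> 'a set set) \<Rightarrow> bool"
  where "finite_type E \<longleftrightarrow> (\<forall>n. finite (E n))"

definition finite_CW_complex :: "'a topology \<Rightarrow> (nat \<Rightarrow> 'a set set) \<Rightarrow> bool"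
  where "finite_CW_complex X E \<longleftrightarrow> CW_complex X E \<and> finite (Sigma UNIV E)"

definition dominated_by :: "'a topology \<Rightarrow> 'b topology \<Rightarrow> bool"
  where "dominated_by X F \<longleftrightarrow>
     (\<exists>i r. continuous_map X F i \<and> continuous_map F X r \<and>
            homotopic_with (\<lambda>h. True) X X (r \<circ> i) id)"

text \<open>A finite CW complex has at most continuum many points, so fixing the carrier type
  \<open>nat \<Rightarrow> real\<close> for \<open>F\<close> loses no generality: see \<open>finitely_dominatedI\<close> below.\<close>

definition finitely_dominated :: "'a topology \<Rightarrow> bool"
  where "finitely_dominated X \<longleftrightarrow>
     (\<exists>(F :: (nat \<Rightarrow> real) topology) E. finite_CW_complex F E \<and> dominated_by X F)"

section \<open>Fundamental group\<close>

definition loops_at :: "'a topology \<Rightarrow> 'a \<Rightarrow> (real \<Rightarrow> 'a) set"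
  where "loops_at X x \<equiv> {p. pathin X p \<and> p 0 = x \<and> p 1 = x}"

definition loop_homotopy :: "'a topology \<Rightarrow> 'a \<Rightarrow> ((real \<Rightarrow> 'a) \<times> (real \<Rightarrow> 'a)) set"
  where "loop_homotopy X x \<equiv>
     {(p, q). p \<in> loops_at X x \<and> q \<in> loops_at X x \<and>
        homotopic_with (\<lambda>h. h 0 = x \<and> h 1 = x) (top_of_set {0..1}) X p q}"

text \<open>The library's \<open>joinpaths\<close>, \<open>homotopic_paths\<close> and \<open>homotopic_loops\<close> are restricted to
  type classes of topological spaces, so they do not apply to a general \<^typ>\<open>'a topology\<close>.\<close>

definition loop_concat :: "(real \<Rightarrow> 'a) \<Rightarrow> (real \<Rightarrow> 'a) \<Rightarrow> real \<Rightarrow> 'a"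
  where "loop_concat p q \<equiv> (\<lambda>t. if t \<le> 1/2 then p (2 * t) else q (2 * t - 1))"

definition fundamental_group :: "'a topology \<Rightarrow> 'a \<Rightarrow> (real \<Rightarrow> 'a) set monoid"
  where "fundamental_group X x \<equiv>
     \<lparr>carrier = loops_at X x // loop_homotopy X x,
      monoid.mult = (\<lambda>A B. \<Union>p\<in>A. \<Union>q\<in>B. loop_homotopy X x `` {loop_concat p q}),
      one = loop_homotopy X x `` {\<lambda>t. x}\<rparr>"

definition finite_fundamental_group :: "'a topology \<Rightarrow> bool"
  where "finite_fundamental_group X \<longleftrightarrow>
     topspace X \<noteq> {} \<and> connected_space X \<and>
     (\<forall>x \<in> topspace X. finite (carrier (fundamental_group X x)))"

section \<open>Wedge\<close>

text \<open>The quotient of the disjoint union of \<open>X\<close> and \<open>Y\<close> that identifies \<open>y\<^sub>0\<close> with \<open>x\<^sub>0\<close>: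
  the common point is represented by \<open>Inl x\<^sub>0\<close>, and the topology is the final one for the
  two inclusions.\<close>

definition wedge_inr :: "'a \<Rightarrow> 'b \<Rightarrow> 'b \<Rightarrow> 'a + 'b"
  where "wedge_inr x0 y0 y \<equiv> if y = y0 then Inl x0 else Inr y"

definition wedge :: "'a topology \<Rightarrow> 'a \<Rightarrow> 'b topology \<Rightarrow> 'b \<Rightarrow> ('a + 'b) topology"
  where "wedge X x0 Y y0 \<equiv> topology (\<lambda>U.
     U \<subseteq> Inl ` topspace X \<union> wedge_inr x0 y0 ` topspace Y \<and>
     openin X {x \<in> topspace X. Inl x \<in> U} \<and>
     openin Y {y \<in> topspace Y. wedge_inr x0 y0 y \<in> U})"

section \<open>Extension of maps and compactifications\<close>

text \<open>\<open>in_AE K X\<close> is the relation \<open>K \<in> AE(X)\<close>.\<close>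

definition in_AE :: "'a topology \<Rightarrow> 'b topology \<Rightarrow> bool"
  where "in_AE K X \<longleftrightarrow>
     (\<forall>A f. closedin X A \<and> continuous_map (subtopology X A) K f \<longrightarrow>
        (\<exists>g. continuous_map X K g \<and> (\<forall>x \<in> A. g x = f x)))"

text \<open>Only the existence of a compactification is asserted later, and a compact metrizable space
  has at most continuum many points, so the carrier type \<open>nat \<Rightarrow> real\<close> is large enough for
  every \<open>C\<close>: see \<open>metrizable_compactificationI\<close> below.\<close>

definition metrizable_compactification :: "'a topology \<Rightarrow> 'b topology \<Rightarrow> bool"
  where "metrizable_compactification X C \<longleftrightarrow>
     compact_space C \<and> metrizable_space C \<and>
     (\<exists>e. embedding_map X C e \<and> C closure_of (e ` topspace X) = topspace C)"

section \<open>Basic facts\<close>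

lemma istopology_wedge:
  "istopology (\<lambda>U.
     U \<subseteq> Inl ` topspace X \<union> wedge_inr x0 y0 ` topspace Y \<and>
     openin X {x \<in> topspace X. Inl x \<in> U} \<and>
     openin Y {y \<in> topspace Y. wedge_inr x0 y0 y \<in> U})"
proof -
  have I: "{x \<in> T. f x \<in> U \<inter> V} = {x \<in> T. f x \<in> U} \<inter> {x \<in> T. f x \<in> V}"
    for T :: "'c set" and f :: "'c \<Rightarrow> 'a + 'b" and U V by auto
  have U: "{x \<in> T. f x \<in> \<Union>\<U>} = (\<Union>U\<in>\<U>. {x \<in> T. f x \<in> U})"
    for T :: "'c set" and f :: "'c \<Rightarrow> 'a + 'b" and \<U> by auto
  show ?thesis
    unfolding istopology_def I U by blast
qed

lemma openin_wedge:
  "openin (wedge X x0 Y y0) U \<longleftrightarrow>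
     U \<subseteq> Inl ` topspace X \<union> wedge_inr x0 y0 ` topspace Y \<and>
     openin X {x \<in> topspace X. Inl x \<in> U} \<and>
     openin Y {y \<in> topspace Y. wedge_inr x0 y0 y \<in> U}"
  unfolding wedge_def topology_inverse'[OF istopology_wedge] ..

lemma topspace_wedge:
  "topspace (wedge X x0 Y y0) = Inl ` topspace X \<union> wedge_inr x0 y0 ` topspace Y"
proof (rule antisym)
  show "topspace (wedge X x0 Y y0) \<subseteq> Inl ` topspace X \<union> wedge_inr x0 y0 ` topspace Y"
    using openin_topspace[of "wedge X x0 Y y0"] unfolding openin_wedge by simp
  have "{x \<in> topspace X. Inl x \<in> Inl ` topspace X \<union> wedge_inr x0 y0 ` topspace Y} = topspace X"
       "{y \<in> topspace Y. wedge_inr x0 y0 y \<in> Inl ` topspace X \<union> wedge_inr x0 y0 ` topspace Y} = topspace Y"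
    by auto
  then have "openin (wedge X x0 Y y0) (Inl ` topspace X \<union> wedge_inr x0 y0 ` topspace Y)"
    unfolding openin_wedge by (metis openin_topspace order_refl)
  then show "Inl ` topspace X \<union> wedge_inr x0 y0 ` topspace Y \<subseteq> topspace (wedge X x0 Y y0)"
    by (rule openin_subset)
qed

lemma ex_homeomorphic_copy:
  fixes X :: "'a topology"
  assumes "topspace X \<lesssim> (UNIV :: 'b set)"
  obtains Y :: "'b topology" and h where "homeomorphic_map X Y h"
proof -
  obtain h :: "'a \<Rightarrow> 'b" where h: "inj_on h (topspace X)"
    using assms by (auto simp: lepoll_def)
  define k where "k = inv_into (topspace X) h"
  define Y where "Y = pullback_topology (h ` topspace X) k X"
  have kh: "k (h x) = x" if "x \<in> topspace X" for x
    using h that by (simp add: k_def)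
  have top: "topspace Y = h ` topspace X"
    using kh by (auto simp: Y_def topspace_pullback_topology)
  have "homeomorphic_maps X Y h k"
    unfolding homeomorphic_maps_def
  proof (intro conjI ballI)
    show "continuous_map X Y h"
      unfolding Y_def
    proof (rule continuous_map_pullback')
      show "continuous_map X X (k \<circ> h)"
        by (rule continuous_map_eq[OF continuous_map_id]) (simp add: kh)
    qed auto
    show "continuous_map Y X k"
      using continuous_map_pullback[OF continuous_map_id, of "h ` topspace X" k X]
      by (simp add: Y_def)
  qed (auto simp: kh top)
  then show thesis
    using that homeomorphic_maps_map by blast
qed

lemma CW_complexD:
  assumes "CW_complex X E"
  shows "Hausdorff_space X"
    and "(\<Union>n. \<Union>(E n)) = topspace X"
    and "\<forall>n. {} \<notin> E n"
    and "\<forall>m n. \<forall>c \<in> E m. \<forall>e \<in> E n. (m, c) \<noteq> (n, e) \<longrightarrow> c \<inter> e = {}"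
    and "\<forall>n. \<forall>e \<in> E n. \<exists>\<Phi>. characteristic_map X E n e \<Phi>"
    and "\<forall>n. \<forall>e \<in> E n. finite {(m, c). c \<in> E m \<and> c \<inter> X closure_of e \<noteq> {}}"
    and "\<forall>S \<subseteq> topspace X. closedin X S \<longleftrightarrow> (\<forall>n. \<forall>e \<in> E n. closedin X (S \<inter> X closure_of e))"
  by (insert assms, unfold CW_complex_def, (elim conjE, assumption)+)

lemma CW_complex_homeomorphic:
  assumes cw: "CW_complex X E" and h: "homeomorphic_map X Y h"
  shows "CW_complex Y (\<lambda>n. image h ` E n)"
proof -
  have inj: "inj_on h (topspace X)" and surj: "h ` topspace X = topspace Y"
    and cont: "continuous_map X Y h"
    using h by (auto simp: homeomorphic_eq_everything_map)
  have sub: "e \<subseteq> topspace X" if "e \<in> E n" for e n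
    using CW_complexD(2)[OF cw] that by blast
  have cl: "Y closure_of (h ` e) = h ` (X closure_of e)" if "e \<in> E n" for e n
    using homeomorphic_map_closure_of[OF h sub[OF that]] .
  have int: "h ` A \<inter> h ` B = h ` (A \<inter> B)" if "A \<subseteq> topspace X" "B \<subseteq> topspace X" for A B
    using inj_on_image_Int[OF inj that] by simp
  note part = CW_complexD(2)[OF cw] and ne = CW_complexD(3)[OF cw]
  have disj: "c \<inter> e = {}" if "c \<in> E m" "e \<in> E n" "(m, c) \<noteq> (n, e)" for m n c e
    using CW_complexD(4)[OF cw] that by blast
  have char: "\<exists>\<Phi>. characteristic_map X E n e \<Phi>" if "e \<in> E n" for n e
    using CW_complexD(5)[OF cw] that by blast
  have fin: "finite {(m, c). c \<in> E m \<and> c \<inter> X closure_of e \<noteq> {}}" if "e \<in> E n" for n e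
    using CW_complexD(6)[OF cw] that by blast
  have weak: "closedin X S \<longleftrightarrow> (\<forall>n. \<forall>e \<in> E n. closedin X (S \<inter> X closure_of e))"
    if "S \<subseteq> topspace X" for S
    by (rule CW_complexD(7)[OF cw, THEN spec, THEN mp, OF that])
  have H1: "Hausdorff_space Y"
    using homeomorphic_Hausdorff_space[OF homeomorphic_map_imp_homeomorphic_space[OF h]]
      CW_complexD(1)[OF cw] by simp
  have H2: "(\<Union>n. \<Union>(image h ` E n)) = topspace Y"
    unfolding surj[symmetric] part[symmetric] by (simp add: image_UN image_Union)
  have H3: "{} \<notin> image h ` E n" for n
    using ne by auto
  have H4: "c \<inter> e = {}"
    if c: "c \<in> image h ` E m" and e: "e \<in> image h ` E n" and ce: "(m, c) \<noteq> (n, e)" for m n c e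
  proof -
    obtain c' e' where ce': "c' \<in> E m" "c = h ` c'" "e' \<in> E n" "e = h ` e'"
      using c e by auto
    then have "c' \<inter> e' = {}"
      using disj ce by blast
    then show ?thesis
      using int[of c' e'] sub ce' by simp
  qed
  have H5: "\<exists>\<Phi>. characteristic_map Y (\<lambda>n. image h ` E n) n e \<Phi>"
    if e: "e \<in> image h ` E n" for n e
  proof -
    obtain e' where e': "e' \<in> E n" "e = h ` e'" using e by auto
    obtain \<Phi> where \<Phi>: "continuous_map (disk n) X \<Phi>"
      "homeomorphic_map (subtopology (disk n) (disk_interior n)) (subtopology X e') \<Phi>"
      "\<Phi> ` disk_boundary n \<subseteq> (\<Union>m<n. \<Union>(E m))"
      using char[OF e'(1)] unfolding characteristic_map_def by blast
    have "homeomorphic_map (subtopology X e') (subtopology Y e) h"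
      using sub[OF e'(1)] surj e'(2) inj
      by (intro homeomorphic_map_subtopologies[OF h]) (auto simp: Int_absorb1)
    then have "homeomorphic_map (subtopology (disk n) (disk_interior n)) (subtopology Y e) (h \<circ> \<Phi>)"
      using \<Phi>(2) homeomorphic_map_compose by blast
    moreover have "continuous_map (disk n) Y (h \<circ> \<Phi>)"
      using \<Phi>(1) cont continuous_map_compose by blast
    moreover have "(h \<circ> \<Phi>) ` disk_boundary n \<subseteq> (\<Union>m<n. \<Union>(image h ` E m))"
      using \<Phi>(3) by fastforce
    ultimately show ?thesis
      unfolding characteristic_map_def by blast
  qed
  have H6: "finite {(m, c). c \<in> image h ` E m \<and> c \<inter> Y closure_of e \<noteq> {}}"
    if e: "e \<in> image h ` E n" for n e
  proof -
    obtain e' where e': "e' \<in> E n" "e = h ` e'" using e by auto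
    have "{(m, c). c \<in> image h ` E m \<and> c \<inter> Y closure_of e \<noteq> {}}
        \<subseteq> (\<lambda>(m, c). (m, h ` c)) ` {(m, c). c \<in> E m \<and> c \<inter> X closure_of e' \<noteq> {}}"
    proof clarify
      fix m c assume c: "c \<in> E m" and ne: "h ` c \<inter> Y closure_of e \<noteq> {}"
      have "h ` (c \<inter> X closure_of e') \<noteq> {}"
        using ne int[OF sub[OF c] closure_of_subset_topspace] cl[OF e'(1)] e'(2) by simp
      then show "(m, h ` c) \<in> (\<lambda>(m, c). (m, h ` c)) ` {(m, c). c \<in> E m \<and> c \<inter> X closure_of e' \<noteq> {}}"
        using c by (intro image_eqI[where x = "(m, c)"]) auto
    qed
    then show ?thesis
      using fin[OF e'(1)] finite_surj by blast
  qed
  have H7: "closedin Y S \<longleftrightarrow> (\<forall>n. \<forall>e \<in> image h ` E n. closedin Y (S \<inter> Y closure_of e))"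
    if S: "S \<subseteq> topspace Y" for S
  proof -
    obtain S' where S': "S' \<subseteq> topspace X" "S = h ` S'"
      using S surj by (metis subset_image_iff)
    have "closedin Y (S \<inter> Y closure_of (h ` e)) \<longleftrightarrow> closedin X (S' \<inter> X closure_of e)"
      if e: "e \<in> E n" for n e
      using homeomorphic_map_closedness[OF h, of "S' \<inter> X closure_of e"] S'
        int[OF S'(1) closure_of_subset_topspace] cl[OF e] by auto
    then show ?thesis
      using weak[OF S'(1)] homeomorphic_map_closedness[OF h S'(1)] S'(2) by auto
  qed
  show ?thesis
    unfolding CW_complex_def
    by (intro conjI allI ballI impI; (rule H1 H2 H3 H4 H5 H6 H7; assumption))
qed

lemma finite_CW_complex_lepoll:
  assumes "finite_CW_complex F E"
  shows "topspace F \<lesssim> (UNIV :: (nat \<Rightarrow> real) set)"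
proof -
  have cw: "CW_complex F E" and fin: "finite (Sigma UNIV E)"
    using assms unfolding finite_CW_complex_def by auto
  note top = CW_complexD(2)[OF cw]
  define P where "P n e = (SOME \<Phi>. characteristic_map F E n e \<Phi>)" for n e
  have P: "characteristic_map F E n e (P n e)" if "e \<in> E n" for n e
  proof -
    have "\<exists>\<Phi>. characteristic_map F E n e \<Phi>"
      using CW_complexD(5)[OF cw] that by blast
    then show ?thesis
      unfolding P_def by (rule someI_ex)
  qed
  obtain g :: "nat \<times> _ set \<Rightarrow> nat" where g: "inj_on g (Sigma UNIV E)"
    using finite_imp_inj_to_nat_seg[OF fin] by auto
  have surj: "P n e ` disk_interior n \<supseteq> e" if "e \<in> E n" for n e
  proof -
    have "P n e ` topspace (subtopology (disk n) (disk_interior n)) = topspace (subtopology F e)"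
      using P[OF that] homeomorphic_imp_surjective_map unfolding characteristic_map_def by blast
    moreover have "e \<subseteq> topspace F"
      using that top by blast
    ultimately show ?thesis by auto
  qed
  define C :: "(nat \<times> (nat \<Rightarrow> real)) set" where "C = UNIV"
  have "topspace F \<subseteq> (\<lambda>(k, z). let (n, e) = inv_into (Sigma UNIV E) g k in P n e z) ` C"
  proof
    fix x assume "x \<in> topspace F"
    then obtain n e where ne: "e \<in> E n" "x \<in> e" using top by blast
    then obtain z where "x = P n e z" using surj by blast
    moreover have "inv_into (Sigma UNIV E) g (g (n, e)) = (n, e)"
      using g ne by (intro inv_into_f_f) auto
    ultimately show "x \<in> (\<lambda>(k, z). let (n, e) = inv_into (Sigma UNIV E) g k in P n e z) ` C"
      by (intro image_eqI[where x = "(g (n, e), z)"]) (auto simp: C_def)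
  qed
  then have "topspace F \<lesssim> C"
    by (meson image_lepoll lepoll_trans subset_imp_lepoll)
  also have "C \<lesssim> (UNIV :: (nat \<Rightarrow> real) set)"
    unfolding lepoll_def
  proof (intro exI conjI)
    show "inj_on (\<lambda>(k, z). case_nat (real k) z) C"
    proof (rule inj_onI, clarify)
      fix k z k' and z' :: "nat \<Rightarrow> real"
      assume eq: "case_nat (real k) z = case_nat (real k') z'"
      have "real k = real k'" using fun_cong[OF eq, of 0] by simp
      moreover have "z i = z' i" for i using fun_cong[OF eq, of "Suc i"] by simp
      ultimately show "k = k' \<and> z = z'" by auto
    qed
  qed auto
  finally show ?thesis .
qed

lemma dominated_by_homeomorphic:
  assumes "dominated_by X F" "homeomorphic_map F G h"
  shows "dominated_by X G"
proof -
  obtain k where k: "homeomorphic_maps F G h k"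
    using assms(2) homeomorphic_map_maps by blast
  obtain i r where ir: "continuous_map X F i" "continuous_map F X r"
      "homotopic_with (\<lambda>h. True) X X (r \<circ> i) id"
    using assms(1) unfolding dominated_by_def by blast
  have "homotopic_with (\<lambda>h. True) X X ((r \<circ> k) \<circ> (h \<circ> i)) (r \<circ> i)"
  proof (rule homotopic_with_equal)
    show "continuous_map X X (r \<circ> k \<circ> (h \<circ> i))"
      using k ir(1,2) unfolding homeomorphic_maps_def
      by (meson continuous_map_compose)
    show "(r \<circ> k \<circ> (h \<circ> i)) x = (r \<circ> i) x" if "x \<in> topspace X" for x
      using that k continuous_map_image_subset_topspace[OF ir(1)] unfolding homeomorphic_maps_def
      by auto
  qed auto
  then have "homotopic_with (\<lambda>h. True) X X ((r \<circ> k) \<circ> (h \<circ> i)) id"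
    using ir(3) homotopic_with_trans by blast
  moreover have "continuous_map X G (h \<circ> i)" "continuous_map G X (r \<circ> k)"
    using k ir(1,2) unfolding homeomorphic_maps_def by (meson continuous_map_compose)+
  ultimately show ?thesis
    unfolding dominated_by_def by blast
qed

lemma finitely_dominatedI:
  fixes F :: "'b topology"
  assumes F: "finite_CW_complex F E" and X: "dominated_by X F"
  shows "finitely_dominated X"
proof -
  obtain G :: "(nat \<Rightarrow> real) topology" and h where h: "homeomorphic_map F G h"
    using ex_homeomorphic_copy[OF finite_CW_complex_lepoll[OF F]] .
  have "(\<lambda>(n, e). (n, h ` e)) ` Sigma UNIV E = Sigma UNIV (\<lambda>n. image h ` E n)"
    by force
  then have "finite (Sigma UNIV (\<lambda>n. image h ` E n))"
    using F unfolding finite_CW_complex_def by (metis finite_imageI)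
  then have "finite_CW_complex G (\<lambda>n. image h ` E n)"
    using F CW_complex_homeomorphic[OF _ h] unfolding finite_CW_complex_def by blast
  then show ?thesis
    using dominated_by_homeomorphic[OF X h] unfolding finitely_dominated_def by blast
qed

lemma compact_metrizable_lepoll:
  assumes "compact_space C" "metrizable_space C"
  shows "topspace C \<lesssim> (UNIV :: (nat \<Rightarrow> real) set)"
proof -
  obtain M d where Md: "Metric_space M d" "C = Metric_space.mtopology M d"
    using assms(2) unfolding metrizable_space_def by blast
  interpret Metric_space M d by (rule Md(1))
  have top: "topspace C = M" by (simp add: Md(2))
  have "compactin mtopology M"
    using assms(1) Md(2) by (simp add: compact_space_def)
  then have "mtotally_bounded M"
    by (rule compactin_imp_mtotally_bounded)
  then have "\<forall>n. \<exists>K. finite K \<and> K \<subseteq> M \<and> M \<subseteq> (\<Union>x\<in>K. mball x (inverse (real (Suc n))))"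
    unfolding mtotally_bounded_def by simp
  then obtain K where fin: "\<And>n. finite (K n)" and KM: "\<And>n. K n \<subseteq> M"
    and cov: "\<And>n. M \<subseteq> (\<Union>x\<in>K n. mball x (inverse (real (Suc n))))"
    by metis
  define D where "D = (\<Union>n. K n)"
  have D: "countable D"
    unfolding D_def using fin by (simp add: countable_finite)
  have "inj_on (\<lambda>x n. d (from_nat_into D n) x) M"
  proof (rule inj_onI, rule ccontr)
    fix x y assume x: "x \<in> M" and y: "y \<in> M" and ne: "x \<noteq> y"
      and eq: "(\<lambda>n. d (from_nat_into D n) x) = (\<lambda>n. d (from_nat_into D n) y)"
    have "0 < d x y / 2" using x y ne by simp
    then obtain n where n: "inverse (real (Suc n)) < d x y / 2"
      using reals_Archimedean by blast
    obtain z where z: "z \<in> K n" "x \<in> mball z (inverse (real (Suc n)))"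
      using cov[of n] x by blast
    then have "z \<in> D" by (auto simp: D_def)
    then obtain k where "from_nat_into D k = z"
      using D by (metis from_nat_into_surj)
    then have "d z x = d z y" using fun_cong[OF eq, of k] by simp
    moreover have "d x y \<le> d z x + d z y"
      using triangle'[of x z y] x y z(2) commute by (metis in_mball triangle)
    ultimately show False
      using z(2) n by simp
  qed
  then show ?thesis
    unfolding top lepoll_def by blast
qed

lemma metrizable_compactificationI:
  fixes C :: "'c topology"
  assumes C: "metrizable_compactification X C" and K: "in_AE K C"
  shows "\<exists>D :: (nat \<Rightarrow> real) topology. metrizable_compactification X D \<and> in_AE K D"
proof -
  have comp: "compact_space C" and metr: "metrizable_space C"
    using C unfolding metrizable_compactification_def by auto
  obtain e where e: "embedding_map X C e" "C closure_of (e ` topspace X) = topspace C"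
    using C unfolding metrizable_compactification_def by blast
  obtain D :: "(nat \<Rightarrow> real) topology" and h where h: "homeomorphic_map C D h"
    using ex_homeomorphic_copy[OF compact_metrizable_lepoll[OF comp metr]] .
  obtain k where hk: "homeomorphic_maps C D h k"
    using h homeomorphic_map_maps by blast
  have CD: "C homeomorphic_space D"
    using h by (rule homeomorphic_map_imp_homeomorphic_space)
  have hC: "h ` topspace C = topspace D"
    using h by (rule homeomorphic_imp_surjective_map)
  have eX: "e ` topspace X \<subseteq> topspace C"
    using homeomorphic_imp_surjective_map[OF e(1)[unfolded embedding_map_def]]
    unfolding topspace_subtopology by blast
  have "embedding_map C D h"
    using h hC unfolding embedding_map_def by simp
  then have "embedding_map X D (h \<circ> e)"
    using e(1) embedding_map_compose by blast
  moreover have "D closure_of ((h \<circ> e) ` topspace X) = topspace D"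
    using homeomorphic_map_closure_of[OF h eX] e(2) hC by (simp add: image_comp)
  moreover have "compact_space D" "metrizable_space D"
    using comp metr homeomorphic_compact_space[OF CD] homeomorphic_metrizable_space[OF CD] by auto
  ultimately have "metrizable_compactification X D"
    unfolding metrizable_compactification_def by blast
  moreover have "in_AE K D"
    unfolding in_AE_def
  proof (intro allI impI, elim conjE)
    fix A f assume A: "closedin D A" and f: "continuous_map (subtopology D A) K f"
    have kD: "homeomorphic_map D C k"
      using hk homeomorphic_maps_sym homeomorphic_maps_map by blast
    have kh: "\<And>y. y \<in> topspace D \<Longrightarrow> h (k y) = y"
      and ck: "continuous_map D C k"
      using hk unfolding homeomorphic_maps_def by blast+
    have AD: "A \<subseteq> topspace D" using A by (rule closedin_subset)
    have "closedin C (k ` A)"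
      using homeomorphic_map_closedness[OF kD AD] A by simp
    moreover have "continuous_map (subtopology C (k ` A)) (subtopology D A) h"
    proof (rule continuous_map_into_subtopology)
      show "continuous_map (subtopology C (k ` A)) D h"
        using h homeomorphic_imp_continuous_map continuous_map_from_subtopology by blast
      show "h \<in> topspace (subtopology C (k ` A)) \<rightarrow> A"
        using kh AD by auto
    qed
    then have "continuous_map (subtopology C (k ` A)) K (f \<circ> h)"
      using f by (rule continuous_map_compose)
    ultimately obtain g where g: "continuous_map C K g" "\<forall>x \<in> k ` A. g x = (f \<circ> h) x"
      using K unfolding in_AE_def by blast
    have "continuous_map D K (g \<circ> k)"
      using ck g(1) by (rule continuous_map_compose)
    moreover have "\<forall>x \<in> A. (g \<circ> k) x = f x"
      using g(2) kh AD by auto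
    ultimately show "\<exists>g. continuous_map D K g \<and> (\<forall>x \<in> A. g x = f x)"
      by blast
  qed
  ultimately show ?thesis by blast
qed

end

theory Submission
  imports Defs
begin

text \<open>
  The complex \<open>K\<close> retracts onto \<open>L\<close> and onto the sphere. The first retraction turns a
  domination of \<open>K\<close> by a finite complex into one of \<open>L\<close>, so \<open>K\<close> is not finitely dominated.
  Over a metrizable space \<open>Z\<close> the two retractions can be undone: \<open>K \<in> AE(Z)\<close> holds exactly
  when \<open>L \<in> AE(Z)\<close> and \<open>S\<^sup>2 \<in> AE(Z)\<close> (\<open>in_AE_wedgeD\<close>, \<open>in_AE_wedgeI\<close>). It remains to find a
  compactification of \<open>X\<close> for which \<open>L\<close> and \<open>S\<^sup>2\<close> are absolute extensors simultaneously.

  The sphere bounds the dimension: \<open>S\<^sup>2 \<in> AE(Z)\<close> passes to all higher spheres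
  (\<open>in_AE_nsphere_Suc\<close>), and a map from \<open>Z\<close> can therefore be pushed off every open cell of
  dimension at least 3 (\<open>push_off_cell\<close>, iterated in \<open>compress\<close>). This makes \<open>L\<close>
  interchangeable with its 2-skeleton, which is a finite complex because \<open>L\<close> has finite type.
  If \<open>L \<in> AE(X)\<close>, then the 2-skeleton is in \<open>AE(X)\<close> (\<open>skeleton_in_AE\<close>), although the values of a
  map from \<open>X\<close> may meet cells of all dimensions: locally they do not, and the map is compressed
  over larger and larger closed sets. Conversely, if the 2-skeleton is in \<open>AE(C)\<close> for a compact
  \<open>C\<close>, then \<open>L \<in> AE(C)\<close> (\<open>in_AE_of_skeleton\<close>): the image of a map from a closed subset of \<open>C\<close>
  lies in a finite subcomplex, the map extends to a neighbourhood since finite complexes are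
  neighbourhood retracts, and on the boundary of that neighbourhood it can be compressed.

  So only finitely many compact spaces \<open>P j\<close> have to be treated, each of them a neighbourhood
  retract of the countable power of the real line by a retraction \<open>r j\<close>
  (\<open>nbhd_retract_attach\<close>, \<open>nbhd_retract_stage\<close>). For these the compactification
  is built by hand (\<open>AE_compactification\<close>). Choose a countable family of bounded continuous
  functions on \<open>X\<close> that separates points from closed sets, is closed under rational polynomial
  operations, and contains the coordinates of a solution of every extension problem that finitely
  many of its members \<open>g\<close> pose: extend \<open>r j \<circ> g\<close> from the closed set where \<open>g\<close> is near \<open>P j\<close>.
  The closure \<open>C\<close> of the image of \<open>X\<close> under all these functions is a metrizable
  compactification. By the theorem of Stone and Weierstrass, an arbitrary extension problem on
  \<open>C\<close> with values in \<open>P j\<close> is a small perturbation of one that the family has solved, and the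
  retraction \<open>r j\<close> turns the perturbation into a homotopy by which the solution is corrected.
\<close>


section \<open>Absolute extensors\<close>

abbreviation R_omega :: "(nat \<Rightarrow> real) topology" where "R_omega \<equiv> euclidean"

lemma continuous_map_R_omega:
  "continuous_map X R_omega f \<longleftrightarrow> (\<forall>i. continuous_map X euclideanreal (\<lambda>x. f x i))"
  unfolding euclidean_product_topology[symmetric] continuous_map_componentwise_UNIV ..

lemma Tietze_R_omega:
  fixes f :: "'a \<Rightarrow> nat \<Rightarrow> real"
  assumes X: "normal_space X" and A: "closedin X A" and f: "continuous_map (subtopology X A) R_omega f"
  obtains g where "continuous_map X R_omega g" "\<forall>x\<in>A. g x = f x"
proof -
  have "\<exists>h. continuous_map X euclideanreal h \<and> (\<forall>x\<in>A. h x = f x i)" for i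
    using f X A by (metis (mono_tags, lifting) continuous_map_R_omega normal_space_iff_Tietze)
  then obtain h where "\<And>i. continuous_map X euclideanreal (h i)" "\<And>i x. x \<in> A \<Longrightarrow> h i x = f x i"
    by metis
  then show thesis
    using that[of "\<lambda>x i. h i x"] by (auto simp: continuous_map_R_omega)
qed

lemma in_AE_D:
  assumes "in_AE K X" "closedin X A" "continuous_map (subtopology X A) K f"
  obtains g where "continuous_map X K g" "\<forall>x\<in>A. g x = f x"
  using assms unfolding in_AE_def by blast

lemma in_AE_closed_subtopology:
  assumes K: "in_AE K X" and A: "closedin X A"
  shows "in_AE K (subtopology X A)"
  unfolding in_AE_def
proof (intro allI impI, elim conjE)
  fix B f assume B: "closedin (subtopology X A) B" and f: "continuous_map (subtopology (subtopology X A) B) K f"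
  have BA: "B \<subseteq> A" and BX: "closedin X B"
    using B A by (auto simp: closedin_closed_subtopology)
  then have "continuous_map (subtopology X B) K f"
    using f by (simp add: subtopology_subtopology Int_absorb1)
  then obtain g where g: "continuous_map X K g" "\<forall>x\<in>B. g x = f x"
    using in_AE_D[OF K BX] by metis
  then show "\<exists>g. continuous_map (subtopology X A) K g \<and> (\<forall>x\<in>B. g x = f x)"
    using continuous_map_from_subtopology by blast
qed

text \<open>An extension problem for the retract is solved in the larger space and retracted back.\<close>
lemma in_AE_retract:
  assumes K: "in_AE K X" and i: "continuous_map P K i" and r: "continuous_map K P r"
    and ri: "\<And>p. p \<in> topspace P \<Longrightarrow> r (i p) = p"
  shows "in_AE P X"
  unfolding in_AE_def
proof (intro allI impI, elim conjE)
  fix A f assume A: "closedin X A" and f: "continuous_map (subtopology X A) P f"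
  then obtain g where g: "continuous_map X K g" "\<forall>x\<in>A. g x = (i \<circ> f) x"
    using in_AE_D[OF K A continuous_map_compose[OF f i]] by blast
  have "f x \<in> topspace P" if "x \<in> A" for x
    using f that closedin_subset[OF A] by (auto simp: continuous_map_def Pi_iff)
  then have "continuous_map X P (r \<circ> g) \<and> (\<forall>x\<in>A. (r \<circ> g) x = f x)"
    using g continuous_map_compose[OF g(1) r] ri by simp
  then show "\<exists>g. continuous_map X P g \<and> (\<forall>x\<in>A. g x = f x)" by blast
qed

lemma in_AE_homeomorphic_target:
  assumes "K homeomorphic_space P"
  shows "in_AE K X \<longleftrightarrow> in_AE P X"
  using assms in_AE_retract unfolding homeomorphic_space_def homeomorphic_maps_def by metis

lemma in_AE_homeomorphic_domain:
  assumes XY: "X homeomorphic_space Y" and K: "in_AE K X"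
  shows "in_AE K Y"
  unfolding in_AE_def
proof (intro allI impI, elim conjE)
  fix A f assume A: "closedin Y A" and f: "continuous_map (subtopology Y A) K f"
  obtain h k where hk: "homeomorphic_maps X Y h k"
    using XY unfolding homeomorphic_space_def by blast
  have h: "continuous_map X Y h" and k: "continuous_map Y X k"
    and hk1: "\<And>y. y \<in> topspace Y \<Longrightarrow> h (k y) = y"
    using hk unfolding homeomorphic_maps_def by auto
  let ?B = "{x \<in> topspace X. h x \<in> A}"
  have B: "closedin X ?B"
    using closedin_continuous_map_preimage[OF h A] .
  have "continuous_map (subtopology X ?B) (subtopology Y A) h"
    using h by (auto simp: continuous_map_in_subtopology continuous_map_from_subtopology)
  then have fh: "continuous_map (subtopology X ?B) K (f \<circ> h)"
    using f by (rule continuous_map_compose)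
  obtain g where g: "continuous_map X K g" "\<forall>x\<in>?B. g x = (f \<circ> h) x"
    by (rule in_AE_D[OF K B fh])
  have "k y \<in> ?B" if "y \<in> A" for y
    using that closedin_subset[OF A] hk1[of y] k by (auto simp: continuous_map_def Pi_iff)
  then have "continuous_map Y K (g \<circ> k) \<and> (\<forall>x\<in>A. (g \<circ> k) x = f x)"
    using g continuous_map_compose[OF k g(1)] hk1 closedin_subset[OF A] by (auto simp: subset_iff)
  then show "\<exists>g. continuous_map Y K g \<and> (\<forall>x\<in>A. g x = f x)" by blast
qed

lemma continuous_map_on_two_closed:
  assumes "closedin X A" "closedin X B" "A \<union> B = topspace X"
    and "continuous_map (subtopology X A) Y f" "continuous_map (subtopology X B) Y f"
  shows "continuous_map X Y f"
  by (rule pasting_lemma_closed[where I = "{A,B}" and T = id and f = "\<lambda>_. f"])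
     (use assms in auto)

section \<open>Disks and spheres\<close>

definition nrm :: "nat \<Rightarrow> (nat \<Rightarrow> real) \<Rightarrow> real"
  where "nrm n x = L2_set x {..<n}"

definition unit_disk :: "nat \<Rightarrow> (nat \<Rightarrow> real) set"
  where "unit_disk n = {x. (\<forall>i\<ge>n. x i = 0) \<and> nrm n x \<le> 1}"

lemma nrm_nonneg [simp]: "0 \<le> nrm n x"
  by (simp add: nrm_def)

lemma nrm_scale: "nrm n (\<lambda>i. c * x i) = \<bar>c\<bar> * nrm n x"
  by (simp add: nrm_def L2_set_def power_mult_distrib real_sqrt_mult flip: sum_distrib_left)

lemma nrm_triangle: "nrm n (\<lambda>i. x i + y i) \<le> nrm n x + nrm n y"
  by (simp add: nrm_def L2_set_triangle_ineq)

lemma nrm_coord: "i < n \<Longrightarrow> \<bar>x i\<bar> \<le> nrm n x"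
  unfolding nrm_def using member_le_L2_set[of "{..<n}" i "\<lambda>i. \<bar>x i\<bar>"] by (simp add: L2_set_def)

lemma nrm_square: "(\<Sum>i<n. x i ^ 2) = nrm n x ^ 2"
  by (simp add: nrm_def L2_set_def sum_nonneg)

lemma nrm_square_eq_1: "(\<Sum>i<n. x i ^ 2) = 1 \<longleftrightarrow> nrm n x = 1"
proof -
  have "nrm n x \<noteq> - 1" using nrm_nonneg[of n x] by linarith
  then show ?thesis by (simp add: nrm_square power2_eq_1_iff)
qed

lemma continuous_map_nrm [continuous_intros]:
  assumes "\<And>i. continuous_map X euclideanreal (\<lambda>y. f y i)"
  shows "continuous_map X euclideanreal (\<lambda>y. nrm n (f y))"
  unfolding nrm_def L2_set_def
  by (intro continuous_intros assms) auto

lemma continuous_on_nrm [continuous_intros]: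
  assumes "continuous_on S f"
  shows "continuous_on S (\<lambda>y. nrm n (f y))"
  using continuous_map_nrm[of "top_of_set S" f n] assms continuous_on_product_then_coordinatewise[OF assms]
  by auto

lemma disk_eq: "disk n = top_of_set (unit_disk n)"
proof -
  have "{x. \<forall>i\<ge>n. x i = 0} \<inter> {x. (\<Sum>i<n. x i ^ 2) \<le> 1} = unit_disk n"
    by (auto simp: unit_disk_def nrm_square power_le_one_iff abs_square_le_1)
  then show ?thesis
    by (simp add: disk_def Euclidean_space_def subtopology_subtopology euclidean_product_topology)
qed

lemma disk_interior_eq: "disk_interior n = {x \<in> unit_disk n. nrm n x < 1}"
  by (auto simp: disk_interior_def disk_eq nrm_square abs_square_less_1)

lemma disk_boundary_eq: "disk_boundary n = {x \<in> unit_disk n. nrm n x = 1}"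
  by (simp add: disk_boundary_def disk_eq nrm_square_eq_1)

lemma nsphere_eq: "nsphere m = top_of_set {x \<in> unit_disk (Suc m). nrm (Suc m) x = 1}"
proof -
  have "{x. \<forall>i\<ge>Suc m. x i = 0} \<inter> {x. (\<Sum>i\<le>m. x i ^ 2) = 1} = {x \<in> unit_disk (Suc m). nrm (Suc m) x = 1}"
    using nrm_square_eq_1[of _ "Suc m"] by (auto simp: unit_disk_def lessThan_Suc_atMost)
  then show ?thesis
    by (simp add: nsphere_def Euclidean_space_def subtopology_subtopology euclidean_product_topology)
qed

lemma compact_unit_disk: "compact (unit_disk n)"
proof -
  let ?B = "PiE UNIV (\<lambda>i. {-1..1::real})"
  have "compactin R_omega ?B"
    unfolding euclidean_product_topology[symmetric] compactin_PiE by simp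
  moreover have "closed (unit_disk n)"
  proof -
    have "unit_disk n = (\<Inter>i\<in>{n..}. {x. x i = 0}) \<inter> {x. nrm n x \<le> 1}"
      by (auto simp: unit_disk_def)
    then show ?thesis
      by (auto intro!: closed_Int closed_INT closed_Collect_eq closed_Collect_le continuous_intros)
  qed
  moreover have "unit_disk n \<subseteq> ?B"
  proof
    fix x assume x: "x \<in> unit_disk n"
    have "\<bar>x i\<bar> \<le> 1" for i
      using x nrm_coord[of i n x] by (cases "i < n") (auto simp: unit_disk_def)
    then show "x \<in> ?B" by (auto simp: abs_le_iff minus_le_iff)
  qed
  ultimately show ?thesis
    using closed_compactin[of R_omega ?B "unit_disk n"] by simp
qed

text \<open>The radial retraction onto the unit disk, applied to the first \<open>n\<close> coordinates.\<close>
definition clip :: "nat \<Rightarrow> (nat \<Rightarrow> real) \<Rightarrow> nat \<Rightarrow> real"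
  where "clip n x = (\<lambda>i. if i < n then x i / max 1 (nrm n x) else 0)"

lemma nrm_cong: "(\<And>i. i < n \<Longrightarrow> x i = y i) \<Longrightarrow> nrm n x = nrm n y"
  by (simp add: nrm_def L2_set_def)

lemma nrm_clip: "nrm n (clip n x) = min 1 (nrm n x)"
proof -
  have "nrm n (clip n x) = nrm n (\<lambda>i. inverse (max 1 (nrm n x)) * x i)"
    by (rule nrm_cong) (simp add: clip_def field_simps)
  also have "\<dots> = nrm n x / max 1 (nrm n x)"
    by (simp add: nrm_scale divide_inverse max_def)
  finally show ?thesis
    by (auto simp: max_def min_def)
qed

lemma clip_unit_disk: "clip n x \<in> unit_disk n"
  using nrm_clip[of n x] by (simp add: unit_disk_def clip_def[of n x])

lemma clip_id: "x \<in> unit_disk n \<Longrightarrow> clip n x = x"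
  by (auto simp: unit_disk_def clip_def)

lemma continuous_map_clip:
  assumes "\<And>i. continuous_map X euclideanreal (\<lambda>y. f y i)"
  shows "continuous_map X euclideanreal (\<lambda>y. clip n (f y) i)"
proof (cases "i < n")
  case True
  then show ?thesis
    unfolding clip_def by (simp, intro continuous_intros assms) (auto simp: max_def)
qed (simp add: clip_def)

text \<open>The preimage of the equator is treated first, by the hypothesis on the lower sphere. It is the
  zero set \<open>E\<close> of an extension \<open>u\<close> of the last coordinate, and the sign of \<open>u\<close> then tells which
  hemisphere to use. Both hemispheres are graphs over the disk, so there the remaining coordinates
  can be extended by Tietze's theorem and clipped to the disk.\<close>
lemma in_AE_nsphere_Suc:
  assumes X: "normal_space X" and AE: "in_AE (nsphere m) X"
  shows "in_AE (nsphere (Suc m)) X"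
  unfolding in_AE_def
proof (intro allI impI, elim conjE)
  fix A f assume A: "closedin X A" and f: "continuous_map (subtopology X A) (nsphere (Suc m)) f"
  have AX: "A \<subseteq> topspace X" using A by (rule closedin_subset)
  have fc: "continuous_map (subtopology X A) euclideanreal (\<lambda>x. f x i)" for i
    using f by (simp add: nsphere_eq continuous_map_in_subtopology continuous_map_R_omega)
  have fD: "f x \<in> unit_disk (Suc (Suc m))" "nrm (Suc (Suc m)) (f x) = 1" if "x \<in> A" for x
    using f that AX by (auto simp: nsphere_eq continuous_map_in_subtopology)
  obtain u where u: "continuous_map X euclideanreal u" "\<forall>x\<in>A. u x = f x (Suc m)"
    using X A fc[of "Suc m"] unfolding normal_space_iff_Tietze by blast
  define E where "E = {x \<in> topspace X. u x = 0}"
  have E: "closedin X E"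
    using closedin_continuous_map_preimage[OF u(1), of "{0}"] by (simp add: E_def)
  have AE0: "closedin (subtopology X E) (A \<inter> E)"
    using A closedin_subtopology by blast
  have "continuous_map (subtopology X (A \<inter> E)) (nsphere (Suc m)) f"
    by (rule continuous_map_from_subtopology_mono[OF f]) simp
  moreover have "f x (Suc m) = 0" if "x \<in> A \<inter> E" for x
    using that u(2)[rule_format, of x] by (simp add: E_def)
  ultimately have "continuous_map (subtopology X (A \<inter> E)) (subtopology (nsphere (Suc m)) {x. x (Suc m) = 0}) f"
    unfolding continuous_map_in_subtopology by auto
  then have "continuous_map (subtopology (subtopology X E) (A \<inter> E)) (nsphere m) f"
    by (simp add: subtopology_subtopology subtopology_nsphere_equator Int_absorb1)
  then obtain e where e: "continuous_map (subtopology X E) (nsphere m) e" "\<forall>x\<in>A \<inter> E. e x = f x"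
    by (rule in_AE_D[OF in_AE_closed_subtopology[OF AE E] AE0])
  have ec: "continuous_map (subtopology X E) euclideanreal (\<lambda>x. e x i)" for i
    using e by (simp add: nsphere_eq continuous_map_in_subtopology continuous_map_R_omega)
  have eD: "e x \<in> unit_disk (Suc m)" "nrm (Suc m) (e x) = 1" if "x \<in> E" for x
    using e that by (auto simp: nsphere_eq continuous_map_in_subtopology E_def)
  define q where "q = (\<lambda>x. if x \<in> E then e x else f x)"
  have AEc: "closedin X (A \<union> E)" using A E by auto
  have "continuous_map (subtopology X (A \<union> E)) R_omega q"
  proof (rule continuous_map_on_two_closed)
    show "closedin (subtopology X (A \<union> E)) A" "closedin (subtopology X (A \<union> E)) E"
      using A E AEc by (auto simp: closedin_closed_subtopology)
    show "A \<union> E = topspace (subtopology X (A \<union> E))"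
      using AX E closedin_subset by auto
    have eq: "subtopology (subtopology X (A \<union> E)) A = subtopology X A"
      "subtopology (subtopology X (A \<union> E)) E = subtopology X E"
      by (simp_all add: subtopology_subtopology Int_absorb1)
    show "continuous_map (subtopology (subtopology X (A \<union> E)) A) R_omega q"
      unfolding eq by (rule continuous_map_eq[of _ _ f]) (use fc e(2) in \<open>auto simp: continuous_map_R_omega q_def\<close>)
    show "continuous_map (subtopology (subtopology X (A \<union> E)) E) R_omega q"
      unfolding eq by (rule continuous_map_eq[of _ _ e]) (use ec in \<open>auto simp: continuous_map_R_omega q_def\<close>)
  qed
  then obtain p where p: "continuous_map X R_omega p" "\<forall>x\<in>A \<union> E. p x = q x"
    by (rule Tietze_R_omega[OF X AEc])
  define c where "c = (\<lambda>x. clip (Suc m) (p x))"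
  have cc: "continuous_map X euclideanreal (\<lambda>x. c x i)" for i
    using p(1) unfolding c_def by (auto intro: continuous_map_clip simp: continuous_map_R_omega)
  define h where "h = (\<lambda>x. sqrt (1 - nrm (Suc m) (c x) ^ 2))"
  have hc: "continuous_map X euclideanreal h"
    unfolding h_def by (intro continuous_intros cc)
  have c1: "nrm (Suc m) (c x) \<le> 1" for x
    using clip_unit_disk[of "Suc m" "p x"] by (simp add: c_def unit_disk_def)
  have hE: "h x = 0" if "x \<in> E" for x
  proof -
    have "c x = e x"
      using that p(2) eD[OF that] by (simp add: c_def q_def clip_id)
    then show ?thesis using eD[OF that] by (simp add: h_def)
  qed
  define k where "k = (\<lambda>x. if 0 \<le> u x then h x else - h x)"
  have kc: "continuous_map X euclideanreal k"
    unfolding k_def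
    by (rule continuous_map_cases_le) (auto intro!: continuous_map_from_subtopology hc u continuous_intros simp: hE E_def)
  define g where "g = (\<lambda>x i. if i = Suc m then k x else c x i)"
  have nrm2: "nrm (Suc (Suc m)) y ^ 2 = nrm (Suc m) y ^ 2 + y (Suc m) ^ 2" for y
    by (simp flip: nrm_square)
  have k2: "k x ^ 2 = 1 - nrm (Suc m) (c x) ^ 2" for x
    using c1[of x] by (simp add: k_def h_def power_le_one)
  have gn: "nrm (Suc (Suc m)) (g x) = 1" for x
  proof -
    have "nrm (Suc m) (g x) = nrm (Suc m) (c x)"
      by (rule nrm_cong) (simp add: g_def)
    then have "nrm (Suc (Suc m)) (g x) ^ 2 = 1"
      using k2[of x] by (simp add: nrm2) (simp add: g_def)
    then show ?thesis
      using nrm_square_eq_1[of "g x" "Suc (Suc m)"] nrm_square[of "g x" "Suc (Suc m)"] by simp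
  qed
  have gD: "g x \<in> unit_disk (Suc (Suc m))" for x
    using clip_unit_disk[of "Suc m" "p x"] gn[of x] by (auto simp: unit_disk_def g_def c_def)
  have "continuous_map X euclideanreal (\<lambda>x. g x i)" for i
    using cc kc by (cases "i = Suc m") (auto simp: g_def)
  then have "continuous_map X (nsphere (Suc m)) g"
    using gn gD by (auto simp: nsphere_eq continuous_map_in_subtopology continuous_map_R_omega)
  moreover have "g x = f x" if x: "x \<in> A" for x
  proof -
    have px: "p x = f x"
      using x p(2) e(2) by (auto simp: q_def)
    have f1: "nrm (Suc m) (f x) ^ 2 + f x (Suc m) ^ 2 = 1"
      using fD[OF x] nrm2[of "f x"] by simp
    then have "nrm (Suc m) (f x) ^ 2 \<le> 1" by (smt (verit) zero_le_power2)
    then have le: "nrm (Suc m) (f x) \<le> 1" by (simp add: power_le_one_iff abs_square_le_1)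
    then have ci: "c x i = (if i < Suc m then f x i else 0)" for i
      by (simp add: c_def clip_def px)
    have "nrm (Suc m) (c x) = nrm (Suc m) (f x)"
      by (rule nrm_cong) (simp add: ci)
    then have "h x = \<bar>f x (Suc m)\<bar>"
      using f1 by (simp add: h_def algebra_simps flip: real_sqrt_abs)
    then have "k x = f x (Suc m)"
      using u(2) x by (auto simp: k_def)
    then show ?thesis
      using ci fD(1)[OF x] by (auto simp: g_def unit_disk_def fun_eq_iff less_Suc_eq_le not_le)
  qed
  ultimately show "\<exists>g. continuous_map X (nsphere (Suc m)) g \<and> (\<forall>x\<in>A. g x = f x)" by blast
qed

section \<open>A space with one cell attached\<close>

text \<open>Maps from compact spaces to a Hausdorff space are closed, so the two maps together form a
  quotient map.\<close>
lemma continuous_map_from_compact_cover: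
  assumes K: "compact_space K" "compact_space K'" and Q: "Hausdorff_space Q"
    and p: "continuous_map K Q p" "continuous_map K' Q p'"
    and top: "topspace Q \<subseteq> p ` topspace K \<union> p' ` topspace K'"
    and h: "continuous_map K T (h \<circ> p)" "continuous_map K' T (h \<circ> p')"
  shows "continuous_map Q T h"
  unfolding continuous_map_closedin
proof (intro conjI allI impI)
  have "h (p k) \<in> topspace T" if "k \<in> topspace K" for k
    using continuous_map_image_subset_topspace[OF h(1)] that by auto
  moreover have "h (p' k) \<in> topspace T" if "k \<in> topspace K'" for k
    using continuous_map_image_subset_topspace[OF h(2)] that by auto
  ultimately show "h \<in> topspace Q \<rightarrow> topspace T"
    using top by blast
next
  fix C assume C: "closedin T C"
  have "p ` topspace K \<subseteq> topspace Q" "p' ` topspace K' \<subseteq> topspace Q"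
    using p continuous_map_image_subset_topspace by blast+
  then have "{x \<in> topspace Q. h x \<in> C} =
      p ` {k \<in> topspace K. (h \<circ> p) k \<in> C} \<union> p' ` {k \<in> topspace K'. (h \<circ> p') k \<in> C}"
    using top by auto
  moreover have "closedin Q (p ` {k \<in> topspace K. (h \<circ> p) k \<in> C})"
    using continuous_imp_closed_map[OF p(1) K(1) Q] closedin_continuous_map_preimage[OF h(1) C]
    by (auto simp: closed_map_def)
  moreover have "closedin Q (p' ` {k \<in> topspace K'. (h \<circ> p') k \<in> C})"
    using continuous_imp_closed_map[OF p(2) K(2) Q] closedin_continuous_map_preimage[OF h(2) C]
    by (auto simp: closed_map_def)
  ultimately show "closedin Q {x \<in> topspace Q. h x \<in> C}"
    by (simp add: closedin_Un)
qed

lemma unit_disk_scale: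
  assumes "z \<in> unit_disk n" "0 \<le> c" "c * nrm n z \<le> 1"
  shows "(\<lambda>i. c * z i) \<in> unit_disk n"
  using assms by (simp add: unit_disk_def nrm_scale)

text \<open>The space \<open>Q\<close> arises from \<open>S\<close> by attaching one \<open>n\<close>-cell with characteristic map \<open>\<Phi>\<close>. Compactness makes
  \<open>\<Phi>\<close> a homeomorphism on the open disk once it is injective there.\<close>
locale cell_attachment =
  fixes Q :: "'a topology" and S :: "'a set" and n :: nat and \<Phi> :: "(nat \<Rightarrow> real) \<Rightarrow> 'a"
  assumes compact_Q: "compact_space Q" and Hausdorff_Q: "Hausdorff_space Q"
    and closed_S: "closedin Q S"
    and cont_\<Phi>: "continuous_map (top_of_set (unit_disk n)) Q \<Phi>"
    and \<Phi>_boundary: "\<And>z. z \<in> unit_disk n \<Longrightarrow> nrm n z = 1 \<Longrightarrow> \<Phi> z \<in> S"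
    and \<Phi>_interior: "\<Phi> ` {z \<in> unit_disk n. nrm n z < 1} = topspace Q - S"
    and inj_\<Phi>: "inj_on \<Phi> {z \<in> unit_disk n. nrm n z < 1}"
begin

definition pos :: "'a \<Rightarrow> nat \<Rightarrow> real"
  where "pos = inv_into {z \<in> unit_disk n. nrm n z < 1} \<Phi>"

text \<open>The coordinates \<open>pos\<close> of the open cell have in general no continuous extension to \<open>S\<close>. Multiplied by the
  distance \<open>depth\<close> from the boundary of the disk they do, with value 0, and where \<open>depth\<close> is positive
  they are recovered by division.\<close>
definition depth :: "'a \<Rightarrow> real"
  where "depth q = (if q \<in> S then 0 else 1 - nrm n (pos q))"

definition damped :: "'a \<Rightarrow> nat \<Rightarrow> real"
  where "damped q = (\<lambda>i. depth q * pos q i)"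

text \<open>A deformation rel \<open>S\<close> that moves points of the cell radially outwards. At time 1 it maps
  everything outside the inner half of the cell to \<open>S\<close>, by the radial projection.\<close>
definition stretch :: "'a \<Rightarrow> real \<Rightarrow> 'a"
  where "stretch q t = (if q \<in> S then q else \<Phi> (clip n (\<lambda>i. (1 + t) * pos q i)))"

lemma S_sub: "S \<subseteq> topspace Q"
  using closed_S by (rule closedin_subset)

lemma \<Phi>_top: "z \<in> unit_disk n \<Longrightarrow> \<Phi> z \<in> topspace Q"
  using continuous_map_image_subset_topspace[OF cont_\<Phi>] by auto

lemma \<Phi>_notin: "z \<in> unit_disk n \<Longrightarrow> nrm n z < 1 \<Longrightarrow> \<Phi> z \<notin> S"
  using \<Phi>_interior by blast

lemma nrm_le: "z \<in> unit_disk n \<Longrightarrow> nrm n z \<le> 1"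
  by (simp add: unit_disk_def)

lemma pos_\<Phi>: "z \<in> unit_disk n \<Longrightarrow> nrm n z < 1 \<Longrightarrow> pos (\<Phi> z) = z"
  unfolding pos_def by (rule inv_into_f_f[OF inj_\<Phi>]) simp

lemma cell_cases:
  assumes "q \<in> topspace Q"
  obtains "q \<in> S" | z where "z \<in> unit_disk n" "nrm n z < 1" "q = \<Phi> z"
  using assms \<Phi>_interior by blast

lemma depth_\<Phi>: "z \<in> unit_disk n \<Longrightarrow> depth (\<Phi> z) = 1 - nrm n z"
  using \<Phi>_boundary[of z] \<Phi>_notin[of z] pos_\<Phi>[of z] nrm_le[of z]
  by (cases "nrm n z = 1") (auto simp: depth_def)

lemma damped_\<Phi>: "z \<in> unit_disk n \<Longrightarrow> damped (\<Phi> z) = (\<lambda>i. (1 - nrm n z) * z i)"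
  using depth_\<Phi>[of z] pos_\<Phi>[of z] nrm_le[of z]
  by (cases "nrm n z = 1") (auto simp: damped_def)

lemma depth_S [simp]: "q \<in> S \<Longrightarrow> depth q = 0"
  by (simp add: depth_def)

lemma damped_S: "q \<in> S \<Longrightarrow> damped q = (\<lambda>i. 0)"
  by (simp add: damped_def)

lemma depth_range: "q \<in> topspace Q \<Longrightarrow> 0 \<le> depth q \<and> depth q \<le> 1"
  by (erule cell_cases) (auto simp: depth_\<Phi>)

lemma depth_eq_0: "q \<in> topspace Q \<Longrightarrow> depth q = 0 \<longleftrightarrow> q \<in> S"
  by (erule cell_cases) (auto simp: depth_\<Phi> dest: \<Phi>_notin)

lemma depth_pos:
  assumes "q \<in> topspace Q" "0 < depth q"
  shows "(\<lambda>i. damped q i / depth q) \<in> unit_disk n" "\<Phi> (\<lambda>i. damped q i / depth q) = q"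
    "nrm n (\<lambda>i. damped q i / depth q) = 1 - depth q"
proof -
  obtain z where z: "z \<in> unit_disk n" "nrm n z < 1" "q = \<Phi> z"
    using assms by (metis cell_cases depth_S less_irrefl)
  then have "(\<lambda>i. damped q i / depth q) = z"
    by (simp add: depth_\<Phi> damped_\<Phi>)
  then show "(\<lambda>i. damped q i / depth q) \<in> unit_disk n" "\<Phi> (\<lambda>i. damped q i / depth q) = q"
    "nrm n (\<lambda>i. damped q i / depth q) = 1 - depth q"
    using z by (simp_all add: depth_\<Phi>)
qed

lemma stretch_S [simp]: "q \<in> S \<Longrightarrow> stretch q t = q"
  by (simp add: stretch_def)

lemma stretch_\<Phi>:
  assumes z: "z \<in> unit_disk n" and t: "0 \<le> t"
  shows "stretch (\<Phi> z) t = \<Phi> (clip n (\<lambda>i. (1 + t) * z i))"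
proof (cases "nrm n z = 1")
  case True
  then have "nrm n (\<lambda>i. (1 + t) * z i) = 1 + t"
    using t by (simp add: nrm_scale)
  then have "clip n (\<lambda>i. (1 + t) * z i) = z"
    using t z by (auto simp: clip_def max_def unit_disk_def)
  then show ?thesis
    using \<Phi>_boundary[OF z True] by simp
next
  case False
  then show ?thesis
    using pos_\<Phi>[OF z] \<Phi>_notin[OF z] nrm_le[OF z] by (simp add: stretch_def)
qed

lemma stretch_0: "q \<in> topspace Q \<Longrightarrow> stretch q 0 = q"
  by (erule cell_cases) (auto simp: stretch_\<Phi> clip_id)

lemma stretch_top: "q \<in> topspace Q \<Longrightarrow> 0 \<le> t \<Longrightarrow> stretch q t \<in> topspace Q"
  using \<Phi>_top[OF clip_unit_disk] by (simp add: stretch_def)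

lemma depth_stretch:
  assumes z: "z \<in> unit_disk n" and t: "0 \<le> t"
  shows "depth (stretch (\<Phi> z) t) = 1 - min 1 ((1 + t) * nrm n z)"
  using t by (simp add: stretch_\<Phi>[OF z t] depth_\<Phi>[OF clip_unit_disk] nrm_clip nrm_scale)

lemma stretch_1:
  assumes q: "q \<in> topspace Q" and d: "depth q \<le> 1/2"
  shows "stretch q 1 \<in> S"
  using q
proof (cases rule: cell_cases)
  case (2 z)
  then have "depth (stretch q 1) = 0"
    using d by (simp add: depth_stretch depth_\<Phi>)
  then show ?thesis
    using stretch_top[OF q, of 1] depth_eq_0 by simp
qed simp

text \<open>Continuity on \<open>Q\<close> is tested on \<open>S\<close> and on the disk. This replaces all reasoning about the
  topology near the places where the boundary of the cell is glued to \<open>S\<close>.\<close>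
lemma continuous_map_from_cell:
  assumes "continuous_map (subtopology Q S) T h" "continuous_map (top_of_set (unit_disk n)) T (h \<circ> \<Phi>)"
  shows "continuous_map Q T h"
proof (rule continuous_map_from_compact_cover[OF _ _ Hausdorff_Q])
  show "compact_space (subtopology Q S)"
    using closedin_compact_space[OF compact_Q closed_S] by (simp add: compact_space_subtopology)
  show "compact_space (top_of_set (unit_disk n))"
    by (simp add: compact_space_subtopology compact_unit_disk)
  show "continuous_map (subtopology Q S) Q id"
    using continuous_map_from_subtopology by fastforce
  show "topspace Q \<subseteq> id ` topspace (subtopology Q S) \<union> \<Phi> ` topspace (top_of_set (unit_disk n))"
    using \<Phi>_interior by auto
qed (use assms cont_\<Phi> in auto)

lemma continuous_depth: "continuous_map Q euclideanreal depth"
proof (rule continuous_map_from_cell)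
  show "continuous_map (subtopology Q S) euclideanreal depth"
    by (rule continuous_map_eq[of _ _ "\<lambda>q. 0"]) auto
  have "continuous_on (unit_disk n) (\<lambda>z. 1 - nrm n z)"
    by (intro continuous_intros)
  then show "continuous_map (top_of_set (unit_disk n)) euclideanreal (depth \<circ> \<Phi>)"
    by (simp add: depth_\<Phi> cong: continuous_on_cong)
qed

lemma continuous_damped: "continuous_map Q R_omega damped"
proof (rule continuous_map_from_cell)
  show "continuous_map (subtopology Q S) R_omega damped"
    by (rule continuous_map_eq[of _ _ "\<lambda>q i. 0"]) (auto simp: damped_S)
  have "continuous_on (unit_disk n) (\<lambda>z i. (1 - nrm n z) * z i)"
    by (intro continuous_on_coordinatewise_then_product continuous_intros
        continuous_on_subset[OF continuous_on_product_coordinates]) auto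
  then show "continuous_map (top_of_set (unit_disk n)) R_omega (damped \<circ> \<Phi>)"
    by (simp add: damped_\<Phi> cong: continuous_on_cong)
qed

lemma continuous_stretch:
  "continuous_map (prod_topology Q (top_of_set {0..1})) Q (\<lambda>(q, t). stretch q t)"
proof (rule continuous_map_from_compact_cover)
  let ?I = "top_of_set {0..1::real}"
  let ?p = "\<lambda>(z, t). (\<Phi> z, t)"
  have I: "compact_space ?I" by (simp add: compact_space_subtopology)
  have "compact_space (subtopology Q S)"
    using closedin_compact_space[OF compact_Q closed_S] by (simp add: compact_space_subtopology)
  then show "compact_space (prod_topology (subtopology Q S) ?I)"
    using I by (simp add: compact_space_prod_topology)
  show "compact_space (prod_topology (top_of_set (unit_disk n)) ?I)"
    using I by (subst compact_space_prod_topology) (simp add: compact_space_subtopology compact_unit_disk)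
  show "Hausdorff_space (prod_topology Q ?I)"
    by (simp add: Hausdorff_space_prod_topology Hausdorff_Q Hausdorff_space_subtopology)
  show "continuous_map (prod_topology (subtopology Q S) ?I) (prod_topology Q ?I) id"
    unfolding prod_topology_subtopology(1) by (simp add: continuous_map_from_subtopology)
  show "continuous_map (prod_topology (top_of_set (unit_disk n)) ?I) (prod_topology Q ?I) ?p"
    unfolding case_prod_unfold
    by (intro continuous_map_pairedI continuous_map_snd continuous_map_compose[OF continuous_map_fst cont_\<Phi>, unfolded o_def])
  show "topspace (prod_topology Q ?I) \<subseteq> id ` topspace (prod_topology (subtopology Q S) ?I) \<union>
      ?p ` topspace (prod_topology (top_of_set (unit_disk n)) ?I)"
    using \<Phi>_interior by (force simp: image_iff)
  show "continuous_map (prod_topology (subtopology Q S) ?I) Q ((\<lambda>(q, t). stretch q t) \<circ> id)"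
    by (rule continuous_map_eq[of _ _ fst])
      (use continuous_map_compose[OF continuous_map_fst continuous_map_from_subtopology[OF continuous_map_id, of Q S]] in
        \<open>auto simp: o_def id_def\<close>)
  have c: "continuous_map (prod_topology (top_of_set (unit_disk n)) ?I) (top_of_set (unit_disk n))
        (\<lambda>(z, t). clip n (\<lambda>i. (1 + t) * z i))"
  proof -
    have "continuous_map (prod_topology (top_of_set (unit_disk n)) ?I) euclideanreal (\<lambda>zt. fst zt i)" for i
      using continuous_on_product_then_coordinatewise[OF continuous_on_fst[OF continuous_on_id],
          of "unit_disk n \<times> {0..1::real}" i] by simp
    moreover have "continuous_map (prod_topology (top_of_set (unit_disk n)) ?I) euclideanreal (\<lambda>zt. snd zt)"
      using continuous_map_snd[of "top_of_set (unit_disk n)" ?I] by (simp add: continuous_map_in_subtopology)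
    ultimately show ?thesis
      unfolding case_prod_unfold continuous_map_in_subtopology continuous_map_R_omega
      by (intro conjI allI continuous_map_clip continuous_intros) (auto simp: clip_unit_disk)
  qed
  show "continuous_map (prod_topology (top_of_set (unit_disk n)) ?I) Q ((\<lambda>(q, t). stretch q t) \<circ> ?p)"
    by (rule continuous_map_eq[OF continuous_map_compose[OF c cont_\<Phi>]]) (auto simp: stretch_\<Phi>)
qed

lemma continuous_map_stretch_compose:
  assumes v: "continuous_map Y Q v" and \<tau>: "continuous_map Y (top_of_set {0..1::real}) \<tau>"
  shows "continuous_map Y Q (\<lambda>y. stretch (v y) (\<tau> y))"
  using continuous_map_compose[OF continuous_map_pairedI[OF v \<tau>] continuous_stretch] by (simp add: o_def)

text \<open>Where \<open>depth (v y) \<le> 1/2\<close> the map is moved towards \<open>S\<close> by radial stretching. Over the inner half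
  of the cell the lifted map \<open>\<zeta>\<close> to the disk is deformed linearly to a map \<open>\<theta>\<close> into the boundary
  sphere that exists because the sphere is an absolute extensor. The function \<open>\<tau>\<close> is the time up
  to which this deformation is carried out at each point.\<close>
lemma push_off_cell:
  assumes v: "continuous_map Y Q v" and \<tau>: "continuous_map Y (top_of_set {0..1::real}) \<tau>"
    and n: "n = Suc m" and AE: "in_AE (nsphere m) Y"
  obtains v' where "continuous_map Y Q v'"
    "\<forall>y\<in>topspace Y. (\<tau> y = 0 \<or> v y \<in> S \<longrightarrow> v' y = v y) \<and> (\<tau> y = 1 \<longrightarrow> v' y \<in> S)"
proof -
  define \<zeta> where "\<zeta> = (\<lambda>y i. damped (v y) i / depth (v y))"
  have vQ: "v y \<in> topspace Q" if "y \<in> topspace Y" for y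
    using continuous_map_image_subset_topspace[OF v] that by auto
  have \<tau>01: "0 \<le> \<tau> y \<and> \<tau> y \<le> 1" if "y \<in> topspace Y" for y
    using \<tau> that by (auto simp: continuous_map_in_subtopology)
  have \<tau>c: "continuous_map Y euclideanreal \<tau>"
    using \<tau> by (simp add: continuous_map_in_subtopology)
  have dc: "continuous_map Y euclideanreal (\<lambda>y. depth (v y))"
    using continuous_map_compose[OF v continuous_depth] by (simp add: o_def)
  have wc: "continuous_map Y euclideanreal (\<lambda>y. damped (v y) i)" for i
    using continuous_map_compose[OF v continuous_damped] by (simp add: continuous_map_R_omega o_def)
  define F where "F = {y \<in> topspace Y. 1/2 \<le> depth (v y)}"
  define D where "D = {y \<in> topspace Y. depth (v y) = 1/2}"
  have D: "closedin Y D"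
    using closedin_continuous_map_preimage[OF dc, of "{1/2}"] by (simp add: D_def)
  have \<zeta>c: "continuous_map (subtopology Y F) euclideanreal (\<lambda>y. \<zeta> y i)" for i
    unfolding \<zeta>_def
    by (intro continuous_intros continuous_map_from_subtopology dc wc) (auto simp: F_def)
  have \<zeta>D: "\<zeta> y \<in> unit_disk n" "\<Phi> (\<zeta> y) = v y" "nrm n (\<zeta> y) = 1 - depth (v y)" if "y \<in> F" for y
    using depth_pos[of "v y"] that vQ by (auto simp: F_def \<zeta>_def)
  have DF: "D \<subseteq> F" by (auto simp: D_def F_def)
  have "continuous_map (subtopology Y D) euclideanreal (\<lambda>y. 2 * \<zeta> y i)" for i
    by (intro continuous_intros continuous_map_from_subtopology_mono[OF \<zeta>c DF])
  moreover have "(\<lambda>i. 2 * \<zeta> y i) \<in> unit_disk n" "nrm n (\<lambda>i. 2 * \<zeta> y i) = 1" if "y \<in> D" for y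
    using \<zeta>D[of y] that DF by (auto simp: D_def nrm_scale intro!: unit_disk_scale)
  ultimately have "continuous_map (subtopology Y D) (nsphere m) (\<lambda>y i. 2 * \<zeta> y i)"
    using n by (auto simp: nsphere_eq continuous_map_in_subtopology continuous_map_R_omega)
  then obtain \<theta> where \<theta>: "continuous_map Y (nsphere m) \<theta>" "\<forall>y\<in>D. \<theta> y = (\<lambda>i. 2 * \<zeta> y i)"
    by (rule in_AE_D[OF AE D])
  have \<theta>c: "continuous_map Y euclideanreal (\<lambda>y. \<theta> y i)" for i
    using \<theta>(1) by (simp add: nsphere_eq continuous_map_in_subtopology continuous_map_R_omega)
  have \<theta>D: "\<theta> y \<in> unit_disk n" "nrm n (\<theta> y) = 1" if "y \<in> topspace Y" for y
    using \<theta>(1) that n by (auto simp: nsphere_eq continuous_map_in_subtopology)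
  define c where "c = (\<lambda>y i. (1 - \<tau> y) * \<zeta> y i + \<tau> y * \<theta> y i)"
  have cD: "c y \<in> unit_disk n" if "y \<in> F" for y
  proof -
    have y: "y \<in> topspace Y" using that by (simp add: F_def)
    have "nrm n (c y) \<le> (1 - \<tau> y) * nrm n (\<zeta> y) + \<tau> y * nrm n (\<theta> y)"
      unfolding c_def using nrm_triangle[of n "\<lambda>i. (1 - \<tau> y) * \<zeta> y i" "\<lambda>i. \<tau> y * \<theta> y i"] \<tau>01[OF y]
      by (simp add: nrm_scale)
    also have "\<dots> \<le> 1"
      using \<tau>01[OF y] \<theta>D[OF y] mult_left_mono[OF nrm_le[OF \<zeta>D(1)[OF that]], of "1 - \<tau> y"] by simp
    finally show ?thesis
      using \<zeta>D(1)[OF that] \<theta>D(1)[OF y] by (auto simp: unit_disk_def c_def)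
  qed
  define v' where "v' = (\<lambda>y. if 1/2 \<le> depth (v y) then \<Phi> (c y) else stretch (v y) (\<tau> y))"
  have "continuous_map Y Q v'"
    unfolding v'_def
  proof (rule continuous_map_cases_le)
    show "continuous_map (subtopology Y {x \<in> topspace Y. depth (v x) \<le> 1/2}) Q (\<lambda>y. stretch (v y) (\<tau> y))"
      by (intro continuous_map_from_subtopology continuous_map_stretch_compose v \<tau>)
    have "continuous_map (subtopology Y F) (top_of_set (unit_disk n)) c"
      unfolding continuous_map_in_subtopology continuous_map_R_omega c_def
      by (intro conjI allI continuous_intros \<zeta>c continuous_map_from_subtopology \<theta>c \<tau>c)
        (use cD in \<open>auto simp: c_def\<close>)
    then show "continuous_map (subtopology Y {x \<in> topspace Y. 1/2 \<le> depth (v x)}) Q (\<lambda>y. \<Phi> (c y))"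
      using continuous_map_compose[OF _ cont_\<Phi>] by (auto simp: F_def o_def)
    show "\<Phi> (c y) = stretch (v y) (\<tau> y)" if y: "y \<in> topspace Y" "1/2 = depth (v y)" for y
    proof -
      have yF: "y \<in> F" and yD: "y \<in> D" using y by (auto simp: F_def D_def)
      have "c y = (\<lambda>i. (1 + \<tau> y) * \<zeta> y i)"
        using \<theta>(2) yD by (auto simp: c_def algebra_simps)
      moreover have "stretch (v y) (\<tau> y) = \<Phi> (clip n (\<lambda>i. (1 + \<tau> y) * \<zeta> y i))"
        using stretch_\<Phi>[OF \<zeta>D(1)[OF yF], of "\<tau> y"] \<tau>01[OF y(1)] \<zeta>D(2)[OF yF] by simp
      ultimately show ?thesis
        using clip_id[OF cD[OF yF]] by simp
    qed
  qed (use dc in auto)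
  moreover have "v' y = v y" if y: "y \<in> topspace Y" "\<tau> y = 0 \<or> v y \<in> S" for y
    using y vQ[OF y(1)] \<zeta>D[of y] by (auto simp: v'_def c_def F_def stretch_0)
  moreover have "v' y \<in> S" if y: "y \<in> topspace Y" "\<tau> y = 1" for y
  proof (cases "1/2 \<le> depth (v y)")
    case True
    then show ?thesis
      using y \<Phi>_boundary \<theta>D[OF y(1)] by (simp add: v'_def c_def)
  next
    case False
    then show ?thesis
      using y stretch_1[OF vQ[OF y(1)]] by (simp add: v'_def)
  qed
  ultimately show thesis
    using that by blast
qed

end

section \<open>Neighbourhood retracts\<close>

text \<open>By Tietze's theorem maps into \<open>R_omega\<close> extend from closed subsets of normal spaces, so maps into
  such a \<open>P\<close> extend to a neighbourhood. The linear structure of \<open>R_omega\<close> makes nearby maps to \<open>P\<close>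
  homotopic, along segments followed by \<open>r\<close>.\<close>
definition nbhd_retract :: "'a topology \<Rightarrow> bool"
  where "nbhd_retract P \<longleftrightarrow> (\<exists>(\<iota> :: 'a \<Rightarrow> nat \<Rightarrow> real) U r.
     continuous_map P euclidean \<iota> \<and> open U \<and> \<iota> ` topspace P \<subseteq> U \<and>
     continuous_map (top_of_set U) P r \<and> (\<forall>p\<in>topspace P. r (\<iota> p) = p))"

text \<open>The coordinates of the three factors are interleaved to obtain an embedding into a single \<open>R_omega\<close>.\<close>
lemma nbhd_retractI_triple:
  fixes j :: "'a \<Rightarrow> (nat \<Rightarrow> real) \<times> (nat \<Rightarrow> real) \<times> real"
  assumes j: "continuous_map P euclidean j" and U: "open U" "j ` topspace P \<subseteq> U"
    and r: "continuous_map (top_of_set U) P r" and rj: "\<And>p. p \<in> topspace P \<Longrightarrow> r (j p) = p"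
  shows "nbhd_retract P"
proof -
  define enc :: "(nat \<Rightarrow> real) \<times> (nat \<Rightarrow> real) \<times> real \<Rightarrow> nat \<Rightarrow> real" where
    "enc z = (\<lambda>i. if i mod 3 = 0 then fst z (i div 3)
        else if i mod 3 = 1 then fst (snd z) (i div 3) else snd (snd z))" for z
  define dec :: "(nat \<Rightarrow> real) \<Rightarrow> (nat \<Rightarrow> real) \<times> (nat \<Rightarrow> real) \<times> real" where
    "dec y = (\<lambda>i. y (3 * i), \<lambda>i. y (3 * i + 1), y 2)" for y
  have "Suc (3 * i) div 3 = i" "Suc (3 * i) mod 3 = 1" for i :: nat by presburger+
  then have de: "dec (enc z) = z" for z
    by (cases z) (auto simp: dec_def enc_def fun_eq_iff)
  have "continuous_on UNIV (\<lambda>z. enc z i)" for i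
    unfolding enc_def
    by (cases "i mod 3 = 0"; cases "i mod 3 = 1")
      (auto intro!: continuous_on_product_then_coordinatewise continuous_on_fst continuous_on_snd continuous_on_id)
  then have enc: "continuous_on UNIV enc"
    using continuous_on_coordinatewise_then_product by blast
  have dec: "continuous_on UNIV dec"
    unfolding dec_def
    by (intro continuous_on_Pair continuous_on_coordinatewise_then_product continuous_on_product_coordinates)
  have "continuous_map P euclidean (enc \<circ> j)"
    using continuous_map_compose[OF j, of euclidean enc] enc by simp
  moreover have "open (dec -` U)"
    using dec U(1) by (simp add: continuous_on_open_vimage)
  moreover have "(enc \<circ> j) ` topspace P \<subseteq> dec -` U"
    using U(2) by (auto simp: de)
  moreover have "continuous_map (top_of_set (dec -` U)) (top_of_set U) dec"
    using continuous_on_subset[OF dec] by auto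
  then have "continuous_map (top_of_set (dec -` U)) P (r \<circ> dec)"
    using r continuous_map_compose by blast
  moreover have "\<forall>p\<in>topspace P. (r \<circ> dec) ((enc \<circ> j) p) = p"
    by (simp add: de rj)
  ultimately show ?thesis
    unfolding nbhd_retract_def by blast
qed

lemma coordinate_le_dist:
  fixes x y :: "nat \<Rightarrow> real"
  shows "(1/2) ^ to_nat i * min \<bar>x i - y i\<bar> 1 \<le> dist x y"
proof -
  let ?f = "\<lambda>n. (1/2) ^ n * min (dist (x (from_nat n)) (y (from_nat n))) (1::real)"
  have "summable ?f"
    by (rule summable_comparison_test'[of "\<lambda>n. (1/2)^n"]) (auto simp: summable_geometric_iff)
  then have "sum ?f {to_nat i} \<le> dist x y"
    unfolding dist_fun_def by (intro sum_le_suminf) auto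
  then show ?thesis
    by (simp add: dist_real_def)
qed

lemma coordinate_uniform:
  fixes e :: real
  assumes "0 < e"
  obtains d where "0 < d" "\<And>x y :: nat \<Rightarrow> real. dist x y < d \<Longrightarrow> \<bar>x i - y i\<bar> < e"
proof
  let ?d = "(1/2) ^ to_nat i * min e 1"
  show "0 < ?d" using assms by simp
  fix x y :: "nat \<Rightarrow> real" assume "dist x y < ?d"
  then have "(1/2) ^ to_nat i * min \<bar>x i - y i\<bar> 1 < (1/2) ^ to_nat i * min e 1"
    using coordinate_le_dist[of i x y] by linarith
  then have "min \<bar>x i - y i\<bar> 1 < min e 1"
    using mult_less_cancel_left_pos[of "(1/2::real) ^ to_nat i"] by simp
  then show "\<bar>x i - y i\<bar> < e" by linarith
qed

text \<open>Serves functions that are given by division by \<open>s\<close>: where \<open>s\<close> vanishes, only a bound is left to check.\<close>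
lemma continuous_on_extend_by_zero:
  fixes f s :: "'z::t2_space \<Rightarrow> real"
  assumes s: "continuous_on UNIV s" and H: "open H"
    and f: "continuous_on (H \<inter> {z. 0 < s z}) f"
    and f0: "\<And>z. s z \<le> 0 \<Longrightarrow> f z = 0"
    and small: "\<And>e. 0 < e \<Longrightarrow> \<exists>d>0. \<forall>z\<in>H. 0 < s z \<and> s z < d \<longrightarrow> \<bar>f z\<bar> < e"
  shows "continuous_on H f"
proof -
  have "continuous (at z within H) f" if z: "z \<in> H" for z
  proof (cases "0 < s z")
    case True
    have "open (H \<inter> {z. 0 < s z})"
      using H s by (auto intro!: open_Int open_Collect_less)
    then have "isCont f z"
      using f True z by (auto simp: continuous_on_eq_continuous_at)
    then show ?thesis by (rule continuous_at_imp_continuous_at_within)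
  next
    case False
    have "\<forall>\<^sub>F y in at z within H. \<bar>f y\<bar> < e" if e: "0 < e" for e
    proof -
      obtain d where d: "d > 0" "\<forall>z\<in>H. 0 < s z \<and> s z < d \<longrightarrow> \<bar>f z\<bar> < e"
        using small[OF e] by blast
      have "open {y. s y < d}"
        using s by (auto intro!: open_Collect_less)
      then have "\<forall>\<^sub>F y in at z within H. s y < d"
        using False d(1) by (auto simp: eventually_at_topological intro!: exI[of _ "{y. s y < d}"])
      moreover have "\<forall>\<^sub>F y in at z within H. y \<in> H"
        by (simp add: eventually_at_topological) (meson open_UNIV UNIV_I)
      ultimately show ?thesis
      proof eventually_elim
        case (elim y)
        then show ?case
          using d(2) f0[of y] e by (cases "0 < s y") auto
      qed
    qed
    then show ?thesis
      using f0[of z] False unfolding continuous_within tendsto_iff by (simp add: dist_real_def)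
  qed
  then show ?thesis
    by (simp add: continuous_on_eq_continuous_within)
qed

context cell_attachment
begin

text \<open>Near the boundary of the cell, stretching does not change the radial projection to \<open>S\<close>.\<close>
lemma stretch_stretch:
  assumes z: "z \<in> unit_disk n" "1/2 \<le> nrm n z" and t: "0 \<le> t"
  shows "stretch (stretch (\<Phi> z) t) 1 = stretch (\<Phi> z) 1"
proof -
  define c where "c = (1 + t) / max 1 ((1 + t) * nrm n z)"
  have n1: "nrm n z \<le> 1" and n0: "0 < nrm n z" using z by (auto simp: unit_disk_def)
  have unit: "clip n (\<lambda>i. b * z i) = (\<lambda>i. if i < n then z i / nrm n z else 0)" if "1 \<le> b * nrm n z" "0 < b" for b
    using that n0 by (auto simp: clip_def nrm_scale fun_eq_iff)
  have c: "clip n (\<lambda>i. (1 + t) * z i) = (\<lambda>i. c * z i)"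
    using z t by (auto simp: clip_def nrm_scale fun_eq_iff c_def unit_disk_def)
  have c1: "1 \<le> 2 * c * nrm n z" "0 < c"
  proof -
    have "1 + t > 0" using t by simp
    then show "0 < c" by (simp add: c_def)
    show "1 \<le> 2 * c * nrm n z"
    proof (cases "(1 + t) * nrm n z \<le> 1")
      case True
      have "1 \<le> 2 * nrm n z" using z by simp
      also have "\<dots> \<le> 2 * (1 + t) * nrm n z" using t n0 by (simp add: algebra_simps)
      finally show ?thesis using True by (simp add: c_def)
    next
      case False
      then show ?thesis using n0 t by (simp add: c_def field_simps)
    qed
  qed
  have "stretch (stretch (\<Phi> z) t) 1 = stretch (\<Phi> (\<lambda>i. c * z i)) 1"
    by (simp add: stretch_\<Phi>[OF z(1) t] c)
  also have "\<dots> = \<Phi> (clip n (\<lambda>i. (2 * c) * z i))"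
    using stretch_\<Phi>[of "\<lambda>i. c * z i" 1] clip_unit_disk[of n "\<lambda>i. (1 + t) * z i"] by (simp add: c mult.assoc)
  also have "\<dots> = \<Phi> (clip n (\<lambda>i. 2 * z i))"
    using unit[of "2 * c"] unit[of 2] c1 z by simp
  also have "\<dots> = stretch (\<Phi> z) 1"
    by (simp add: stretch_\<Phi>[OF z(1)])
  finally show ?thesis .
qed

text \<open>Given a neighbourhood retraction \<open>r\<close> onto \<open>S\<close>, embed \<open>Q\<close> by \<open>q \<mapsto> (\<kappa> q, damped q, depth q)\<close>, where \<open>\<kappa>\<close>
  extends the embedding \<open>\<iota>\<close> of \<open>S\<close> and depends near \<open>S\<close> on the radial projection only.
  A nearby point \<open>(x, w, s)\<close> with \<open>s > 0\<close> names the point \<open>q0\<close> of the cell with disk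
  coordinates \<open>w / s\<close>, and \<open>\<delta>\<close> measures how far \<open>(x, w, s)\<close> is from the image of \<open>q0\<close>.
  The retraction sends it to \<open>q0\<close> if \<open>\<delta> = 0\<close>. While \<open>\<delta>\<close> grows to \<open>s\<close>, it stretches \<open>q0\<close> until
  the boundary is reached. While \<open>\<delta>\<close> grows from \<open>s\<close> to \<open>2 * s\<close>, it uses \<open>r\<close> on the segment from \<open>\<kappa> q0\<close>
  to \<open>x\<close>, and from then on its value is \<open>r x\<close>. All comparisons are relative to \<open>s\<close>, which makes
  the construction fit with \<open>r\<close> on \<open>s = 0\<close>.\<close>
lemma nbhd_retract_attach:
  assumes "nbhd_retract (subtopology Q S)"
  shows "nbhd_retract Q"
proof -
  obtain \<iota> :: "'a \<Rightarrow> nat \<Rightarrow> real" and U r where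
    \<iota>: "continuous_map (subtopology Q S) euclidean \<iota>" and U: "open U" "\<iota> ` topspace (subtopology Q S) \<subseteq> U"
    and r: "continuous_map (top_of_set U) (subtopology Q S) r"
    and r\<iota>: "\<forall>p\<in>topspace (subtopology Q S). r (\<iota> p) = p"
    using assms unfolding nbhd_retract_def by blast
  have tS: "topspace (subtopology Q S) = S" using S_sub by auto
  have rS: "r y \<in> S" if "y \<in> U" for y
    using continuous_map_image_subset_topspace[OF r] that by (auto simp: tS)
  define F where "F = {q \<in> topspace Q. depth q \<le> 1/2}"
  have F: "closedin Q F"
    using closedin_continuous_map_preimage[OF continuous_depth, of "{..1/2}"] by (simp add: F_def)
  have "continuous_map Q Q (\<lambda>q. stretch q 1)"
    using continuous_map_stretch_compose[OF continuous_map_id, of "\<lambda>q. 1"] by (simp add: id_def)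
  then have "continuous_map (subtopology Q F) (subtopology Q S) (\<lambda>q. stretch q 1)"
    using stretch_1 by (auto simp: continuous_map_in_subtopology continuous_map_from_subtopology F_def)
  then have "continuous_map (subtopology Q F) R_omega (\<lambda>q. \<iota> (stretch q 1))"
    using continuous_map_compose[OF _ \<iota>] by (auto simp: o_def)
  moreover have "normal_space Q"
    using compact_Q Hausdorff_Q compact_Hausdorff_or_regular_imp_normal_space by blast
  ultimately obtain \<kappa> where \<kappa>: "continuous_map Q R_omega \<kappa>" "\<forall>q\<in>F. \<kappa> q = \<iota> (stretch q 1)"
    using Tietze_R_omega[OF _ F] by metis
  have \<kappa>S: "\<kappa> q = \<iota> q" if "q \<in> S" for q
    using that \<kappa>(2) S_sub by (auto simp: F_def)
  define j where "j q = (\<kappa> q, damped q, depth q)" for q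
  have "continuous_map Q (prod_topology euclidean (prod_topology euclidean euclidean)) j"
    unfolding j_def using \<kappa>(1) continuous_damped continuous_depth by (intro continuous_map_pairedI)
  then have j: "continuous_map Q euclidean j" by (simp only: prod_topology_euclidean)
  have inj: "inj_on j (topspace Q)"
  proof (rule inj_onI)
    fix p q assume p: "p \<in> topspace Q" and q: "q \<in> topspace Q" and eq: "j p = j q"
    have e: "\<kappa> p = \<kappa> q" "damped p = damped q" "depth p = depth q"
      using eq by (auto simp: j_def)
    show "p = q"
    proof (cases "0 < depth p")
      case True
      have "p = \<Phi> (\<lambda>i. damped p i / depth p)"
        using depth_pos(2)[OF p True] by (rule sym)
      also have "\<dots> = \<Phi> (\<lambda>i. damped q i / depth q)"
        unfolding e ..
      also have "\<dots> = q"
        using depth_pos(2)[OF q] True e(3) by metis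
      finally show ?thesis .
    next
      case False
      then have "p \<in> S" "q \<in> S"
        using depth_range[OF p] depth_eq_0[OF p] depth_eq_0[OF q] e(3) by auto
      then show ?thesis
        using e(1) \<kappa>S r\<iota> tS by metis
    qed
  qed
  have inv: "continuous_map (subtopology euclidean (j ` topspace Q)) Q (inv_into (topspace Q) j)"
    using inj by (intro continuous_inverse_map[OF compact_Q _ j]) auto
  \<comment> \<open>By compactness \<open>Q\<close> carries the initial topology for \<open>\<kappa>\<close>, \<open>damped\<close> and \<open>depth\<close>.\<close>
  have into_Q: "continuous_map (top_of_set W) Q f"
    if f: "\<And>z. z \<in> W \<Longrightarrow> f z \<in> topspace Q"
      and c: "continuous_on W (\<lambda>z. \<kappa> (f z))" "continuous_on W (\<lambda>z. damped (f z))" "continuous_on W (\<lambda>z. depth (f z))"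
    for W and f :: "(nat \<Rightarrow> real) \<times> (nat \<Rightarrow> real) \<times> real \<Rightarrow> 'a"
  proof -
    have "continuous_on W (\<lambda>z. j (f z))"
      unfolding j_def using c by (intro continuous_on_Pair)
    then have "continuous_map (top_of_set W) (subtopology euclidean (j ` topspace Q)) (\<lambda>z. j (f z))"
      using f by auto
    from continuous_map_compose[OF this inv] show ?thesis
      by (rule continuous_map_eq) (use f inj in auto)
  qed
  define s :: "(nat \<Rightarrow> real) \<times> (nat \<Rightarrow> real) \<times> real \<Rightarrow> real" where "s z = snd (snd z)" for z
  define P0 where "P0 = {z. 0 < s z}"
  define V where "V z = clip n (\<lambda>i. fst (snd z) i / s z)" for z
  define q0 where "q0 z = \<Phi> (V z)" for z
  define a where "a z = \<kappa> (q0 z)" for z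
  define \<rho> where "\<rho> z = nrm n (V z)" for z
  define \<delta> where "\<delta> z = dist (fst z) (a z) + \<bar>\<rho> z - (1 - s z)\<bar>" for z
  define \<omega> where "\<omega> z = max 0 (min 1 (2 - \<delta> z / s z))" for z
  define y where "y z = (\<lambda>i. fst z i + (if s z \<le> 0 then 0 else \<omega> z * (a z i - fst z i)))" for z
  \<comment> \<open>For \<open>s < 1/6\<close> and \<open>\<delta> \<le> s\<close> the point \<open>q0\<close> has radius \<open>\<rho> \<ge> 2/3\<close>, so \<open>\<kappa> q0\<close> is given by the radial projection.\<close>
  define H where "H = {z. s z < 1/6}"
  have VD: "V z \<in> unit_disk n" for z by (simp add: V_def clip_unit_disk)
  have \<rho>1: "0 \<le> \<rho> z" "\<rho> z \<le> 1" for z using nrm_le[OF VD] by (auto simp: \<rho>_def)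
  have q0Q: "q0 z \<in> topspace Q" for z using \<Phi>_top[OF VD] by (simp add: q0_def)
  have sc: "continuous_on A s" for A
    unfolding s_def[abs_def] by (intro continuous_intros)
  have oP0: "open P0" unfolding P0_def by (intro open_Collect_less sc continuous_on_const)
  have oH: "open H" unfolding H_def by (intro open_Collect_less sc continuous_on_const)
  have xc: "continuous_on A (\<lambda>z :: (nat \<Rightarrow> real) \<times> (nat \<Rightarrow> real) \<times> real. fst z i)" for A i
    using continuous_on_product_then_coordinatewise[OF continuous_on_fst[OF continuous_on_id], of A i] by simp
  have wc: "continuous_on A (\<lambda>z :: (nat \<Rightarrow> real) \<times> (nat \<Rightarrow> real) \<times> real. fst (snd z) i)" for A i
    using continuous_on_product_then_coordinatewise[OF continuous_on_fst[OF continuous_on_snd[OF continuous_on_id]], of A i] by simp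
  have Vci: "continuous_on P0 (\<lambda>z. V z i)" for i
  proof -
    have "continuous_on P0 (\<lambda>z. fst (snd z) i / s z)" for i
      by (intro continuous_on_divide wc sc) (auto simp: P0_def)
    then show ?thesis
      using continuous_map_clip[of "top_of_set P0" "\<lambda>z i. fst (snd z) i / s z"] by (simp add: V_def)
  qed
  then have Vc: "continuous_on P0 V"
    using continuous_on_coordinatewise_then_product by blast
  have q0c: "continuous_map (top_of_set P0) Q q0"
    using continuous_map_compose[OF _ cont_\<Phi>, of "top_of_set P0" V] Vc VD by (auto simp: q0_def[abs_def] o_def)
  have ac: "continuous_on P0 a"
    using continuous_map_compose[OF q0c \<kappa>(1)] by (simp add: a_def[abs_def] o_def)
  have \<rho>c: "continuous_on P0 \<rho>" unfolding \<rho>_def[abs_def] by (intro continuous_on_nrm Vc)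
  have \<delta>c: "continuous_on P0 \<delta>"
    unfolding \<delta>_def[abs_def]
    by (intro continuous_intros ac \<rho>c sc continuous_on_fst continuous_on_id)
  have rat: "continuous_on P0 (\<lambda>z. \<delta> z / s z)"
    by (intro continuous_on_divide \<delta>c sc) (auto simp: P0_def)
  have \<delta>0: "0 \<le> \<delta> z" for z by (simp add: \<delta>_def)
  have close: "dist (fst z) (a z) \<le> \<delta> z" "1 - s z - \<delta> z \<le> \<rho> z" for z
    using zero_le_dist[of "fst z" "a z"] unfolding \<delta>_def by linarith+
  have yc: "continuous_on UNIV (\<lambda>z. y z i)" for i
  proof -
    have "continuous_on UNIV (\<lambda>z. if s z \<le> 0 then 0 else \<omega> z * (a z i - fst z i))"
    proof (rule continuous_on_extend_by_zero[OF sc open_UNIV])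
      have "continuous_on P0 (\<lambda>z. \<omega> z * (a z i - fst z i))"
        unfolding \<omega>_def
        by (intro continuous_intros rat xc continuous_on_product_then_coordinatewise[OF ac])
      then have "continuous_on P0 (\<lambda>z. if s z \<le> 0 then 0 else \<omega> z * (a z i - fst z i))"
        by (rule continuous_on_eq) (simp add: P0_def)
      then show "continuous_on (UNIV \<inter> {z. 0 < s z}) (\<lambda>z. if s z \<le> 0 then 0 else \<omega> z * (a z i - fst z i))"
        by (simp add: P0_def)
      fix e :: real assume "0 < e"
      then obtain d where d: "0 < d" "\<And>x y :: nat \<Rightarrow> real. dist x y < d \<Longrightarrow> \<bar>x i - y i\<bar> < e"
        using coordinate_uniform by blast
      have "\<bar>\<omega> z * (a z i - fst z i)\<bar> < e" if z: "0 < s z" "s z < d / 2" for z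
      proof (cases "\<delta> z < 2 * s z")
        case True
        then have "\<bar>a z i - fst z i\<bar> < e"
          using d(2)[of "fst z" "a z"] close(1)[of z] z by (simp add: abs_minus_commute)
        moreover have "\<bar>\<omega> z\<bar> \<le> 1" by (simp add: \<omega>_def)
        then have "\<bar>\<omega> z * (a z i - fst z i)\<bar> \<le> \<bar>a z i - fst z i\<bar>"
          by (simp add: abs_mult mult_left_le_one_le)
        ultimately show ?thesis by linarith
      next
        case False
        then have "\<omega> z = 0"
          using z by (simp add: \<omega>_def field_simps)
        then show ?thesis using \<open>0 < e\<close> by simp
      qed
      then show "\<exists>d>0. \<forall>z\<in>UNIV. 0 < s z \<and> s z < d \<longrightarrow>
          \<bar>if s z \<le> 0 then 0 else \<omega> z * (a z i - fst z i)\<bar> < e"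
        using d(1) by (intro exI[of _ "d / 2"]) auto
    qed auto
    then show ?thesis
      unfolding y_def by (intro continuous_on_add xc)
  qed
  then have yc': "continuous_on A y" for A
    using continuous_on_coordinatewise_then_product continuous_on_subset by blast

  \<comment> \<open>On \<open>W1\<close> only the cell is involved; \<open>W2\<close> is a neighbourhood of the image of \<open>S\<close>.\<close>
  define W1 where "W1 = {z \<in> P0. \<delta> z < s z}"
  define W2 where "W2 = H \<inter> y -` U"
  define out where "out z = (if 0 < s z \<and> \<delta> z \<le> s z then stretch (q0 z) (\<delta> z / s z) else r (y z))" for z
  have oW1: "open W1"
  proof -
    obtain A where "open A" "A \<inter> P0 = {z \<in> P0. \<delta> z < s z}"
      using open_Collect_less_Int[OF \<delta>c sc] by blast
    then show ?thesis
      using oP0 by (metis W1_def open_Int)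
  qed
  have oW2: "open W2"
    unfolding W2_def using yc'[of UNIV] U(1) oH by (simp add: continuous_on_open_vimage open_Int)
  have cW1: "continuous_map (top_of_set W1) Q out"
  proof (rule continuous_map_eq)
    have "continuous_map (top_of_set W1) Q q0"
      by (rule continuous_map_from_subtopology_mono[OF q0c]) (auto simp: W1_def)
    moreover have "continuous_on W1 (\<lambda>z. \<delta> z / s z)"
      by (rule continuous_on_subset[OF rat]) (auto simp: W1_def)
    then have "continuous_map (top_of_set W1) (top_of_set {0..1}) (\<lambda>z. \<delta> z / s z)"
      using \<delta>0 by (auto simp: W1_def P0_def)
    ultimately show "continuous_map (top_of_set W1) Q (\<lambda>z. stretch (q0 z) (\<delta> z / s z))"
      by (rule continuous_map_stretch_compose)
  qed (auto simp: W1_def P0_def out_def)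
  define t where "t z = \<delta> z / s z" for z
  \<comment> \<open>The functions \<open>Sf\<close> and \<open>g i\<close> are \<open>depth\<close> and \<open>damped\<close> of \<open>out\<close>, written so that their continuity can be checked.\<close>
  define Sf where "Sf z = (if 0 < s z \<and> \<delta> z \<le> s z then 1 - min 1 ((1 + t z) * \<rho> z) else 0)" for z
  define g where "g i z = (if s z \<le> 0 then 0 else Sf z * clip n (\<lambda>i. (1 + t z) * V z i) i)" for i z
  have t0: "0 \<le> t z" if "0 < s z" for z
    using that \<delta>0 by (simp add: t_def)
  have Sf_bound: "0 \<le> Sf z" "0 < s z \<Longrightarrow> Sf z \<le> 2 * s z" for z
  proof -
    show "0 \<le> Sf z" by (simp add: Sf_def)
    assume z: "0 < s z"
    have "1 * \<rho> z \<le> (1 + t z) * \<rho> z"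
      using t0[OF z] \<rho>1[of z] by (intro mult_right_mono) auto
    then show "Sf z \<le> 2 * s z"
      using close(2)[of z] z \<rho>1[of z] by (auto simp: Sf_def min_def)
  qed
  have near: "2/3 \<le> \<rho> z" "a z = \<iota> (stretch (q0 z) 1)" "stretch (q0 z) 1 \<in> S"
    if "s z < 1/6" "\<delta> z \<le> s z" for z
  proof -
    show \<rho>: "2/3 \<le> \<rho> z" using close(2)[of z] that by simp
    have "depth (q0 z) \<le> 1/2"
      using \<rho> by (simp add: q0_def depth_\<Phi>[OF VD] \<rho>_def)
    then show "a z = \<iota> (stretch (q0 z) 1)" "stretch (q0 z) 1 \<in> S"
      using \<kappa>(2) q0Q[of z] stretch_1[of "q0 z"] by (auto simp: a_def F_def)
  qed
  have outQ: "out z \<in> topspace Q" if "z \<in> W2" for z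
    using that rS[of "y z"] S_sub stretch_top[OF q0Q[of z], of "t z"] t0[of z]
    by (auto simp: out_def W2_def t_def)
  \<comment> \<open>On \<open>W2\<close> the first component of \<open>out\<close> is \<open>\<iota> (r (y z))\<close> in both cases, since \<open>y = \<kappa> q0\<close> while \<open>\<delta> \<le> s\<close>.\<close>
  have \<kappa>out: "\<kappa> (out z) = \<iota> (r (y z))" if z: "z \<in> W2" for z
  proof (cases "0 < s z \<and> \<delta> z \<le> s z")
    case True
    have s: "s z < 1/6" using z by (simp add: W2_def H_def)
    note nr = near[OF s conjunct2[OF True]]
    have "\<omega> z = 1" using True by (simp add: \<omega>_def min_def field_simps)
    then have ya: "y z = a z" using True by (simp add: y_def)
    have o: "out z = stretch (q0 z) (t z)" using True by (simp add: out_def t_def)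
    have "1 * \<rho> z \<le> (1 + t z) * \<rho> z"
      using t0[of z] True \<rho>1[of z] by (intro mult_right_mono) auto
    then have "2/3 \<le> (1 + t z) * \<rho> z" using nr(1) by linarith
    moreover have "depth (out z) = 1 - min 1 ((1 + t z) * \<rho> z)"
      using depth_stretch[OF VD[of z], of "t z"] t0[of z] True by (simp add: o q0_def \<rho>_def)
    ultimately have "depth (out z) \<le> 1/2" by linarith
    then have "\<kappa> (out z) = \<iota> (stretch (out z) 1)"
      using \<kappa>(2) outQ[OF z] by (simp add: F_def)
    also have "\<dots> = \<iota> (stretch (q0 z) 1)"
      using stretch_stretch[OF VD[of z], of "t z"] nr(1) t0[of z] True by (simp add: o q0_def \<rho>_def)
    also have "\<dots> = \<iota> (r (y z))"
      using r\<iota> nr(2,3) tS ya by simp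
    finally show ?thesis .
  next
    case False
    then show ?thesis
      using \<kappa>S rS z by (auto simp: out_def W2_def)
  qed
  have dout: "depth (out z) = Sf z" and wout: "damped (out z) i = g i z" if z: "z \<in> W2" for z i
  proof -
    show d: "depth (out z) = Sf z"
      using z rS[of "y z"] depth_stretch[OF VD[of z], of "t z"] t0[of z]
      by (auto simp: out_def Sf_def W2_def q0_def t_def[symmetric] \<rho>_def)
    show "damped (out z) i = g i z"
    proof (cases "0 < s z \<and> \<delta> z \<le> s z")
      case True
      then have "out z = \<Phi> (clip n (\<lambda>i. (1 + t z) * V z i))"
        using stretch_\<Phi>[OF VD[of z], of "t z"] t0[of z] by (simp add: out_def q0_def t_def)
      then show ?thesis
        using True d damped_\<Phi>[OF clip_unit_disk] depth_\<Phi>[OF clip_unit_disk] by (simp add: g_def)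
    next
      case False
      then show ?thesis
        using z rS[of "y z"] damped_S[of "r (y z)"] by (auto simp: out_def g_def Sf_def W2_def)
    qed
  qed
  have HP: "H \<inter> {z. 0 < s z} \<subseteq> P0" by (auto simp: P0_def)
  have tc: "continuous_on P0 t" using rat by (simp add: t_def[abs_def])
  have Sfc0: "continuous_on (H \<inter> {z. 0 < s z}) Sf"
  proof -
    let ?X = "top_of_set (H \<inter> {z. 0 < s z})"
    have "continuous_on P0 (\<lambda>z. 1 - min 1 ((1 + t z) * \<rho> z))"
      by (intro continuous_intros tc \<rho>c)
    then have "continuous_map ?X euclideanreal (\<lambda>z. 1 - min 1 ((1 + t z) * \<rho> z))"
      using continuous_on_subset[OF _ HP] by simp
    moreover have "continuous_map ?X euclideanreal \<delta>" "continuous_map ?X euclideanreal s"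
      using continuous_on_subset[OF \<delta>c HP] sc by simp_all
    moreover have "1 - min 1 ((1 + t z) * \<rho> z) = 0" if "z \<in> topspace ?X" "\<delta> z = s z" for z
      using near(1)[of z] that by (simp add: t_def H_def min_def)
    ultimately have "continuous_map ?X euclideanreal (\<lambda>z. if \<delta> z \<le> s z then 1 - min 1 ((1 + t z) * \<rho> z) else 0)"
      by (intro continuous_map_cases_le) (auto intro: continuous_map_from_subtopology)
    then have "continuous_map ?X euclideanreal Sf"
      by (rule continuous_map_eq) (auto simp: Sf_def)
    then show ?thesis by simp
  qed
  have Sfc: "continuous_on H Sf"
  proof (rule continuous_on_extend_by_zero[OF sc oH Sfc0])
    fix e :: real assume "0 < e"
    then show "\<exists>d>0. \<forall>z\<in>H. 0 < s z \<and> s z < d \<longrightarrow> \<bar>Sf z\<bar> < e"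
      using Sf_bound by (intro exI[of _ "e / 2"]) force
  qed (simp add: Sf_def)
  have gc: "continuous_on H (g i)" for i
  proof (rule continuous_on_extend_by_zero[OF sc oH])
    have "continuous_on P0 (\<lambda>z. (1 + t z) * V z i)" for i
      by (intro continuous_intros tc Vci)
    then have "continuous_on P0 (\<lambda>z. clip n (\<lambda>i. (1 + t z) * V z i) i)"
      using continuous_map_clip[of "top_of_set P0" "\<lambda>z i. (1 + t z) * V z i"] by simp
    then have "continuous_on (H \<inter> {z. 0 < s z}) (\<lambda>z. Sf z * clip n (\<lambda>i. (1 + t z) * V z i) i)"
      by (intro continuous_on_mult Sfc0) (rule continuous_on_subset[OF _ HP])
    then show "continuous_on (H \<inter> {z. 0 < s z}) (g i)"
      by (rule continuous_on_eq) (simp add: g_def)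
    fix e :: real assume e: "0 < e"
    have "\<bar>g i z\<bar> \<le> 2 * s z" if "0 < s z" for z
    proof -
      have "\<bar>clip n (\<lambda>i. (1 + t z) * V z i) i\<bar> \<le> 1"
        using clip_unit_disk[of n "\<lambda>i. (1 + t z) * V z i"] nrm_coord[of i n "clip n (\<lambda>i. (1 + t z) * V z i)"]
        by (cases "i < n") (auto simp: unit_disk_def)
      then have "\<bar>g i z\<bar> \<le> Sf z"
        using Sf_bound(1)[of z] that by (simp add: g_def abs_mult mult_left_le)
      then show ?thesis using Sf_bound(2)[OF that] by simp
    qed
    then show "\<exists>d>0. \<forall>z\<in>H. 0 < s z \<and> s z < d \<longrightarrow> \<bar>g i z\<bar> < e"
      using e by (intro exI[of _ "e / 2"]) force
  qed (simp add: g_def)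
  have W2H: "W2 \<subseteq> H" by (auto simp: W2_def)
  have cW2: "continuous_map (top_of_set W2) Q out"
  proof (rule into_Q)
    have "continuous_map (top_of_set W2) (top_of_set U) y"
      using yc'[of W2] by (auto simp: W2_def)
    then have "continuous_map (top_of_set W2) euclidean (\<iota> \<circ> (r \<circ> y))"
      by (rule continuous_map_compose[OF continuous_map_compose[OF _ r] \<iota>])
    then have "continuous_on W2 (\<lambda>z. \<iota> (r (y z)))"
      by (simp add: o_def)
    then show "continuous_on W2 (\<lambda>z. \<kappa> (out z))"
      by (rule continuous_on_eq) (simp add: \<kappa>out)
    show "continuous_on W2 (\<lambda>z. depth (out z))"
      using continuous_on_subset[OF Sfc W2H] by (rule continuous_on_eq) (simp add: dout)
    show "continuous_on W2 (\<lambda>z. damped (out z))"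
    proof (rule continuous_on_coordinatewise_then_product)
      show "continuous_on W2 (\<lambda>z. damped (out z) i)" for i
        using continuous_on_subset[OF gc W2H] by (rule continuous_on_eq) (simp add: wout)
    qed
  qed (rule outQ)
  show ?thesis
  proof (rule nbhd_retractI_triple[OF j])
    show "open (W1 \<union> W2)" using oW1 oW2 by (rule open_Un)
    have eq: "subtopology (top_of_set (W1 \<union> W2)) W = top_of_set W" if "W \<in> {W1, W2}" for W
      using that by (auto simp: subtopology_subtopology Int_absorb1)
    show "continuous_map (top_of_set (W1 \<union> W2)) Q out"
    proof (rule pasting_lemma[where I = "{W1, W2}" and T = id and f = "\<lambda>_. out"])
      show "openin (top_of_set (W1 \<union> W2)) (id W)" if "W \<in> {W1, W2}" for W
        using that oW1 oW2 by (auto intro: open_subset)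
      show "continuous_map (subtopology (top_of_set (W1 \<union> W2)) (id W)) Q out" if "W \<in> {W1, W2}" for W
        using that eq[OF that] cW1 cW2 by auto
    qed auto
    have main: "j q \<in> W1 \<union> W2 \<and> out (j q) = q" if q: "q \<in> topspace Q" for q
    proof (cases "q \<in> S")
      case True
      then have "s (j q) = 0" "y (j q) = \<iota> q"
        by (simp_all add: s_def j_def y_def \<kappa>S)
      then show ?thesis
        using U(2) True r\<iota> tS by (auto simp: W2_def H_def out_def)
    next
      case False
      then have d: "0 < depth q" using depth_range[OF q] depth_eq_0[OF q] by auto
      have "V (j q) = (\<lambda>i. damped q i / depth q)"
        using clip_id[OF depth_pos(1)[OF q d]] by (simp add: V_def j_def s_def)
      then have "q0 (j q) = q" "\<rho> (j q) = 1 - depth q"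
        using depth_pos[OF q d] by (simp_all add: q0_def \<rho>_def)
      then have "\<delta> (j q) = 0" "s (j q) = depth q"
        by (simp_all add: \<delta>_def a_def j_def s_def)
      then show ?thesis
        using d \<open>q0 (j q) = q\<close> stretch_0[OF q] by (auto simp: W1_def P0_def out_def)
    qed
    then show "j ` topspace Q \<subseteq> W1 \<union> W2" by blast
    show "out (j q) = q" if "q \<in> topspace Q" for q
      using main[OF that] by blast
  qed
qed

end

section \<open>The finite stages of a complex of finite type\<close>

locale finite_type_CW =
  fixes L :: "'a topology" and E :: "nat \<Rightarrow> 'a set set"
  assumes cw: "CW_complex L E" and ft: "finite_type E"
begin

definition cells_below :: "nat \<Rightarrow> nat"
  where "cells_below n = (\<Sum>m<n. card (E m))"

definition number :: "nat \<Rightarrow> 'a set \<Rightarrow> nat"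
  where "number n = (SOME h. bij_betw h (E n) {0..<card (E n)})"

text \<open>A numbering of the cells that increases with the dimension. The boundary of a cell of rank \<open>k\<close>
  lies in \<open>stage k\<close> below, so each stage arises from the previous one by attaching at most one
  cell, and \<open>stage (cells_below n)\<close> is the skeleton of dimension \<open>n - 1\<close>.\<close>
definition rank :: "nat \<Rightarrow> 'a set \<Rightarrow> nat"
  where "rank n e = cells_below n + number n e"

definition stage :: "nat \<Rightarrow> 'a set"
  where "stage k = {x. \<exists>n. \<exists>e\<in>E n. x \<in> e \<and> rank n e < k}"

lemma number_bij: "bij_betw (number n) (E n) {0..<card (E n)}"
proof -
  have "\<exists>h. bij_betw h (E n) {0..<card (E n)}"
    using ft ex_bij_betw_finite_nat unfolding finite_type_def by blast
  then show ?thesis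
    unfolding number_def by (rule someI_ex)
qed

lemma number_less: "e \<in> E n \<Longrightarrow> number n e < card (E n)"
  using number_bij[of n] by (auto simp: bij_betw_def)

lemma cells_below_mono: "m \<le> n \<Longrightarrow> cells_below m \<le> cells_below n"
  unfolding cells_below_def by (intro sum_mono2) auto

lemma rank_bounds: "e \<in> E n \<Longrightarrow> cells_below n \<le> rank n e \<and> rank n e < cells_below (Suc n)"
  using number_less by (simp add: rank_def cells_below_def)

lemma rank_less:
  assumes "m < n" "c \<in> E m" "e \<in> E n"
  shows "rank m c < rank n e"
  using rank_bounds[OF assms(2)] rank_bounds[OF assms(3)] cells_below_mono[of "Suc m" n] assms(1) by simp

lemma rank_inj:
  assumes "c \<in> E m" "e \<in> E n" "rank m c = rank n e"
  shows "m = n \<and> c = e"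
proof -
  have "m = n"
    using rank_less[of m n c e] rank_less[of n m e c] assms by (metis less_irrefl linorder_neqE_nat)
  then show ?thesis
    using assms number_bij[of n] by (auto simp: rank_def bij_betw_def dest: inj_onD)
qed

lemma dim_ge: "e \<in> E n \<Longrightarrow> cells_below d \<le> rank n e \<Longrightarrow> d \<le> n"
  using rank_bounds[of e n] cells_below_mono[of "Suc n" d] by (meson leD le_trans not_less_eq_eq order_less_le_trans)

lemma cell_sub: "e \<in> E n \<Longrightarrow> e \<subseteq> topspace L"
  using CW_complexD(2)[OF cw] by blast

lemma stage_sub: "stage k \<subseteq> topspace L"
  using cell_sub by (auto simp: stage_def)

lemma stage_mono: "j \<le> k \<Longrightarrow> stage j \<subseteq> stage k"
  unfolding stage_def by (auto intro: order_less_le_trans)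

lemma in_stage: "e \<in> E n \<Longrightarrow> x \<in> e \<Longrightarrow> rank n e < k \<Longrightarrow> x \<in> stage k"
  unfolding stage_def by blast

lemma stageE:
  assumes "x \<in> stage k"
  obtains n e where "e \<in> E n" "x \<in> e" "rank n e < k"
  using assms unfolding stage_def by blast

lemma in_some_stage:
  assumes "x \<in> topspace L"
  shows "\<exists>k. x \<in> stage k"
proof -
  obtain n e where "e \<in> E n" "x \<in> e"
    using CW_complexD(2)[OF cw] assms by blast
  then show ?thesis using in_stage[of e n x] by blast
qed

lemma finite_cells_below: "finite {(n, e). e \<in> E n \<and> rank n e < k}"
proof (rule inj_on_finite)
  show "inj_on (\<lambda>(n, e). rank n e) {(n, e). e \<in> E n \<and> rank n e < k}"
    using rank_inj by (auto simp: inj_on_def)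
  show "(\<lambda>(n, e). rank n e) ` {(n, e). e \<in> E n \<and> rank n e < k} \<subseteq> {..<k}"
    by auto
qed simp

definition char_map :: "nat \<Rightarrow> 'a set \<Rightarrow> (nat \<Rightarrow> real) \<Rightarrow> 'a"
  where "char_map n e = (SOME \<Phi>. characteristic_map L E n e \<Phi>)"

lemma char_map: 
  assumes e: "e \<in> E n"
  shows "continuous_map (top_of_set (unit_disk n)) L (char_map n e)"
    and "inj_on (char_map n e) {z \<in> unit_disk n. nrm n z < 1}"
    and "char_map n e ` {z \<in> unit_disk n. nrm n z < 1} = e"
    and "\<And>z. z \<in> unit_disk n \<Longrightarrow> nrm n z = 1 \<Longrightarrow> char_map n e z \<in> stage (rank n e)"
proof -
  have "\<exists>\<Phi>. characteristic_map L E n e \<Phi>"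
    using CW_complexD(5)[OF cw] e by blast
  then have "characteristic_map L E n e (char_map n e)"
    unfolding char_map_def by (rule someI_ex)
  then have c: "continuous_map (disk n) L (char_map n e)"
    and h: "homeomorphic_map (subtopology (disk n) (disk_interior n)) (subtopology L e) (char_map n e)"
    and b: "char_map n e ` disk_boundary n \<subseteq> (\<Union>m<n. \<Union>(E m))"
    unfolding characteristic_map_def by auto
  show "continuous_map (top_of_set (unit_disk n)) L (char_map n e)"
    using c by (simp add: disk_eq)
  have t: "topspace (subtopology (disk n) (disk_interior n)) = {z \<in> unit_disk n. nrm n z < 1}"
    by (auto simp: disk_eq disk_interior_eq)
  show "inj_on (char_map n e) {z \<in> unit_disk n. nrm n z < 1}"
    using h unfolding homeomorphic_eq_everything_map t by blast
  show "char_map n e ` {z \<in> unit_disk n. nrm n z < 1} = e"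
    using homeomorphic_imp_surjective_map[OF h] cell_sub[OF e] unfolding t by auto
  fix z assume "z \<in> unit_disk n" "nrm n z = 1"
  then have "z \<in> disk_boundary n" by (simp add: disk_boundary_eq)
  then obtain m c where "m < n" "c \<in> E m" "char_map n e z \<in> c"
    using b by blast
  then show "char_map n e z \<in> stage (rank n e)"
    using rank_less[of m n c e] e in_stage by blast
qed

lemma char_map_in_stage:
  assumes e: "e \<in> E n" and z: "z \<in> unit_disk n" and k: "rank n e < k"
  shows "char_map n e z \<in> stage k"
proof (cases "nrm n z = 1")
  case True
  then show ?thesis
    using char_map(4)[OF e z] stage_mono[of "rank n e" k] k by auto
next
  case False
  then have "nrm n z < 1" using z by (simp add: unit_disk_def)
  then have "char_map n e z \<in> e" using char_map(3)[OF e] z by blast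
  then show ?thesis using in_stage[OF e _ k] by blast
qed

lemma compact_stage: "compactin L (stage k)"
proof -
  let ?A = "{(n, e). e \<in> E n \<and> rank n e < k}"
  have "stage k = (\<Union>(n, e)\<in>?A. char_map n e ` unit_disk n)"
  proof
    show "stage k \<subseteq> (\<Union>(n, e)\<in>?A. char_map n e ` unit_disk n)"
    proof
      fix x assume "x \<in> stage k"
      then obtain n e where e: "e \<in> E n" "x \<in> e" "rank n e < k" by (rule stageE)
      then have "x \<in> char_map n e ` unit_disk n" using char_map(3)[OF e(1)] by blast
      then show "x \<in> (\<Union>(n, e)\<in>?A. char_map n e ` unit_disk n)" using e by blast
    qed
    show "(\<Union>(n, e)\<in>?A. char_map n e ` unit_disk n) \<subseteq> stage k"
      using char_map_in_stage by blast
  qed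
  moreover have "compactin L (char_map n e ` unit_disk n)" if "e \<in> E n" for n e
    using image_compactin[OF _ char_map(1)[OF that], of "unit_disk n"] compact_unit_disk[of n]
    by (simp add: compactin_subtopology)
  then have "compactin L (\<Union>(n, e)\<in>?A. char_map n e ` unit_disk n)"
    by (intro compactin_Union finite_imageI finite_cells_below) auto
  ultimately show ?thesis by simp
qed

lemma closed_stage: "closedin L (stage k)"
  using compactin_imp_closedin[OF CW_complexD(1)[OF cw] compact_stage] .

lemma topspace_stage: "topspace (subtopology L (stage k)) = stage k"
  using stage_sub by auto

lemma stage_cell_attachment:
  assumes e: "e \<in> E n"
  shows "cell_attachment (subtopology L (stage (Suc (rank n e)))) (stage (rank n e)) n (char_map n e)"
proof
  let ?k = "rank n e"
  have sub: "stage ?k \<subseteq> stage (Suc ?k)" by (rule stage_mono) simp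
  show "compact_space (subtopology L (stage (Suc ?k)))"
    using compact_stage by (simp add: compact_space_subtopology)
  show "Hausdorff_space (subtopology L (stage (Suc ?k)))"
    using CW_complexD(1)[OF cw] by (rule Hausdorff_space_subtopology)
  show "closedin (subtopology L (stage (Suc ?k))) (stage ?k)"
    using closed_stage sub by (simp add: closedin_closed_subtopology)
  show "continuous_map (top_of_set (unit_disk n)) (subtopology L (stage (Suc ?k))) (char_map n e)"
    using char_map(1)[OF e] char_map_in_stage[OF e] by (auto simp: continuous_map_in_subtopology)
  show "char_map n e z \<in> stage ?k" if "z \<in> unit_disk n" "nrm n z = 1" for z
    using char_map(4)[OF e that] .
  show "inj_on (char_map n e) {z \<in> unit_disk n. nrm n z < 1}"
    using char_map(2)[OF e] .
  have "e \<inter> stage ?k = {}"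
  proof -
    have "c \<inter> e = {}" if c: "c \<in> E m" "rank m c < ?k" for m c
    proof -
      have "(m, c) \<noteq> (n, e)" using c(2) by auto
      then show ?thesis
        using CW_complexD(4)[OF cw, rule_format, OF c(1) e] by simp
    qed
    then show ?thesis by (blast elim: stageE)
  qed
  moreover have "stage (Suc ?k) = stage ?k \<union> e"
  proof
    show "stage (Suc ?k) \<subseteq> stage ?k \<union> e"
    proof
      fix x assume "x \<in> stage (Suc ?k)"
      then obtain m c where c: "c \<in> E m" "x \<in> c" "rank m c < Suc ?k" by (rule stageE)
      then show "x \<in> stage ?k \<union> e"
        using rank_inj[OF c(1) e] in_stage[OF c(1,2)] by (metis Un_iff less_SucE)
    qed
    show "stage ?k \<union> e \<subseteq> stage (Suc ?k)"
      using sub in_stage[OF e] by blast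
  qed
  ultimately show "char_map n e ` {z \<in> unit_disk n. nrm n z < 1} = topspace (subtopology L (stage (Suc ?k))) - stage ?k"
    unfolding char_map(3)[OF e] topspace_stage by blast
qed

lemma stage_Suc_cases:
  obtains "stage (Suc k) = stage k" | n e where "e \<in> E n" "rank n e = k"
  by (cases "\<exists>n. \<exists>e\<in>E n. rank n e = k") (auto simp: stage_def less_Suc_eq)

lemma subtopology_stage: "j \<le> k \<Longrightarrow> subtopology (subtopology L (stage k)) (stage j) = subtopology L (stage j)"
  using stage_mono[of j k] by (simp add: subtopology_subtopology Int_absorb1)

lemma nbhd_retract_stage: "nbhd_retract (subtopology L (stage k))"
proof (induction k)
  case 0
  have "stage 0 = {}" by (simp add: stage_def)
  then show ?case
    unfolding nbhd_retract_def by (intro exI[of _ "\<lambda>_ _. 0"] exI[of _ "{}"]) auto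
next
  case (Suc k)
  show ?case
  proof (cases rule: stage_Suc_cases[of k])
    case 1
    then show ?thesis using Suc by simp
  next
    case (2 n e)
    then interpret cell_attachment "subtopology L (stage (Suc k))" "stage k" n "char_map n e"
      using stage_cell_attachment[OF 2(1)] by simp
    show ?thesis
      by (rule nbhd_retract_attach) (simp add: subtopology_stage Suc)
  qed
qed

text \<open>The cells are pushed off one after the other, the last one first. An open cell is
  open in the stage that it completes but in general not in later ones, so the deformations cannot
  be run at the same time at one place: the first one is finished where \<open>\<sigma> y \<le> 1/2\<close>, and the remaining ones take place inside
  that set.\<close>
lemma compress:
  assumes "cells_below 3 \<le> k" "\<And>m. 2 \<le> m \<Longrightarrow> in_AE (nsphere m) Y"
    "continuous_map Y (subtopology L (stage k)) v" "continuous_map Y euclideanreal \<sigma>"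
  shows "\<exists>v'. continuous_map Y (subtopology L (stage k)) v' \<and>
     (\<forall>y\<in>topspace Y. (1 \<le> \<sigma> y \<or> v y \<in> stage (cells_below 3) \<longrightarrow> v' y = v y) \<and> (\<sigma> y \<le> 0 \<longrightarrow> v' y \<in> stage (cells_below 3)))"
  using assms
proof (induction k arbitrary: Y v \<sigma> rule: dec_induct)
  case base
  then show ?case
    by (intro exI[of _ v]) (use continuous_map_image_subset_topspace[OF base(2)] in \<open>auto simp: topspace_stage\<close>)
next
  case (step k)
  show ?case
  proof (cases rule: stage_Suc_cases[of k])
    case 1
    show ?thesis
      unfolding 1 by (rule step.IH) (use step.prems in \<open>simp_all add: 1\<close>)
  next
    case (2 n e)
    then interpret cell_attachment "subtopology L (stage (Suc k))" "stage k" n "char_map n e"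
      using stage_cell_attachment[OF 2(1)] by simp
    have "3 \<le> n" using dim_ge[OF 2(1), of 3] step.hyps(1) 2(2) by simp
    then obtain m where n: "n = Suc m" and m: "2 \<le> m" by (cases n) auto
    \<comment> \<open>The cell of rank \<open>k\<close> is cleared while \<open>\<sigma>\<close> falls from 1 to \<open>1/2\<close>; the rest is left to the induction hypothesis.\<close>
    define \<tau> where "\<tau> y = max 0 (min 1 (2 - 2 * \<sigma> y))" for y
    have "continuous_map Y (top_of_set {0..1}) \<tau>"
      unfolding \<tau>_def[abs_def] continuous_map_in_subtopology using step.prems(3)
      by (intro conjI continuous_intros) auto
    then obtain v1 where v1: "continuous_map Y (subtopology L (stage (Suc k))) v1"
      "\<forall>y\<in>topspace Y. (\<tau> y = 0 \<or> v y \<in> stage k \<longrightarrow> v1 y = v y) \<and> (\<tau> y = 1 \<longrightarrow> v1 y \<in> stage k)"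
      using push_off_cell[OF step.prems(2) _ n step.prems(1)[OF m]] by metis
    define B where "B = {y \<in> topspace Y. \<sigma> y \<le> 1/2}"
    have B: "closedin Y B"
      using closedin_continuous_map_preimage[OF step.prems(3), of "{..1/2}"] by (simp add: B_def)
    have v1B: "v1 y \<in> stage k" if "y \<in> B" for y
      using that v1(2) by (auto simp: B_def \<tau>_def)
    have "continuous_map (subtopology Y B) (subtopology L (stage k)) v1"
      using v1 v1B by (auto simp: continuous_map_in_subtopology continuous_map_from_subtopology)
    moreover have "continuous_map (subtopology Y B) euclideanreal (\<lambda>y. 2 * \<sigma> y)"
      by (intro continuous_intros continuous_map_from_subtopology step.prems)
    ultimately obtain v2 where v2: "continuous_map (subtopology Y B) (subtopology L (stage k)) v2"
      "\<forall>y\<in>topspace (subtopology Y B). (1 \<le> 2 * \<sigma> y \<or> v1 y \<in> stage (cells_below 3) \<longrightarrow> v2 y = v1 y) \<and>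
         (2 * \<sigma> y \<le> 0 \<longrightarrow> v2 y \<in> stage (cells_below 3))"
      using step.IH[OF in_AE_closed_subtopology[OF step.prems(1) B]] by blast
    define v' where "v' y = (if \<sigma> y \<le> 1/2 then v2 y else v1 y)" for y
    have "continuous_map Y (subtopology L (stage (Suc k))) v'"
      unfolding v'_def[abs_def]
    proof (rule continuous_map_cases_le)
      show "continuous_map (subtopology Y {x \<in> topspace Y. \<sigma> x \<le> 1/2}) (subtopology L (stage (Suc k))) v2"
        using v2(1) stage_mono[of k "Suc k"] unfolding B_def[symmetric]
        by (auto simp: continuous_map_in_subtopology)
      show "continuous_map (subtopology Y {x \<in> topspace Y. 1/2 \<le> \<sigma> x}) (subtopology L (stage (Suc k))) v1"
        using v1(1) by (rule continuous_map_from_subtopology)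
      show "v2 x = v1 x" if "x \<in> topspace Y" "\<sigma> x = 1/2" for x
        using v2(2) that by (simp add: B_def)
    qed (use step.prems in auto)
    moreover have "v' y = v y" if y: "y \<in> topspace Y" "1 \<le> \<sigma> y \<or> v y \<in> stage (cells_below 3)" for y
    proof -
      have "v y \<in> stage k" if "v y \<in> stage (cells_below 3)"
        using that stage_mono[OF step.hyps(1)] by auto
      then have "v1 y = v y"
        using y v1(2) by (auto simp: \<tau>_def)
      then show ?thesis
        using y v2(2) by (auto simp: v'_def B_def)
    qed
    moreover have "v' y \<in> stage (cells_below 3)" if y: "y \<in> topspace Y" "\<sigma> y \<le> 0" for y
      using y v2(2) by (auto simp: v'_def B_def)
    ultimately show ?thesis by blast
  qed
qed

end

section \<open>Passing between a complex and its 2-skeleton\<close>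

context finite_type_CW
begin

text \<open>Otherwise points converging to \<open>x\<close> have images outside larger and larger stages. The set of these
  images meets every closed cell in a finite set, so the weak topology makes it closed and keeps
  it away from \<open>g x\<close>.\<close>
lemma locally_in_stage:
  fixes X :: "'m::metric_space set"
  assumes g: "continuous_map (top_of_set X) L g" and x: "x \<in> X"
  shows "\<exists>d>0. \<exists>k. \<forall>y\<in>X. dist x y < d \<longrightarrow> g y \<in> stage k"
proof (rule ccontr)
  assume no: "\<not> ?thesis"
  have "\<exists>y\<in>X. dist x y < 1 / real (Suc k) \<and> g y \<notin> stage k" for k
    using no by (metis of_nat_0_less_iff zero_less_Suc zero_less_divide_1_iff)
  then obtain y where y: "\<And>k. y k \<in> X" "\<And>k. dist x (y k) < 1 / real (Suc k)" "\<And>k. g (y k) \<notin> stage k"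
    by metis
  have gL: "g z \<in> topspace L" if "z \<in> X" for z
    using continuous_map_image_subset_topspace[OF g] that by auto
  define D where "D = range (\<lambda>k. g (y k)) - {g x}"
  have DL: "D \<subseteq> topspace L" using gL y(1) by (auto simp: D_def)
  have "closedin L (D \<inter> L closure_of e)" if e: "e \<in> E n" for n e
  proof -
    let ?j = "Suc (rank n e)"
    have "e \<subseteq> stage ?j" using in_stage[OF e] by blast
    then have "L closure_of e \<subseteq> stage ?j"
      using closed_stage by (rule closure_of_minimal)
    moreover have "D \<inter> stage ?j \<subseteq> (\<lambda>k. g (y k)) ` {..<?j}"
    proof
      fix z assume z: "z \<in> D \<inter> stage ?j"
      then obtain k where k: "z = g (y k)" by (auto simp: D_def)
      then have "\<not> ?j \<le> k" using z y(3)[of k] stage_mono[of ?j k] by auto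
      then show "z \<in> (\<lambda>k. g (y k)) ` {..<?j}" using k by auto
    qed
    ultimately have "finite (D \<inter> L closure_of e)"
      by (meson Int_mono finite_imageI finite_lessThan finite_subset order_refl)
    then show ?thesis
      using DL CW_complexD(1)[OF cw] by (intro closedin_Hausdorff_finite) auto
  qed
  then have "closedin L D"
    using CW_complexD(7)[OF cw, rule_format, OF DL] by blast
  then have "openin (top_of_set X) {z \<in> topspace (top_of_set X). g z \<in> topspace L - D}"
    by (intro openin_continuous_map_preimage[OF g]) (simp add: openin_diff)
  moreover have "x \<in> {z \<in> topspace (top_of_set X). g z \<in> topspace L - D}"
    using x gL by (simp add: D_def)
  ultimately obtain d where d: "0 < d" "\<And>z. z \<in> X \<Longrightarrow> dist z x < d \<Longrightarrow> g z \<notin> D"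
    unfolding openin_euclidean_subtopology_iff by blast
  obtain N where N: "1 / real (Suc N) < d"
    using d(1) nat_approx_posE by blast
  obtain j where j: "g x \<in> stage j"
    using in_some_stage gL[OF x] by blast
  let ?k = "max N j"
  have "1 / real (Suc ?k) \<le> 1 / real (Suc N)"
    by (intro divide_left_mono) auto
  then have "dist (y ?k) x < d"
    using y(2)[of ?k] N by (simp add: dist_commute)
  then have "g (y ?k) = g x"
    using d(2)[OF y(1)] by (auto simp: D_def)
  then show False
    using j y(3)[of ?k] stage_mono[of j ?k] by auto
qed

lemma compact_image_in_stage:
  fixes A :: "'m::metric_space set"
  assumes f: "continuous_map (top_of_set A) L f" and A: "compact A"
  obtains k where "f ` A \<subseteq> stage k"
proof -
  have "\<forall>x\<in>A. \<exists>d k. 0 < d \<and> (\<forall>y\<in>A. dist x y < d \<longrightarrow> f y \<in> stage k)"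
    using locally_in_stage[OF f] by blast
  then obtain d k where dk: "\<And>x. x \<in> A \<Longrightarrow> 0 < d x" "\<And>x y. x \<in> A \<Longrightarrow> y \<in> A \<Longrightarrow> dist x y < d x \<Longrightarrow> f y \<in> stage (k x)"
    by metis
  have "A \<subseteq> (\<Union>x\<in>A. ball x (d x))" using dk(1) by auto
  then obtain T where T: "T \<subseteq> A" "finite T" "A \<subseteq> (\<Union>x\<in>T. ball x (d x))"
    using compactE_image[OF A, of A "\<lambda>x. ball x (d x)"] by auto
  have "f y \<in> stage (Max (insert 0 (k ` T)))" if y: "y \<in> A" for y
  proof -
    obtain x where x: "x \<in> T" "dist x y < d x" using T(3) y by auto
    then have "f y \<in> stage (k x)" using dk(2) T(1) y by blast
    moreover have "k x \<le> Max (insert 0 (k ` T))" using T(2) x(1) by (intro Max_ge) auto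
    ultimately show ?thesis using stage_mono by blast
  qed
  then show thesis using that by blast
qed

text \<open>The map \<open>f\<close> has values in a finite stage and extends to a neighbourhood \<open>Y\<close> of \<open>A\<close> because stages
  are neighbourhood retracts. Compressing it towards the frontier of \<open>Y\<close> leaves \<open>f\<close>
  unchanged and brings the frontier into the 2-skeleton, from where the hypothesis extends it over
  the rest of \<open>C\<close>.\<close>
lemma in_AE_of_skeleton:
  fixes C :: "'m::metric_space set"
  assumes C: "compact C" and sph: "\<And>m. 2 \<le> m \<Longrightarrow> in_AE (nsphere m) (top_of_set C)"
    and AE: "in_AE (subtopology L (stage (cells_below 3))) (top_of_set C)"
  shows "in_AE L (top_of_set C)"
  unfolding in_AE_def
proof (intro allI impI, elim conjE)
  let ?C = "top_of_set C"
  fix A f assume A: "closedin ?C A" and f: "continuous_map (subtopology ?C A) L f"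
  have AC: "A \<subseteq> C" using closedin_subset[OF A] by simp
  have eqA: "subtopology ?C A = top_of_set A"
    using AC by (simp add: subtopology_subtopology Int_absorb1)
  have "compact A" using A C closedin_compact by blast
  then obtain k' where k': "f ` A \<subseteq> stage k'"
    using compact_image_in_stage f unfolding eqA by blast
  define k where "k = max k' (cells_below 3)"
  have fk: "f ` A \<subseteq> stage k" using k' stage_mono[of k' k] by (auto simp: k_def)
  obtain \<iota> :: "'a \<Rightarrow> nat \<Rightarrow> real" and U r where
    \<iota>: "continuous_map (subtopology L (stage k)) euclidean \<iota>" and U: "open U" "\<iota> ` stage k \<subseteq> U"
    and r: "continuous_map (top_of_set U) (subtopology L (stage k)) r" and r\<iota>: "\<forall>p\<in>stage k. r (\<iota> p) = p"
    using nbhd_retract_stage[of k] unfolding nbhd_retract_def topspace_stage by blast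
  have N: "normal_space ?C"
    by (simp add: metrizable_imp_normal_space metrizable_space_subtopology metrizable_space_euclidean)
  have fs: "continuous_map (subtopology ?C A) (subtopology L (stage k)) f"
    using f fk AC by (auto simp: continuous_map_in_subtopology)
  obtain F where F: "continuous_map ?C euclidean F" "\<forall>x\<in>A. F x = (\<iota> \<circ> f) x"
    by (rule Tietze_R_omega[OF N A continuous_map_compose[OF fs \<iota>]])
  define B where "B = {x \<in> C. F x \<notin> U}"
  have B: "closedin ?C B"
    using closedin_continuous_map_preimage[OF F(1), of "- U"] U(1) by (simp add: B_def closed_def)
  have "F x \<in> U" if "x \<in> A" for x
    using F(2) U(2) fk that by force
  then have "disjnt A B"
    by (auto simp: B_def disjnt_def)
  then obtain u where u: "continuous_map ?C euclideanreal u" "u ` A \<subseteq> {1}" "u ` B \<subseteq> {0}"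
    using Urysohn_lemma_alt[OF N A B] by metis
  define Y where "Y = {x \<in> C. 1/2 \<le> u x}"
  have Y: "closedin ?C Y"
    using closedin_continuous_map_preimage[OF u(1), of "{1/2..}"] by (simp add: Y_def)
  have "F x \<in> U" if "x \<in> Y" for x
    using that u(3) by (auto simp: Y_def B_def)
  then have "continuous_map (subtopology ?C Y) (top_of_set U) F"
    using F(1) by (simp only: continuous_map_in_subtopology continuous_map_from_subtopology) auto
  then have v: "continuous_map (subtopology ?C Y) (subtopology L (stage k)) (r \<circ> F)"
    using r by (rule continuous_map_compose)
  have \<sigma>: "continuous_map (subtopology ?C Y) euclideanreal (\<lambda>x. 2 * u x - 1)"
    by (intro continuous_intros continuous_map_from_subtopology u(1))
  have k3: "cells_below 3 \<le> k" by (simp add: k_def)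
  obtain v' where v': "continuous_map (subtopology ?C Y) (subtopology L (stage k)) v'"
    "\<forall>y\<in>topspace (subtopology ?C Y). (1 \<le> 2 * u y - 1 \<or> (r \<circ> F) y \<in> stage (cells_below 3) \<longrightarrow> v' y = (r \<circ> F) y) \<and>
       (2 * u y - 1 \<le> 0 \<longrightarrow> v' y \<in> stage (cells_below 3))"
    using compress[OF k3 in_AE_closed_subtopology[OF sph Y] v \<sigma>] by blast
  define Z where "Z = {x \<in> C. u x = 1/2}"
  have Z: "closedin ?C Z"
    using closedin_continuous_map_preimage[OF u(1), of "{1/2}"] by (simp add: Z_def)
  have ZY: "Z \<subseteq> Y" by (auto simp: Z_def Y_def)
  have YC: "Y \<subseteq> C" by (auto simp: Y_def)
  have v'L: "continuous_map (subtopology ?C Y) L v'"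
    using v'(1) by (simp add: continuous_map_in_subtopology)
  have "v' y \<in> stage (cells_below 3)" if "y \<in> Z" for y
    using v'(2) that YC ZY by (auto simp: Z_def)
  then have "continuous_map (subtopology ?C Z) (subtopology L (stage (cells_below 3))) v'"
    using continuous_map_from_subtopology_mono[OF v'L ZY] by (auto simp: continuous_map_in_subtopology)
  then obtain h where h: "continuous_map ?C (subtopology L (stage (cells_below 3))) h" "\<forall>x\<in>Z. h x = v' x"
    by (rule in_AE_D[OF AE Z])
  have "continuous_map ?C L (\<lambda>x. if 1/2 \<le> u x then v' x else h x)"
  proof (rule continuous_map_cases_le)
    show "continuous_map (subtopology ?C {x \<in> topspace ?C. 1/2 \<le> u x}) L v'"
      using v'L by (simp add: Y_def)
    show "continuous_map (subtopology ?C {x \<in> topspace ?C. u x \<le> 1/2}) L h"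
      using h(1) by (simp only: continuous_map_in_subtopology continuous_map_from_subtopology)
    show "v' x = h x" if "x \<in> topspace ?C" "1/2 = u x" for x
      using h(2) that by (simp add: Z_def)
  qed (use u in auto)
  moreover have "(if 1/2 \<le> u x then v' x else h x) = f x" if x: "x \<in> A" for x
  proof -
    have "u x = 1" using u(2) x by auto
    moreover have "x \<in> C" using x AC by auto
    ultimately have "v' x = r (F x)"
      using v'(2) by (simp add: Y_def)
    then show ?thesis
      using F(2) x r\<iota> fk \<open>u x = 1\<close> by auto
  qed
  ultimately show "\<exists>g. continuous_map ?C L g \<and> (\<forall>x\<in>A. g x = f x)" by blast
qed

text \<open>A map \<open>f\<close> to the 2-skeleton extends to a map \<open>g\<close> to \<open>L\<close>. The closed sets \<open>F k\<close> on which \<open>g\<close> keeps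
  to a finite stage, uniformly on balls of radius \<open>1/k\<close>, exhaust \<open>X\<close>, and each lies in the
  interior of the next. The maps \<open>G k\<close> are compressed over \<open>F k\<close>. Compression never moves points of
  the 2-skeleton, so \<open>G (Suc k)\<close> agrees with \<open>G k\<close> on \<open>F k\<close>, and the sequence has a limit.\<close>
lemma skeleton_in_AE:
  fixes X :: "'m::metric_space set"
  assumes L: "in_AE L (top_of_set X)" and sph: "\<And>m. 2 \<le> m \<Longrightarrow> in_AE (nsphere m) (top_of_set X)"
  shows "in_AE (subtopology L (stage (cells_below 3))) (top_of_set X)"
  unfolding in_AE_def
proof (intro allI impI, elim conjE)
  let ?X = "top_of_set X" and ?b = "cells_below 3"
  fix A f assume A: "closedin ?X A" and f: "continuous_map (subtopology ?X A) (subtopology L (stage ?b)) f"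
  have AX: "A \<subseteq> X" using closedin_subset[OF A] by simp
  have N: "normal_space ?X"
    by (simp add: metrizable_imp_normal_space metrizable_space_subtopology metrizable_space_euclidean)
  have fL: "continuous_map (subtopology ?X A) L f" and fb: "\<And>x. x \<in> A \<Longrightarrow> f x \<in> stage ?b"
    using f AX by (auto simp: continuous_map_in_subtopology)
  obtain g where g: "continuous_map ?X L g" "\<forall>x\<in>A. g x = f x"
    by (rule in_AE_D[OF L A fL])
  define F where "F k = {x \<in> X. \<forall>y\<in>X. real k * dist x y < 1 \<longrightarrow> g y \<in> stage (?b + k)}" for k
  \<comment> \<open>Balls of radius \<open>d k\<close> around points of \<open>F k\<close> stay in \<open>F (Suc k)\<close> when \<open>k\<close> is positive.\<close>
  define d where "d k = 1 / real k - 1 / real (Suc k)" for k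
  define W where "W k = X \<inter> (\<Union>x\<in>F k. ball x (d k))" for k
  have d0: "0 < d (Suc k)" for k
    using divide_strict_left_mono[of "real (Suc k)" "real (Suc (Suc k))" 1] by (simp add: d_def)
  have FX: "F k \<subseteq> X" for k by (auto simp: F_def)
  have Fg: "g x \<in> stage (?b + k)" if "x \<in> F k" for x k
    using that by (auto simp: F_def)
  have Fmono: "F k \<subseteq> F (Suc k)" for k
  proof
    fix x assume x: "x \<in> F k"
    have "g y \<in> stage (?b + Suc k)" if y: "y \<in> X" "real (Suc k) * dist x y < 1" for y
    proof -
      have "real k * dist x y \<le> real (Suc k) * dist x y" by (intro mult_right_mono) auto
      then have "g y \<in> stage (?b + k)" using x y by (simp add: F_def)
      then show ?thesis using stage_mono[of "?b + k" "?b + Suc k"] by auto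
    qed
    then show "x \<in> F (Suc k)" using x by (simp add: F_def)
  qed
  have Wopen: "openin ?X (W k)" for k
    unfolding W_def by (intro openin_open_Int open_UN ballI open_ball)
  have FW: "F (Suc k) \<subseteq> W (Suc k)" for k
  proof
    fix x assume x: "x \<in> F (Suc k)"
    have "x \<in> ball x (d (Suc k))" using d0 by simp
    then show "x \<in> W (Suc k)" unfolding W_def using x FX by blast
  qed
  have WF: "W (Suc k) \<subseteq> F (Suc (Suc k))" for k
  proof
    fix x assume "x \<in> W (Suc k)"
    then obtain x' where x: "x \<in> X" "x' \<in> F (Suc k)" "dist x' x < d (Suc k)" by (auto simp: W_def)
    have "g y \<in> stage (?b + Suc (Suc k))" if y: "y \<in> X" "real (Suc (Suc k)) * dist x y < 1" for y
    proof -
      have "dist x y < 1 / real (Suc (Suc k))"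
        using y(2) by (subst pos_less_divide_eq) (simp_all only: mult.commute of_nat_0_less_iff zero_less_Suc)
      then have "dist x' y < d (Suc k) + 1 / real (Suc (Suc k))"
        using x(3) dist_triangle[of x' y x] by linarith
      then have "dist x' y < 1 / real (Suc k)"
        by (simp add: d_def)
      then have "real (Suc k) * dist x' y < 1"
        by (subst (asm) pos_less_divide_eq) (simp_all only: mult.commute of_nat_0_less_iff zero_less_Suc)
      then have "g y \<in> stage (?b + Suc k)"
        using x(2) y(1) unfolding F_def by blast
      then show ?thesis using stage_mono[of "?b + Suc k" "?b + Suc (Suc k)"] by auto
    qed
    then show "x \<in> F (Suc (Suc k))" using x by (simp add: F_def)
  qed
  have Fclosed: "closedin ?X (F k)" for k
  proof -
    have "openin ?X (X - F k)"
      unfolding openin_euclidean_subtopology_iff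
    proof (intro conjI ballI)
      fix x assume x: "x \<in> X - F k"
      then obtain y where y: "y \<in> X" "real k * dist x y < 1" "g y \<notin> stage (?b + k)"
        by (auto simp: F_def)
      define e where "e = (1 - real k * dist x y) / real (Suc k)"
      have e: "0 < e" using y(2) by (simp add: e_def)
      have "x' \<in> X - F k" if x': "x' \<in> X" "dist x' x < e" for x'
      proof -
        have "real k * dist x' y \<le> real k * dist x' x + real k * dist x y"
          using dist_triangle[of x' y x] by (simp flip: distrib_left add: mult_left_mono)
        also have "real k * dist x' x \<le> real (Suc k) * dist x' x"
          by (intro mult_right_mono) auto
        also have "real (Suc k) * dist x' x < 1 - real k * dist x y"
          using x'(2) unfolding e_def
          by (subst (asm) pos_less_divide_eq) (simp_all only: mult.commute of_nat_0_less_iff zero_less_Suc)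
        finally have "real k * dist x' y < 1" by simp
        then show ?thesis using y x' by (auto simp: F_def)
      qed
      then show "\<exists>e>0. \<forall>x'\<in>X. dist x' x < e \<longrightarrow> x' \<in> X - F k"
        using e by blast
    qed auto
    then show ?thesis using FX by (simp add: closedin_def)
  qed
  have Fcover: "\<exists>k. x \<in> F k" if x: "x \<in> X" for x
  proof -
    obtain \<epsilon> k where \<epsilon>: "0 < \<epsilon>" "\<forall>y\<in>X. dist x y < \<epsilon> \<longrightarrow> g y \<in> stage k"
      using locally_in_stage[OF g(1) x] by blast
    obtain N where Ne: "1 / real (Suc N) < \<epsilon>" using \<epsilon>(1) nat_approx_posE by blast
    let ?K = "Suc (max N k)"
    have "g y \<in> stage (?b + ?K)" if y: "y \<in> X" "real ?K * dist x y < 1" for y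
    proof -
      have "real (Suc N) * dist x y \<le> real ?K * dist x y" by (intro mult_right_mono) auto
      then have "real (Suc N) * dist x y < 1" using y(2) by linarith
      then have "dist x y < 1 / real (Suc N)"
        by (subst pos_less_divide_eq) (simp_all only: mult.commute of_nat_0_less_iff zero_less_Suc)
      then have "g y \<in> stage k" using \<epsilon>(2) y(1) Ne by auto
      moreover have "k \<le> ?b + ?K" by simp
      ultimately show ?thesis using stage_mono by blast
    qed
    then have "x \<in> F ?K" using x by (simp add: F_def)
    then show ?thesis by blast
  qed
  define P where "P k G \<longleftrightarrow> continuous_map ?X L G \<and> (\<forall>x\<in>X. g x \<in> stage ?b \<longrightarrow> G x = g x) \<and>
    (\<forall>j\<ge>k. \<forall>x\<in>F j. G x \<in> stage (?b + j)) \<and> (\<forall>x\<in>F k. G x \<in> stage ?b)" for k G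
  have "\<exists>G. \<forall>k. P k (G k) \<and> (\<forall>x\<in>X. G k x \<in> stage ?b \<longrightarrow> G (Suc k) x = G k x)"
  proof (rule dependent_nat_choice)
    have "\<forall>x\<in>F 0. g x \<in> stage ?b" using Fg[of _ 0] by simp
    then show "\<exists>G. P 0 G" unfolding P_def using g(1) Fg by blast
  next
    fix G k assume G: "P k G"
    let ?Y = "F (Suc (Suc k))" and ?T = "X - W (Suc k)"
    have T: "closedin ?X ?T" using Wopen by (simp add: closedin_diff)
    have "disjnt (F (Suc k)) ?T" using FW by (auto simp: disjnt_def)
    then obtain \<sigma> where \<sigma>: "continuous_map ?X euclideanreal \<sigma>" "\<sigma> ` F (Suc k) \<subseteq> {0}" "\<sigma> ` ?T \<subseteq> {1}"
      using Urysohn_lemma_alt[OF N Fclosed T] by metis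
    have tY: "topspace (subtopology ?X ?Y) = ?Y" using FX by auto
    have "G x \<in> stage (?b + Suc (Suc k))" if "x \<in> ?Y" for x
      using G that unfolding P_def by (meson le_SucI order_refl)
    then have v: "continuous_map (subtopology ?X ?Y) (subtopology L (stage (?b + Suc (Suc k)))) G"
      using G tY unfolding P_def continuous_map_in_subtopology by (simp add: continuous_map_from_subtopology Pi_iff)
    obtain v' where v': "continuous_map (subtopology ?X ?Y) (subtopology L (stage (?b + Suc (Suc k)))) v'"
      "\<forall>y\<in>?Y. (1 \<le> \<sigma> y \<or> G y \<in> stage ?b \<longrightarrow> v' y = G y) \<and> (\<sigma> y \<le> 0 \<longrightarrow> v' y \<in> stage ?b)"
      using compress[OF le_add1 in_AE_closed_subtopology[OF sph Fclosed] v continuous_map_from_subtopology[OF \<sigma>(1)]]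
      unfolding tY by blast
    define G' where "G' x = (if x \<in> ?Y then v' x else G x)" for x
    have G'T: "G' x = G x" if "x \<in> ?T" for x
      using v'(2) \<sigma>(3) that by (auto simp: G'_def)
    have keep: "G' x = G x" if "G x \<in> stage ?b" for x
      using v'(2) that by (auto simp: G'_def)
    have v'Y: "v' x \<in> stage (?b + Suc (Suc k))" if "x \<in> ?Y" for x
      using continuous_map_image_subset_topspace[OF v'(1)] tY that by auto
    have "continuous_map ?X L G'"
    proof (rule continuous_map_on_two_closed[OF Fclosed T])
      show "?Y \<union> ?T = topspace ?X" using WF[of k] FX by auto
      show "continuous_map (subtopology ?X ?Y) L G'"
        by (rule continuous_map_eq[of _ _ v']) (use v'(1) tY in \<open>auto simp: continuous_map_in_subtopology G'_def\<close>)
      have "continuous_map (subtopology ?X ?T) L G"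
        using G unfolding P_def by (simp add: continuous_map_from_subtopology)
      then show "continuous_map (subtopology ?X ?T) L G'"
        by (rule continuous_map_eq) (use G'T in auto)
    qed
    moreover have "\<forall>x\<in>X. g x \<in> stage ?b \<longrightarrow> G' x = g x"
      using G keep unfolding P_def by metis
    moreover have last: "\<forall>x\<in>F (Suc k). G' x \<in> stage ?b"
    proof
      fix x assume x: "x \<in> F (Suc k)"
      then have "\<sigma> x = 0" using \<sigma>(2) by auto
      then show "G' x \<in> stage ?b" using v'(2) x Fmono[of "Suc k"] by (auto simp: G'_def)
    qed
    moreover have "G' x \<in> stage (?b + j)" if j: "Suc k \<le> j" and x: "x \<in> F j" for j x
    proof (cases "x \<in> ?Y")
      case True
      show ?thesis
      proof (cases "j = Suc k")
        case True
        then show ?thesis using last x stage_mono[of ?b "?b + j"] by auto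
      next
        case False
        then have "?b + Suc (Suc k) \<le> ?b + j" using j by simp
        then have "v' x \<in> stage (?b + j)" using v'Y[OF \<open>x \<in> ?Y\<close>] stage_mono by blast
        then show ?thesis using \<open>x \<in> ?Y\<close> by (simp add: G'_def)
      qed
    next
      case False
      have "G x \<in> stage (?b + j)" using G x j unfolding P_def by (meson Suc_leD)
      then show ?thesis using False by (simp add: G'_def)
    qed
    ultimately have "P (Suc k) G'" unfolding P_def by blast
    then show "\<exists>G'. P (Suc k) G' \<and> (\<forall>x\<in>X. G x \<in> stage ?b \<longrightarrow> G' x = G x)"
      using keep by blast
  qed
  then obtain G where G: "\<And>k. P k (G k)" and step: "\<And>k x. x \<in> X \<Longrightarrow> G k x \<in> stage ?b \<Longrightarrow> G (Suc k) x = G k x"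
    by blast
  have Gb: "G k x \<in> stage ?b" if "x \<in> F k" for k x
    using G[of k] that unfolding P_def by blast
  have const: "G (k + i) x = G k x" if x: "x \<in> F k" for k i x
  proof (induction i)
    case (Suc i)
    have "x \<in> X" using x FX by blast
    then show ?case using step[of x "k + i"] Gb[OF x] Suc by simp
  qed simp
  \<comment> \<open>At each point the sequence \<open>G k\<close> is eventually constant.\<close>
  define h where "h x = G (LEAST k. x \<in> F k) x" for x
  have h: "h x = G k x" if x: "x \<in> F k" for k x
  proof -
    let ?l = "LEAST k. x \<in> F k"
    have "x \<in> F ?l" using x by (rule LeastI)
    moreover have "?l \<le> k" using x by (rule Least_le)
    ultimately show ?thesis using const[of x ?l "k - ?l"] by (simp add: h_def)
  qed
  have "continuous_map ?X L h"
  proof (rule pasting_lemma[where I = UNIV and T = "\<lambda>k. W (Suc k)" and f = "\<lambda>k. G (Suc (Suc k))"])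
    show "openin ?X (W (Suc k))" for k by (rule Wopen)
    show "continuous_map (subtopology ?X (W (Suc k))) L (G (Suc (Suc k)))" for k
      using G[of "Suc (Suc k)"] unfolding P_def by (simp add: continuous_map_from_subtopology)
    show "G (Suc (Suc i)) x = G (Suc (Suc j)) x" if "x \<in> topspace ?X \<inter> W (Suc i) \<inter> W (Suc j)" for i j x
      using that WF h by (metis Int_iff subsetD)
    show "\<exists>j. j \<in> UNIV \<and> x \<in> W (Suc j) \<and> h x = G (Suc (Suc j)) x" if x: "x \<in> topspace ?X" for x
    proof -
      obtain k where "x \<in> F k" using Fcover x by auto
      then have "x \<in> W (Suc k)" using Fmono FW by blast
      moreover have "h x = G (Suc (Suc k)) x" using h WF calculation by blast
      ultimately show ?thesis by blast
    qed
  qed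
  moreover have "h x \<in> stage ?b" if "x \<in> X" for x
    using Fcover[OF that] h Gb by metis
  ultimately have "continuous_map ?X (subtopology L (stage ?b)) h"
    by (auto simp: continuous_map_in_subtopology)
  moreover have "h x = f x" if x: "x \<in> A" for x
  proof -
    obtain k where k: "x \<in> F k" using Fcover AX x by blast
    have "G k x = g x" using G[of k] fb[OF x] g(2) x AX unfolding P_def by auto
    then show ?thesis using h[OF k] g(2) x by simp
  qed
  ultimately show "\<exists>g. continuous_map ?X (subtopology L (stage ?b)) g \<and> (\<forall>x\<in>A. g x = f x)" by blast
qed

end

section \<open>Compactifications preserving absolute extensors\<close>

text \<open>Names for a countable family of functions on a space. \<open>Coord n\<close> is a given function, and
  \<open>Sol j ts i\<close> is the \<open>i\<close>-th coordinate of the chosen solution of the extension problem with values in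
  the \<open>j\<close>-th target space that the functions named by \<open>ts\<close> pose. As names form a datatype with
  countable parameters, the family is countable by construction.\<close>
datatype fterm = Coord nat | Const rat | Add fterm fterm | Mul fterm fterm | Sol nat "fterm list" nat

instance fterm :: countable by countable_datatype

primrec fterm_val :: "(nat \<Rightarrow> ('x \<Rightarrow> nat \<Rightarrow> real) \<Rightarrow> 'x \<Rightarrow> nat \<Rightarrow> real) \<Rightarrow> (nat \<Rightarrow> 'x \<Rightarrow> real) \<Rightarrow> fterm \<Rightarrow> 'x \<Rightarrow> real"
  where
    "fterm_val sol c (Coord n) = c n"
  | "fterm_val sol c (Const q) = (\<lambda>x. of_rat q)"
  | "fterm_val sol c (Add s t) = (\<lambda>x. fterm_val sol c s x + fterm_val sol c t x)"
  | "fterm_val sol c (Mul s t) = (\<lambda>x. fterm_val sol c s x * fterm_val sol c t x)"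
  | "fterm_val sol c (Sol j ts i) = (\<lambda>x. sol j (\<lambda>y m. if m < length ts then (map (fterm_val sol c) ts ! m) y else 0) x i)"

text \<open>A neighbourhood of a compact set is controlled by finitely many coordinates, and in terms of
  them the neighbourhoods are boxes, hence convex.\<close>
lemma compact_box_nbhd:
  fixes P :: "(nat \<Rightarrow> real) set"
  assumes P: "compact P" and V: "open V" "P \<subseteq> V"
  obtains M e where "0 < e" "\<And>p x. p \<in> P \<Longrightarrow> (\<And>i. i < M \<Longrightarrow> \<bar>x i - p i\<bar> < e) \<Longrightarrow> x \<in> V"
proof -
  obtain d where d: "0 < d" "(\<Union>p\<in>P. ball p d) \<subseteq> V"
    using compact_subset_open_imp_ball_epsilon_subset[OF P V] by blast
  obtain N :: nat where N: "(1/2) ^ N < d / 2"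
    using real_arch_pow_inv[of "d / 2" "1/2"] d(1) by auto
  define M where "M = Suc (Max (from_nat ` {..N}))"
  have M: "from_nat n < M" if "n \<le> N" for n
    unfolding M_def less_Suc_eq_le using that by (intro Max_ge) auto
  have "x \<in> V" if p: "p \<in> P" and x: "\<And>i. i < M \<Longrightarrow> \<bar>x i - p i\<bar> < d / 4" for p x
  proof -
    have "Max {dist (p (from_nat n)) (x (from_nat n)) |n. n \<le> N} < d / 4"
    proof (subst Max_less_iff)
      show "finite {dist (p (from_nat n)) (x (from_nat n)) |n. n \<le> N}" by simp
      show "{dist (p (from_nat n)) (x (from_nat n)) |n. n \<le> N} \<noteq> {}" by auto
      show "\<forall>a\<in>{dist (p (from_nat n)) (x (from_nat n)) |n. n \<le> N}. a < d / 4"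
        using x M by (auto simp: dist_real_def abs_minus_commute)
    qed
    then have "dist p x < d"
      using dist_fun_le_dist_first_terms[of p x N] N by linarith
    then have "x \<in> (\<Union>p\<in>P. ball p d)" using p by (intro UN_I[of p]) (simp_all add: mem_ball)
    then show ?thesis using d(2) by blast
  qed
  then show thesis using that[of "d / 4" M] d(1) by simp
qed

text \<open>See the introduction for the idea. In the proof \<open>e\<close> embeds \<open>X\<close> by all functions \<open>val t\<close>, and every
  algebraic relation between these functions persists between the corresponding coordinates of
  points of the closure \<open>C\<close>.\<close>
theorem AE_compactification:
  fixes X :: "(nat \<Rightarrow> real) set" and P :: "nat \<Rightarrow> (nat \<Rightarrow> real) set"
  assumes bounded: "\<And>x i. x \<in> X \<Longrightarrow> \<bar>x i\<bar> \<le> 1"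
    and P: "\<And>j. compact (P j)" and U: "\<And>j. open (U j)" "\<And>j. P j \<subseteq> U j"
    and r: "\<And>j. continuous_on (U j) (r j)" "\<And>j. r j ` U j \<subseteq> P j" "\<And>j p. p \<in> P j \<Longrightarrow> r j p = p"
    and AE: "\<And>j. in_AE (top_of_set (P j)) (top_of_set X)"
  obtains C :: "(nat \<Rightarrow> real) set" where "compact C"
    "metrizable_compactification (top_of_set X) (top_of_set C)"
    "\<forall>j. in_AE (top_of_set (P j)) (top_of_set C)"
proof -
  have "\<exists>V W. open V \<and> closed W \<and> P j \<subseteq> V \<and> V \<subseteq> W \<and> W \<subseteq> U j" for j
  proof -
    have "normal_space R_omega"
      by (simp add: metrizable_imp_normal_space metrizable_space_euclidean)
    moreover have "closedin R_omega (P j)" "closedin R_omega (- U j)" "disjnt (P j) (- U j)"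
      using compact_imp_closed[OF P[of j]] U(1)[of j] U(2)[of j] by (auto simp: disjnt_def)
    ultimately obtain u where u: "continuous_map R_omega euclideanreal u" "u ` P j \<subseteq> {0}" "u ` (- U j) \<subseteq> {1}"
      using Urysohn_lemma_alt by metis
    have uc: "continuous_on UNIV u" using u(1) by simp
    have "u x = 1" if "x \<notin> U j" for x using u(3) that by auto
    then have "{x. u x \<le> 1/2} \<subseteq> U j" by force
    moreover have "P j \<subseteq> {x. u x < 1/2}" using u(2) by force
    moreover have "open {x. u x < 1/2}" "closed {x. u x \<le> 1/2}"
      using uc by (auto intro!: open_Collect_less closed_Collect_le continuous_intros)
    ultimately show ?thesis
      by (intro exI[of _ "{x. u x < 1/2}"] exI[of _ "{x. u x \<le> 1/2}"]) auto
  qed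
  then obtain V W where VW: "\<And>j. open (V j)" "\<And>j. closed (W j)" "\<And>j. P j \<subseteq> V j" "\<And>j. V j \<subseteq> W j" "\<And>j. W j \<subseteq> U j"
    by metis
  \<comment> \<open>The problem is posed on the closed set \<open>W j\<close>; the open set \<open>V j\<close> inside it serves for limits of points of \<open>X\<close>.\<close>
  define is_sol where "is_sol j G S \<longleftrightarrow> continuous_on X S \<and> S ` X \<subseteq> P j \<and> (\<forall>x\<in>X. G x \<in> W j \<longrightarrow> S x = r j (G x))"
    for j and G S :: "(nat \<Rightarrow> real) \<Rightarrow> nat \<Rightarrow> real"
  have ex_sol: "\<exists>S. is_sol j G S" if G: "continuous_on X G" for j G
  proof -
    let ?A = "{x \<in> X. G x \<in> W j}"
    have A: "closedin (top_of_set X) ?A"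
      using continuous_closedin_preimage[OF G VW(2)[of j]] by (simp add: vimage_def Int_def)
    have "continuous_on ?A (\<lambda>x. r j (G x))"
      by (rule continuous_on_compose2[OF r(1) continuous_on_subset[OF G]]) (use VW(5) in auto)
    moreover have "(\<lambda>x. r j (G x)) ` ?A \<subseteq> P j" using r(2)[of j] VW(5)[of j] by blast
    moreover have "subtopology (top_of_set X) ?A = top_of_set ?A"
      by (simp add: subtopology_subtopology Int_absorb1)
    ultimately have "continuous_map (subtopology (top_of_set X) ?A) (top_of_set (P j)) (\<lambda>x. r j (G x))"
      by auto
    then obtain S where "continuous_map (top_of_set X) (top_of_set (P j)) S" "\<forall>x\<in>?A. S x = r j (G x)"
      by (rule in_AE_D[OF AE A])
    then show ?thesis unfolding is_sol_def by auto
  qed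
  define sol where "sol j G = (SOME S. is_sol j G S)" for j G
  have sol: "is_sol j G (sol j G)" if "continuous_on X G" for j G
    unfolding sol_def by (rule someI_ex[OF ex_sol[OF that]])
  define val where "val = fterm_val sol (\<lambda>n x. x n)"
  have coord: "continuous_on S (\<lambda>y. y n)" for S :: "(nat \<Rightarrow> real) set" and n
    by (rule continuous_on_subset[OF continuous_on_product_coordinates]) simp
  have args: "continuous_on X (\<lambda>y m. if m < length ts then (map val ts ! m) y else 0)"
    if "\<And>t. t \<in> set ts \<Longrightarrow> continuous_on X (val t)" for ts
  proof (rule continuous_on_coordinatewise_then_product)
    show "continuous_on X (\<lambda>y. if m < length ts then (map val ts ! m) y else 0)" for m
      using that[of "ts ! m"] by (cases "m < length ts") auto
  qed
  have val: "continuous_on X (val t) \<and> (\<exists>B. \<forall>x\<in>X. \<bar>val t x\<bar> \<le> B)" for t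
  proof (induction t)
    case (Coord n)
    then show ?case using bounded coord by (auto simp: val_def)
  next
    case (Const q)
    then show ?case by (auto simp: val_def)
  next
    case (Add s t)
    then obtain A B where "\<forall>x\<in>X. \<bar>val s x\<bar> \<le> A" "\<forall>x\<in>X. \<bar>val t x\<bar> \<le> B" by blast
    then have "\<forall>x\<in>X. \<bar>val (Add s t) x\<bar> \<le> A + B"
      unfolding val_def by (auto intro: order_trans[OF abs_triangle_ineq] add_mono)
    then show ?case
      using Add by (auto simp: val_def intro!: continuous_on_add)
  next
    case (Mul s t)
    then obtain A B where "\<forall>x\<in>X. \<bar>val s x\<bar> \<le> A" "\<forall>x\<in>X. \<bar>val t x\<bar> \<le> B" by blast
    then have "\<forall>x\<in>X. \<bar>val (Mul s t) x\<bar> \<le> A * B"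
      unfolding val_def by (auto simp: abs_mult intro!: mult_mono intro: order_trans[OF abs_ge_zero])
    then show ?case
      using Mul by (auto simp: val_def intro!: continuous_on_mult)
  next
    case (Sol j ts i)
    define S where "S = sol j (\<lambda>y m. if m < length ts then (map val ts ! m) y else 0)"
    have S: "continuous_on X S" "S ` X \<subseteq> P j"
    proof -
      have "is_sol j (\<lambda>y m. if m < length ts then (map val ts ! m) y else 0) S"
        unfolding S_def by (rule sol, rule args) (use Sol in blast)
      then show "continuous_on X S" "S ` X \<subseteq> P j" unfolding is_sol_def by simp_all
    qed
    have eq: "val (Sol j ts i) = (\<lambda>x. S x i)"
      unfolding val_def S_def by simp
    have "bounded ((\<lambda>p. p i) ` P j)"
      by (intro compact_imp_bounded compact_continuous_image coord P)
    then obtain B where "\<forall>p\<in>P j. \<bar>p i\<bar> \<le> B" by (auto simp: bounded_iff)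
    then have "\<forall>x\<in>X. \<bar>val (Sol j ts i) x\<bar> \<le> B" using S(2) by (auto simp: eq)
    then show ?case
      using continuous_on_product_then_coordinatewise[OF S(1), of i] by (auto simp: eq)
  qed
  then obtain B where B: "\<And>t x. x \<in> X \<Longrightarrow> \<bar>val t x\<bar> \<le> B t" by metis
  define e where "e x = (\<lambda>n. val (from_nat n) x)" for x
  define C where "C = closure (e ` X)"
  have e_cont: "continuous_on X e"
    unfolding e_def[abs_def] using val by (intro continuous_on_coordinatewise_then_product) auto
  have e_at: "e x (to_nat t) = val t x" for x t by (simp add: e_def)
  have eC: "e x \<in> C" if "x \<in> X" for x
    unfolding C_def using that closure_subset[of "e ` X"] by blast
  \<comment> \<open>Closed conditions pass from the image of \<open>X\<close> to its closure \<open>C\<close>.\<close>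
  have C_ind: "Q y" if "closed {y. Q y}" "\<And>x. x \<in> X \<Longrightarrow> Q (e x)" "y \<in> C" for Q y
  proof -
    have "C \<subseteq> {y. Q y}"
      unfolding C_def by (rule closure_minimal) (use that in auto)
    then show ?thesis using that(3) by blast
  qed
  have "compact C"
  proof -
    let ?K = "PiE UNIV (\<lambda>n. {- B (from_nat n)..B (from_nat n)})"
    have K: "compact ?K"
      using compactin_PiE[of "\<lambda>_. euclideanreal" UNIV "\<lambda>n. {- B (from_nat n)..B (from_nat n)}"]
      by (simp add: euclidean_product_topology)
    have "e ` X \<subseteq> ?K"
      using B by (auto simp: e_def abs_le_iff minus_le_iff)
    then have "C \<subseteq> ?K"
      unfolding C_def using K compact_imp_closed closure_minimal by blast
    then show ?thesis
      using K by (metis C_def closed_closure closed_Int_compact inf.absorb1)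
  qed
  \<comment> \<open>Indices outside the range of \<open>to_nat\<close> repeat coordinates that have a name.\<close>
  have C_same: "y n = y (to_nat (from_nat n :: fterm))" if "y \<in> C" for y n
    by (rule C_ind[OF _ _ that]) (auto simp: e_def intro!: closed_Collect_eq coord)
  have C_add: "y (to_nat (Add s t)) = y (to_nat s) + y (to_nat t)" if "y \<in> C" for y s t
    by (rule C_ind[OF _ _ that]) (auto simp: e_at val_def intro!: closed_Collect_eq coord continuous_on_add)
  have C_mul: "y (to_nat (Mul s t)) = y (to_nat s) * y (to_nat t)" if "y \<in> C" for y s t
    by (rule C_ind[OF _ _ that]) (auto simp: e_at val_def intro!: closed_Collect_eq coord continuous_on_mult)
  have C_const: "y (to_nat (Const q)) = of_rat q" if "y \<in> C" for y q
    by (rule C_ind[OF _ _ that]) (auto simp: e_at val_def intro!: closed_Collect_eq coord)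
  define near where "near F d t \<longleftrightarrow> (\<forall>y\<in>C. \<bar>F y - y (to_nat t)\<bar> < d)" for F :: "(nat \<Rightarrow> real) \<Rightarrow> real" and d and t :: fterm
  \<comment> \<open>The uniform closure of the named functions on \<open>C\<close> is an algebra that separates points.\<close>
  define R where "R = {F. continuous_on C F \<and> (\<forall>d>0. \<exists>t. near F d t)}"
  have R_near: "\<exists>t. near f d t" if "f \<in> R" "0 < d" for f d
    using that by (simp add: R_def)
  interpret function_ring_on R C
  proof
    show "compact C" by fact
    show "continuous_on C f" if "f \<in> R" for f using that by (simp add: R_def)
    show "(\<lambda>x. f x + g x) \<in> R" if f: "f \<in> R" and g: "g \<in> R" for f g
    proof -
      have "\<exists>t. near (\<lambda>x. f x + g x) d t" if d: "0 < d" for d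
      proof -
        obtain s t where st: "near f (d / 2) s" "near g (d / 2) t"
          using R_near[OF f, of "d / 2"] R_near[OF g, of "d / 2"] d by auto
        have "near (\<lambda>x. f x + g x) d (Add s t)"
          unfolding near_def
        proof
          fix y assume y: "y \<in> C"
          then have "\<bar>f y - y (to_nat s)\<bar> < d / 2" "\<bar>g y - y (to_nat t)\<bar> < d / 2"
            using st by (auto simp: near_def)
          then show "\<bar>f y + g y - y (to_nat (Add s t))\<bar> < d"
            unfolding C_add[OF y] by linarith
        qed
        then show ?thesis by blast
      qed
      then show ?thesis using f g by (auto simp: R_def intro: continuous_on_add)
    qed
    show "(\<lambda>x. f x * g x) \<in> R" if f: "f \<in> R" and g: "g \<in> R" for f g
    proof -
      have "bounded (f ` C)" "bounded (g ` C)"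
        using f g \<open>compact C\<close> by (auto simp: R_def intro!: compact_imp_bounded compact_continuous_image)
      then obtain K1 K2 where K': "\<forall>y\<in>C. \<bar>f y\<bar> \<le> K1" "\<forall>y\<in>C. \<bar>g y\<bar> \<le> K2"
        by (auto simp: bounded_iff)
      define K where "K = max 0 (max K1 K2)"
      have K: "0 \<le> K" "\<And>y. y \<in> C \<Longrightarrow> \<bar>f y\<bar> \<le> K" "\<And>y. y \<in> C \<Longrightarrow> \<bar>g y\<bar> \<le> K"
        using K' by (auto simp: K_def le_max_iff_disj)
      have "\<exists>t. near (\<lambda>x. f x * g x) d t" if d: "0 < d" for d
      proof -
        define a where "a = min 1 (d / (2 * (K + 1)))"
        have a: "0 < a" "a \<le> 1" "a \<le> d / (2 * (K + 1))"
          using d K(1) by (auto simp: a_def)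
        then have ad: "a * (2 * (K + 1)) \<le> d"
          using K(1) by (subst (asm) pos_le_divide_eq) auto
        obtain s t where st: "near f a s" "near g a t"
          using R_near[OF f a(1)] R_near[OF g a(1)] by blast
        have "near (\<lambda>x. f x * g x) d (Mul s t)"
          unfolding near_def
        proof
          fix y assume y: "y \<in> C"
          define u v where "u = f y - y (to_nat s)" and "v = g y - y (to_nat t)"
          have uv: "\<bar>u\<bar> < a" "\<bar>v\<bar> < a"
            using st y by (auto simp: near_def u_def v_def)
          have "f y * g y - y (to_nat (Mul s t)) = f y * v + g y * u - u * v"
            unfolding C_mul[OF y] u_def v_def by (simp add: algebra_simps)
          also have "\<bar>\<dots>\<bar> \<le> \<bar>f y\<bar> * \<bar>v\<bar> + \<bar>g y\<bar> * \<bar>u\<bar> + \<bar>u\<bar> * \<bar>v\<bar>"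
            unfolding abs_mult[symmetric] by linarith
          also have "\<bar>f y\<bar> * \<bar>v\<bar> \<le> K * a" using K(1) K(2)[OF y] uv by (intro mult_mono) auto
          also have "\<bar>g y\<bar> * \<bar>u\<bar> \<le> K * a" using K(1) K(3)[OF y] uv by (intro mult_mono) auto
          also have "\<bar>u\<bar> * \<bar>v\<bar> \<le> 1 * a" using uv a by (intro mult_mono) auto
          also have "K * a + K * a + 1 * a < a * (2 * (K + 1))"
            using a(1) by (simp add: algebra_simps)
          finally show "\<bar>f y * g y - y (to_nat (Mul s t))\<bar> < d" using ad by simp
        qed
        then show ?thesis by blast
      qed
      then show ?thesis using f g by (auto simp: R_def intro: continuous_on_mult)
    qed
    show "(\<lambda>_. c) \<in> R" for c
    proof -
      have "\<exists>t. near (\<lambda>_. c) d t" if d: "0 < d" for d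
      proof -
        obtain q where "c - d < of_rat q" "of_rat q < c"
          using of_rat_dense[of "c - d" c] d by auto
        then have "near (\<lambda>_. c) d (Const q)"
          using C_const by (auto simp: near_def)
        then show ?thesis by blast
      qed
      then show ?thesis by (simp add: R_def)
    qed
    show "\<exists>f\<in>R. f y \<noteq> f z" if yz: "y \<in> C" "z \<in> C" "y \<noteq> z" for y z
    proof -
      obtain n where n: "y n \<noteq> z n" using yz(3) by blast
      have "near (\<lambda>y. y n) d (from_nat n)" if d: "0 < d" for d
        unfolding near_def
      proof
        fix y assume "y \<in> C"
        then have "y n - y (to_nat (from_nat n :: fterm)) = 0" using C_same[of y n] by linarith
        then show "\<bar>y n - y (to_nat (from_nat n :: fterm))\<bar> < d" using d by (simp only: abs_zero)
      qed
      then have "(\<lambda>y. y n) \<in> R" using coord by (auto simp: R_def)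
      then show ?thesis by (rule bexI[rotated]) (rule n)
    qed
  qed
  have approx: "\<exists>t. near F d t" if F: "continuous_on C F" and d: "0 < d" for F d
  proof -
    obtain G where G: "G \<in> R" "\<forall>y\<in>C. \<bar>F y - G y\<bar> < d / 2"
      using Stone_Weierstrass_basic[OF F, of "d / 2"] d by auto
    obtain t where t: "near G (d / 2) t"
      using R_near[OF G(1), of "d / 2"] d by auto
    have "near F d t"
      unfolding near_def
    proof
      fix y assume "y \<in> C"
      then have "\<bar>F y - G y\<bar> < d / 2" "\<bar>G y - y (to_nat t)\<bar> < d / 2"
        using G(2) t by (auto simp: near_def)
      then show "\<bar>F y - y (to_nat t)\<bar> < d" by linarith
    qed
    then show ?thesis by blast
  qed
  have mc: "metrizable_compactification (top_of_set X) (top_of_set C)"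
    unfolding metrizable_compactification_def
  proof (intro conjI exI)
    show "compact_space (top_of_set C)" using \<open>compact C\<close> by (simp add: compact_space_subtopology)
    show "metrizable_space (top_of_set C)"
      by (simp add: metrizable_space_subtopology metrizable_space_euclidean)
    have CX: "C \<inter> e ` X = e ` X" using eC by auto
    define p where "p y = (\<lambda>n. y (to_nat (Coord n)))" for y :: "nat \<Rightarrow> real"
    have pe: "p (e x) = x" for x by (simp add: p_def e_at val_def)
    have pc: "continuous_on (e ` X) p"
      unfolding p_def[abs_def] by (intro continuous_on_coordinatewise_then_product coord)
    have "homeomorphic_maps (top_of_set X) (top_of_set (e ` X)) e p"
      unfolding homeomorphic_maps_def using e_cont pc pe by auto
    then show "embedding_map (top_of_set X) (top_of_set C) e"
      unfolding embedding_map_def homeomorphic_map_maps by (auto simp: subtopology_subtopology CX)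
    show "top_of_set C closure_of e ` topspace (top_of_set X) = topspace (top_of_set C)"
      using CX by (simp add: closure_of_subtopology C_def)
  qed
  have "in_AE (top_of_set (P j)) (top_of_set C)" for j
    unfolding in_AE_def
  proof (intro allI impI, elim conjE)
    let ?C = "top_of_set C"
    fix A f assume A: "closedin ?C A" and f: "continuous_map (subtopology ?C A) (top_of_set (P j)) f"
    have N: "normal_space ?C"
      by (simp add: metrizable_imp_normal_space metrizable_space_subtopology metrizable_space_euclidean)
    have AC: "A \<subseteq> C" using closedin_subset[OF A] by simp
    have fP: "f y \<in> P j" if "y \<in> A" for y
      using f that AC by (auto simp: continuous_map_in_subtopology)
    have fR: "continuous_map (subtopology ?C A) R_omega f" using f by (simp add: continuous_map_in_subtopology)
    obtain F where F: "continuous_map ?C R_omega F" "\<forall>y\<in>A. F y = f y" by (rule Tietze_R_omega[OF N A fR])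
    have Fc: "continuous_on C (\<lambda>y. F y i)" for i
      using F(1) continuous_on_product_then_coordinatewise by auto
    obtain M d where d: "0 < d" and box: "\<And>p x. p \<in> P j \<Longrightarrow> (\<And>i. i < M \<Longrightarrow> \<bar>x i - p i\<bar> < d) \<Longrightarrow> x \<in> V j"
      using compact_box_nbhd[OF P VW(1) VW(3)] by metis
    have "\<exists>t. near (\<lambda>y. F y i) (d / 2) t" for i using approx[OF Fc] d by simp
    then obtain t where t: "\<And>i. near (\<lambda>y. F y i) (d / 2) (t i)" by metis
    \<comment> \<open>The functions \<open>G\<close> approximate \<open>f\<close> on \<open>A\<close>, and \<open>S\<close> is the extension to \<open>C\<close> of the solution of the problem that they pose.\<close>
    define ts where "ts = map t [0..<M]"
    define G where "G y = (\<lambda>m. if m < M then y (to_nat (t m)) else 0)" for y :: "nat \<Rightarrow> real"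
    define S where "S y = (\<lambda>i. y (to_nat (Sol j ts i)))" for y :: "nat \<Rightarrow> real"
    have "continuous_on UNIV (\<lambda>y. G y m)" for m
      unfolding G_def by (cases "m < M") (auto intro: coord)
    then have Gc: "continuous_on D G" for D
      using continuous_on_coordinatewise_then_product continuous_on_subset by blast
    have Sc: "continuous_on D S" for D
      unfolding S_def[abs_def] by (intro continuous_on_coordinatewise_then_product coord)
    have arg: "(\<lambda>y m. if m < length ts then (map val ts ! m) y else 0) = (\<lambda>y. G (e y))"
      by (auto simp: ts_def G_def e_at fun_eq_iff)
    have "is_sol j (\<lambda>y. G (e y)) (sol j (\<lambda>y. G (e y)))"
      using sol[OF args, of ts j] val unfolding arg by blast
    moreover have Se: "S (e x) = sol j (\<lambda>y. G (e y)) x" for x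
      unfolding arg[symmetric] S_def e_at unfolding val_def by simp
    ultimately have Se: "S (e x) \<in> P j" "G (e x) \<in> W j \<Longrightarrow> S (e x) = r j (G (e x))" if "x \<in> X" for x
      using that unfolding is_sol_def by auto
    have SP: "S y \<in> P j" if "y \<in> C" for y
    proof (rule C_ind[OF _ _ that])
      have "closed (S -` P j)"
        using Sc[of UNIV] compact_imp_closed[OF P[of j]] by (simp add: continuous_on_closed_vimage)
      then show "closed {y. S y \<in> P j}" by (simp add: vimage_def)
    qed (use Se in blast)
    \<comment> \<open>On \<open>X\<close> this is how \<open>S\<close> was chosen, and \<open>X\<close> is dense in the open set in question.\<close>
    have Sr: "S y = r j (G y)" if y: "y \<in> C" "G y \<in> V j" for y
    proof -
      obtain z where z: "\<And>n. z n \<in> e ` X" "z \<longlonglongrightarrow> y"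
        using y(1) unfolding C_def closure_sequential by blast
      have "\<exists>x. x \<in> X \<and> z n = e x" for n
        using z(1)[of n] by blast
      then obtain x where xz: "\<And>n. x n \<in> X \<and> z n = e (x n)" by metis
      then have "z = (\<lambda>n. e (x n))" by auto
      then have x: "\<And>n. x n \<in> X" "(\<lambda>n. e (x n)) \<longlonglongrightarrow> y" using xz z(2) by simp_all
      have Gl: "(\<lambda>n. G (e (x n))) \<longlonglongrightarrow> G y"
        using continuous_on_tendsto_compose[OF Gc[of UNIV] x(2)] by simp
      have Sl: "(\<lambda>n. S (e (x n))) \<longlonglongrightarrow> S y"
        using continuous_on_tendsto_compose[OF Sc[of UNIV] x(2)] by simp
      have evt: "\<forall>\<^sub>F n in sequentially. G (e (x n)) \<in> V j"
        using topological_tendstoD[OF Gl VW(1) y(2)] .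
      have "isCont (r j) (G y)"
        using r(1)[of j] U(1)[of j] y(2) VW(4,5)[of j] by (auto simp: continuous_on_eq_continuous_at)
      then have "(\<lambda>n. r j (G (e (x n)))) \<longlonglongrightarrow> r j (G y)"
        using Gl by (rule isCont_tendsto_compose)
      moreover have "\<forall>\<^sub>F n in sequentially. r j (G (e (x n))) = S (e (x n))"
        using evt by eventually_elim (use Se(2)[OF x(1)] VW(4)[of j] in auto)
      ultimately have "(\<lambda>n. S (e (x n))) \<longlonglongrightarrow> r j (G y)"
        by (rule Lim_transform_eventually)
      then show ?thesis by (rule LIMSEQ_unique[OF Sl])
    qed
    define Q where "Q = (\<Union>p\<in>P j. \<Inter>i\<in>{..<M}. {x :: nat \<Rightarrow> real. \<bar>x i - p i\<bar> < d / 2})"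
    define N' where "N' = C \<inter> F -` Q"
    define mix where "mix s y = (\<lambda>i. (1 - s) * F y i + s * G y i)" for s y
    have AN: "A \<subseteq> N'"
    proof
      fix y assume y: "y \<in> A"
      have "f y \<in> Q" unfolding Q_def using fP[OF y] d by (intro UN_I[of "f y"]) auto
      then show "y \<in> N'" using F(2) y AC by (auto simp: N'_def)
    qed
    have mixV: "mix s y \<in> V j" if y: "y \<in> N'" and s: "0 \<le> s" "s \<le> 1" for s y
    proof -
      obtain p where p: "p \<in> P j" "y \<in> C" "\<forall>i<M. \<bar>F y i - p i\<bar> < d / 2"
        using y unfolding N'_def Q_def by blast
      have "\<bar>mix s y i - p i\<bar> < d" if i: "i < M" for i
      proof -
        have "\<bar>F y i - G y i\<bar> < d / 2" using t[of i] p(2) i by (auto simp: near_def G_def)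
        then have "\<bar>s * (G y i - F y i)\<bar> \<le> d / 2"
          using s mult_left_le_one_le[of "\<bar>G y i - F y i\<bar>" "\<bar>s\<bar>"] by (simp add: abs_mult abs_minus_commute)
        moreover have "mix s y i - p i = (F y i - p i) + s * (G y i - F y i)"
          by (simp add: mix_def algebra_simps)
        moreover have "\<bar>F y i - p i\<bar> < d / 2" using p(3) i by blast
        ultimately show ?thesis by linarith
      qed
      then show ?thesis using box[OF p(1)] by blast
    qed
    have "open Q"
      unfolding Q_def
      by (intro open_UN ballI open_INT finite_lessThan open_Collect_less continuous_intros coord)
    then have "openin ?C N'"
      using F(1) unfolding N'_def by (intro continuous_openin_preimage_gen) simp_all
    then have T: "closedin ?C (C - N')" by (simp add: closedin_diff)
    have "disjnt A (C - N')" using AN by (auto simp: disjnt_def)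
    then obtain u where u: "continuous_map ?C (top_of_set {0..1}) u" "u ` A \<subseteq> {0::real}" "u ` (C - N') \<subseteq> {1}"
      using Urysohn_lemma[OF N A T] by (metis zero_le_one)
    have uc: "continuous_map ?C euclideanreal u" and u01: "\<And>y. y \<in> C \<Longrightarrow> 0 \<le> u y"
      using u(1) by (auto simp: continuous_map_in_subtopology)
    have uN: "y \<in> N'" if "y \<in> C" "u y \<le> 1/2" for y
      using u(3) that by force
    \<comment> \<open>Near \<open>A\<close> follow the homotopy from \<open>f\<close> to \<open>r j \<circ> G\<close>, which \<open>S\<close> continues over the rest of \<open>C\<close>.\<close>
    define h where "h y = (if u y \<le> 1/2 then r j (mix (2 * u y) y) else S y)" for y
    have "continuous_map ?C R_omega h"
      unfolding h_def[abs_def]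
    proof (rule continuous_map_cases_le)
      let ?D = "{y \<in> topspace ?C. u y \<le> 1/2}"
      have sub: "subtopology ?C ?D = top_of_set ?D" by (auto simp: subtopology_subtopology Int_absorb1)
      have "continuous_on ?D u" using uc continuous_on_subset[of C u ?D] by auto
      moreover have "continuous_on ?D (\<lambda>y. F y i)" "continuous_on ?D (\<lambda>y. G y i)" for i
        using continuous_on_subset[OF Fc, of ?D] continuous_on_product_then_coordinatewise[OF Gc] by auto
      ultimately have "continuous_on ?D (\<lambda>y. mix (2 * u y) y)"
        unfolding mix_def by (intro continuous_on_coordinatewise_then_product continuous_intros)
      moreover have "mix (2 * u y) y \<in> U j" if "y \<in> ?D" for y
        using mixV[of y "2 * u y"] uN[of y] u01[of y] that VW(4,5)[of j] by auto
      ultimately have "continuous_on ?D (\<lambda>y. r j (mix (2 * u y) y))"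
        by (intro continuous_on_compose2[OF r(1)]) auto
      then show "continuous_map (subtopology ?C ?D) R_omega (\<lambda>y. r j (mix (2 * u y) y))"
        unfolding sub by simp
      show "continuous_map (subtopology ?C {y \<in> topspace ?C. 1/2 \<le> u y}) R_omega S"
        using Sc by (intro continuous_map_from_subtopology) simp
      show "r j (mix (2 * u y) y) = S y" if y: "y \<in> topspace ?C" "u y = 1/2" for y
      proof -
        have m: "mix (2 * u y) y = G y" "mix 1 y = G y" unfolding y(2) by (simp_all add: mix_def)
        have "G y \<in> V j" using mixV[of y 1] uN[of y] y m(2) by simp
        then show ?thesis unfolding m using Sr[of y] y by simp
      qed
    qed (use uc in auto)
    moreover have "h y \<in> P j" if y: "y \<in> C" for y
    proof (cases "u y \<le> 1/2")
      case True
      then have "mix (2 * u y) y \<in> U j" using mixV[of y "2 * u y"] uN[OF y] u01[OF y] VW(4,5)[of j] by auto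
      then show ?thesis using True r(2)[of j] by (auto simp: h_def)
    next
      case False
      then show ?thesis using SP[OF y] by (simp add: h_def)
    qed
    ultimately have "continuous_map ?C (top_of_set (P j)) h"
      by (auto simp: continuous_map_in_subtopology)
    moreover have "h y = f y" if y: "y \<in> A" for y
    proof -
      have "u y = 0" using u(2) y by auto
      then show ?thesis using F(2) y r(3)[OF fP[OF y]] by (simp add: h_def mix_def)
    qed
    ultimately show "\<exists>g. continuous_map ?C (top_of_set (P j)) g \<and> (\<forall>y\<in>A. g y = f y)" by blast
  qed
  then show thesis using that \<open>compact C\<close> mc by blast
qed

lemma nbhd_retract_nsphere: "nbhd_retract (nsphere m)"
proof -
  let ?n = "Suc m"
  define U where "U = {x. 0 < nrm ?n x}"
  define r where "r x = (\<lambda>i. if i < ?n then x i / nrm ?n x else 0)" for x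
  have coord: "continuous_on U (\<lambda>y. y i)" for i
    by (rule continuous_on_subset[OF continuous_on_product_coordinates]) simp
  have U: "open U"
    unfolding U_def by (intro open_Collect_less continuous_on_nrm continuous_on_id continuous_on_const)
  have "continuous_on U (\<lambda>x. x i / nrm ?n x)" for i
    by (intro continuous_on_divide coord continuous_on_nrm continuous_on_id) (simp add: U_def)
  then have "continuous_on U (\<lambda>x. r x i)" for i
    unfolding r_def by (cases "i < ?n") auto
  then have rc: "continuous_on U r" using continuous_on_coordinatewise_then_product by blast
  have rn: "nrm ?n (r x) = 1" if "x \<in> U" for x
  proof -
    have "nrm ?n (r x) = nrm ?n (\<lambda>i. inverse (nrm ?n x) * x i)"
      by (rule nrm_cong) (simp add: r_def field_simps)
    then show ?thesis using that by (simp add: nrm_scale U_def)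
  qed
  have "r x \<in> unit_disk ?n" if "x \<in> U" for x
    using rn[OF that] by (simp add: unit_disk_def r_def[of x])
  then have "continuous_map (top_of_set U) (nsphere m) r"
    using rc rn by (auto simp: nsphere_eq continuous_map_in_subtopology)
  moreover have "continuous_map (nsphere m) euclidean (\<lambda>x. x)"
    unfolding nsphere_eq by simp
  moreover have "r x = x" if "x \<in> topspace (nsphere m)" for x
    using that by (auto simp: nsphere_eq r_def unit_disk_def)
  moreover have "(\<lambda>x. x) ` topspace (nsphere m) \<subseteq> U"
    by (auto simp: nsphere_eq U_def)
  ultimately show ?thesis
    unfolding nbhd_retract_def using U by blast
qed

lemma compact_nsphere: "compact_space (nsphere m)"
proof -
  have "{x \<in> unit_disk (Suc m). nrm (Suc m) x = 1} = unit_disk (Suc m) \<inter> {x. nrm (Suc m) x = 1}" by auto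
  moreover have "closed {x. nrm (Suc m) x = 1}"
    by (intro closed_Collect_eq continuous_on_nrm continuous_on_id continuous_on_const)
  ultimately have "compact {x \<in> unit_disk (Suc m). nrm (Suc m) x = 1}"
    using compact_unit_disk compact_Int_closed by metis
  then show ?thesis by (simp add: nsphere_eq compact_space_subtopology)
qed

lemma nbhd_retract_model:
  assumes Q: "nbhd_retract Q" "compact_space Q"
  obtains P :: "(nat \<Rightarrow> real) set" and U r where "compact P" "open U" "P \<subseteq> U" "continuous_on U r" "r ` U \<subseteq> P"
    "\<forall>p\<in>P. r p = p" "Q homeomorphic_space top_of_set P"
proof -
  obtain \<iota> :: "'a \<Rightarrow> nat \<Rightarrow> real" and U r where
    \<iota>: "continuous_map Q euclidean \<iota>" and U: "open U" "\<iota> ` topspace Q \<subseteq> U"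
    and r: "continuous_map (top_of_set U) Q r" and r\<iota>: "\<forall>p\<in>topspace Q. r (\<iota> p) = p"
    using Q(1) unfolding nbhd_retract_def by blast
  let ?P = "\<iota> ` topspace Q"
  have "compactin euclidean ?P"
    using image_compactin[OF _ \<iota>] Q(2) by (simp add: compact_space_def)
  then have "compact ?P" by simp
  moreover have "continuous_on U (\<iota> \<circ> r)"
    using continuous_map_compose[OF r \<iota>] by simp
  moreover have "(\<iota> \<circ> r) ` U \<subseteq> ?P"
    using continuous_map_image_subset_topspace[OF r] by auto
  moreover have "\<forall>p\<in>?P. (\<iota> \<circ> r) p = p" using r\<iota> by auto
  moreover have "homeomorphic_maps Q (top_of_set ?P) \<iota> r"
    unfolding homeomorphic_maps_def
    using \<iota> r\<iota> continuous_map_from_subtopology_mono[OF r U(2)] by (auto simp: continuous_map_in_subtopology)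
  then have "Q homeomorphic_space top_of_set ?P" unfolding homeomorphic_space_def by blast
  ultimately show thesis using that[OF _ U(1) U(2)] by blast
qed

text \<open>The coordinates are the truncated distances from the points of a countable dense set.\<close>
lemma separable_metrizable_in_cube:
  assumes X: "separable_space X" "metrizable_space X"
  obtains X' :: "(nat \<Rightarrow> real) set" where "\<And>x i. x \<in> X' \<Longrightarrow> \<bar>x i\<bar> \<le> 1" "X homeomorphic_space top_of_set X'"
proof -
  obtain M d where Md: "Metric_space M d" "X = Metric_space.mtopology M d"
    using X(2) unfolding metrizable_space_def by blast
  interpret Metric_space M d by (rule Md(1))
  have top: "topspace X = M" by (simp add: Md(2))
  obtain D where D: "countable D" "D \<subseteq> M" "X closure_of D = M"
    using X(1) unfolding separable_space_def top by blast
  define q where "q = from_nat_into D"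
  define \<phi> where "\<phi> x = (\<lambda>n. min 1 (d x (q n)))" for x
  have key: "\<exists>n c. \<phi> x n < c \<and> (\<forall>x'\<in>M. \<phi> x' n < c \<longrightarrow> x' \<in> mball x e)" if x: "x \<in> M" and e: "0 < e" for x e
  proof -
    define a where "a = min 1 e / 2"
    have a: "0 < a" "a < 1" "2 * a \<le> e" using e by (auto simp: a_def)
    obtain z where z: "z \<in> D" "z \<in> mball x a"
      using D(3) x a(1) unfolding Md(2) metric_closure_of by blast
    then obtain n where n: "q n = z"
      using D(1) by (metis from_nat_into_surj q_def)
    have "\<phi> x n < a" using z(2) a by (simp add: \<phi>_def n)
    moreover have "x' \<in> mball x e" if x': "x' \<in> M" "\<phi> x' n < a" for x'
    proof -
      have "d x' z < a" using x'(2) a(2) by (auto simp: \<phi>_def n min_def split: if_splits)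
      moreover have "d x z < a" "z \<in> M" using z by auto
      moreover have "d x x' \<le> d x z + d z x'" using triangle x x'(1) \<open>z \<in> M\<close> by blast
      ultimately show ?thesis using x x'(1) a(3) by (simp add: commute)
    qed
    ultimately show ?thesis by blast
  qed
  let ?Y = "top_of_set (\<phi> ` M)"
  have inj: "inj_on \<phi> M"
  proof (rule inj_onI, rule ccontr)
    fix x y assume x: "x \<in> M" and y: "y \<in> M" and eq: "\<phi> x = \<phi> y" and ne: "x \<noteq> y"
    then have "0 < d x y" by simp
    then obtain n c where nc: "\<phi> x n < c" "\<forall>x'\<in>M. \<phi> x' n < c \<longrightarrow> x' \<in> mball x (d x y)"
      using key[OF x] by blast
    have "\<phi> y n < c" using nc(1) unfolding eq .
    then have "y \<in> mball x (d x y)" using nc(2) y by blast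
    then show False by simp
  qed
  have "continuous_map X euclideanreal (\<lambda>x. \<phi> x n)" for n
  proof (cases "M = {}")
    case True
    then show ?thesis using top by (simp add: continuous_map_def)
  next
    case False
    then have "D \<noteq> {}" using D(3) by auto
    then have qM: "q n \<in> M" using D(2) from_nat_into[of D n] by (auto simp: q_def)
    have "continuous_map (mtopology_of Self) euclideanreal (\<lambda>x. mdist Self x (q n))"
      by (intro continuous_map_mdist) (auto simp: qM)
    then have "continuous_map X euclideanreal (\<lambda>x. d x (q n))"
      by (simp add: Md(2) mtopology_of_def)
    then show ?thesis unfolding \<phi>_def by (intro continuous_intros)
  qed
  then have cont: "continuous_map X ?Y \<phi>"
    using top by (auto simp: continuous_map_in_subtopology continuous_map_R_omega)
  have "open_map X ?Y \<phi>"
    unfolding open_map_def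
  proof (intro allI impI)
    fix O' assume O: "openin X O'"
    show "openin ?Y (\<phi> ` O')"
    proof (subst openin_subopen, intro ballI)
      fix y assume "y \<in> \<phi> ` O'"
      then obtain x where x: "x \<in> O'" "y = \<phi> x" by blast
      have OM: "O' \<subseteq> M" using openin_subset[OF O] top by simp
      obtain e where e: "0 < e" "mball x e \<subseteq> O'"
        using O x(1) unfolding Md(2) openin_mtopology by blast
      obtain n c where nc: "\<phi> x n < c" "\<forall>x'\<in>M. \<phi> x' n < c \<longrightarrow> x' \<in> mball x e"
        using key[OF _ e(1), of x] x(1) OM by blast
      have "open {z :: nat \<Rightarrow> real. z n < c}"
        by (intro open_Collect_less continuous_on_product_coordinates continuous_on_const)
      then have "openin ?Y (\<phi> ` M \<inter> {z. z n < c})" by (rule openin_open_Int)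
      moreover have "y \<in> \<phi> ` M \<inter> {z. z n < c}" using x OM nc(1) by auto
      moreover have "\<phi> ` M \<inter> {z. z n < c} \<subseteq> \<phi> ` O'" using nc(2) e(2) by blast
      ultimately show "\<exists>T. openin ?Y T \<and> y \<in> T \<and> T \<subseteq> \<phi> ` O'" by blast
    qed
  qed
  then have "homeomorphic_map X ?Y \<phi>"
    using cont inj top by (intro bijective_open_imp_homeomorphic_map) auto
  then have "X homeomorphic_space ?Y" by (rule homeomorphic_map_imp_homeomorphic_space)
  moreover have "\<bar>x i\<bar> \<le> 1" if "x \<in> \<phi> ` M" for x i
    using that by (auto simp: \<phi>_def min_def)
  ultimately show thesis using that by blast
qed

section \<open>Wedges\<close>

text \<open>The points that are at least as close to \<open>A1\<close> as to \<open>A2\<close>, and conversely.\<close>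
lemma closed_split:
  fixes C :: "'m::metric_space set"
  assumes A: "closedin (top_of_set C) A1" "closedin (top_of_set C) A2"
  obtains C1 C2 where "closedin (top_of_set C) C1" "closedin (top_of_set C) C2" "C1 \<union> C2 = C"
    "C1 \<inter> (A1 \<union> A2) \<subseteq> A1" "C2 \<inter> (A1 \<union> A2) \<subseteq> A2"
proof (cases "A1 = {} \<or> A2 = {}")
  case True
  then show thesis using that[of "{}" C] that[of C "{}"] by auto
next
  case False
  have dc: "continuous_on C (\<lambda>y. infdist y B)" for B by (intro continuous_on_infdist continuous_on_id)
  have zero: "y \<in> B" if "closedin (top_of_set C) B" "B \<noteq> {}" "y \<in> C" "infdist y B \<le> 0" for y B
  proof -
    have "y \<in> closure B"
      using that infdist_nonneg[of y B] by (simp add: in_closure_iff_infdist_zero)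
    then show ?thesis using that by (metis IntI closedin_closed closure_closed closure_mono inf.cobounded2 subsetD)
  qed
  have cl: "closedin (top_of_set C) {y \<in> C. infdist y B \<le> infdist y B'}" for B B'
  proof -
    have "continuous_on C (\<lambda>y. infdist y B - infdist y B')" by (intro continuous_on_diff dc)
    from continuous_closedin_preimage[OF this, of "{..0}"] show ?thesis
      by (simp add: vimage_def Int_def)
  qed
  have AC: "A1 \<subseteq> C" "A2 \<subseteq> C" using A closedin_subset by fastforce+
  show thesis
  proof (rule that[OF cl[of A1 A2] cl[of A2 A1]])
    show "{y \<in> C. infdist y A1 \<le> infdist y A2} \<union> {y \<in> C. infdist y A2 \<le> infdist y A1} = C" by auto
    have one: "y \<in> B" if "closedin (top_of_set C) B" "B \<noteq> {}" "y \<in> C" "infdist y B \<le> infdist y B'" "y \<in> B'" for y B B'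
      using zero[OF that(1-3)] that(4) infdist_zero[OF that(5)] by simp
    show "{y \<in> C. infdist y A1 \<le> infdist y A2} \<inter> (A1 \<union> A2) \<subseteq> A1"
      using one[OF A(1)] False by blast
    show "{y \<in> C. infdist y A2 \<le> infdist y A1} \<inter> (A1 \<union> A2) \<subseteq> A2"
      using one[OF A(2)] False by blast
  qed
qed

lemma continuous_map_Inl_wedge: "continuous_map X (wedge X x0 Y y0) Inl"
  unfolding continuous_map_def by (auto simp: topspace_wedge openin_wedge)

lemma continuous_map_inr_wedge: "continuous_map Y (wedge X x0 Y y0) (wedge_inr x0 y0)"
  unfolding continuous_map_def by (auto simp: topspace_wedge openin_wedge)

lemma continuous_map_from_wedge:
  assumes "continuous_map X T (h \<circ> Inl)" "continuous_map Y T (h \<circ> wedge_inr x0 y0)"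
  shows "continuous_map (wedge X x0 Y y0) T h"
  unfolding continuous_map_def
proof (intro conjI allI impI)
  show "h \<in> topspace (wedge X x0 Y y0) \<rightarrow> topspace T"
    using assms[THEN continuous_map_image_subset_topspace] by (auto simp: topspace_wedge)
  fix U assume U: "openin T U"
  let ?U = "{k \<in> topspace (wedge X x0 Y y0). h k \<in> U}"
  have "{x \<in> topspace X. Inl x \<in> ?U} = {x \<in> topspace X. (h \<circ> Inl) x \<in> U}"
    "{y \<in> topspace Y. wedge_inr x0 y0 y \<in> ?U} = {y \<in> topspace Y. (h \<circ> wedge_inr x0 y0) y \<in> U}"
    by (auto simp: topspace_wedge)
  then show "openin (wedge X x0 Y y0) ?U"
    unfolding openin_wedge
    using openin_continuous_map_preimage[OF assms(1) U] openin_continuous_map_preimage[OF assms(2) U]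
    by (auto simp: topspace_wedge)
qed

definition wedge_prl :: "'a \<Rightarrow> 'a + 'b \<Rightarrow> 'a"
  where "wedge_prl x0 = case_sum id (\<lambda>_. x0)"

definition wedge_prr :: "'b \<Rightarrow> 'a + 'b \<Rightarrow> 'b"
  where "wedge_prr y0 = case_sum (\<lambda>_. y0) id"

lemma wedge_pr_simps [simp]:
  "wedge_prl x0 (Inl x) = x" "wedge_prl x0 (wedge_inr x0 y0 y) = x0"
  "wedge_prr y0 (Inl x) = y0" "wedge_prr y0 (wedge_inr x0 y0 y) = y"
  by (auto simp: wedge_prl_def wedge_prr_def wedge_inr_def)

lemma continuous_map_wedge_prl:
  assumes "x0 \<in> topspace X"
  shows "continuous_map (wedge X x0 Y y0) X (wedge_prl x0)"
  by (rule continuous_map_from_wedge) (use assms in \<open>simp_all add: o_def\<close>)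

lemma continuous_map_wedge_prr:
  assumes "y0 \<in> topspace Y"
  shows "continuous_map (wedge X x0 Y y0) Y (wedge_prr y0)"
  by (rule continuous_map_from_wedge) (use assms in \<open>simp_all add: o_def\<close>)

lemma in_AE_wedgeD:
  assumes "in_AE (wedge X x0 Y y0) Z" "x0 \<in> topspace X" "y0 \<in> topspace Y"
  shows "in_AE X Z" "in_AE Y Z"
  using in_AE_retract[OF assms(1) continuous_map_Inl_wedge continuous_map_wedge_prl[OF assms(2)]]
    in_AE_retract[OF assms(1) continuous_map_inr_wedge continuous_map_wedge_prr[OF assms(3)]] by simp_all

text \<open>The two projections \<open>wedge_prl x0 \<circ> f\<close> and \<open>wedge_prr y0 \<circ> f\<close> are extended separately. The extensions
  \<open>gl\<close> and \<open>gr\<close> fit together to a map to the wedge because \<open>C\<close> is split into closed sets \<open>C1\<close> and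
  \<open>C2\<close> such that \<open>gr\<close> can be kept at the base point on \<open>C1\<close>, and \<open>gl\<close> on \<open>C2\<close>.\<close>
lemma in_AE_wedgeI:
  fixes C :: "'m::metric_space set"
  assumes AE: "in_AE X (top_of_set C)" "in_AE Y (top_of_set C)"
    and x0: "x0 \<in> topspace X" and y0: "y0 \<in> topspace Y" and T1: "closedin X {x0}" "closedin Y {y0}"
  shows "in_AE (wedge X x0 Y y0) (top_of_set C)"
  unfolding in_AE_def
proof (intro allI impI, elim conjE)
  let ?C = "top_of_set C" and ?K = "wedge X x0 Y y0"
  fix A f assume A: "closedin ?C A" and f: "continuous_map (subtopology ?C A) ?K f"
  have AC: "A \<subseteq> C" using closedin_subset[OF A] by simp
  have tA: "topspace (subtopology ?C A) = A" using AC by auto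
  have fl: "continuous_map (subtopology ?C A) X (\<lambda>y. wedge_prl x0 (f y))"
    using continuous_map_compose[OF f continuous_map_wedge_prl[OF x0]] by (simp add: o_def)
  have fr: "continuous_map (subtopology ?C A) Y (\<lambda>y. wedge_prr y0 (f y))"
    using continuous_map_compose[OF f continuous_map_wedge_prr[OF y0]] by (simp add: o_def)
  define A1 where "A1 = {y \<in> A. wedge_prr y0 (f y) = y0}"
  define A2 where "A2 = {y \<in> A. wedge_prl x0 (f y) = x0}"
  have "closedin (subtopology ?C A) A1" "closedin (subtopology ?C A) A2"
    using closedin_continuous_map_preimage[OF fr T1(2)] closedin_continuous_map_preimage[OF fl T1(1)]
    unfolding tA by (simp_all add: A1_def A2_def)
  then have A12: "closedin ?C A1" "closedin ?C A2"
    using A closedin_trans_full by blast+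
  have fcase: "f y = Inl (wedge_prl x0 (f y)) \<and> y \<in> A1 \<or> f y = wedge_inr x0 y0 (wedge_prr y0 (f y)) \<and> y \<in> A2"
    if y: "y \<in> A" for y
  proof -
    have "f y \<in> topspace ?K" using continuous_map_image_subset_topspace[OF f] y tA by auto
    then show ?thesis using y by (auto simp: topspace_wedge A1_def A2_def)
  qed
  have A_eq: "A1 \<union> A2 = A" using fcase by (auto simp: A1_def A2_def)
  obtain C1 C2 where C12: "closedin ?C C1" "closedin ?C C2" "C1 \<union> C2 = C" "C1 \<inter> A \<subseteq> A1" "C2 \<inter> A \<subseteq> A2"
    using closed_split[OF A12] unfolding A_eq by blast
  have one: "\<exists>g. continuous_map ?C T g \<and> (\<forall>y\<in>A. g y = p y) \<and> (\<forall>y\<in>D. g y = t)"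
    if T: "in_AE T ?C" "t \<in> topspace T" and D: "closedin ?C D"
      and p: "continuous_map (subtopology ?C A) T p" and pD: "\<And>y. y \<in> A \<inter> D \<Longrightarrow> p y = t" for T t D p
  proof -
    let ?q = "\<lambda>y. if y \<in> D then t else p y"
    have AD: "closedin ?C (A \<union> D)" using A D by auto
    have DC: "D \<subseteq> C" using closedin_subset[OF D] by simp
    have "C \<inter> (A \<union> D) \<inter> A = C \<inter> A" "C \<inter> (A \<union> D) \<inter> D = C \<inter> D" by auto
    then have eq: "subtopology (subtopology ?C (A \<union> D)) A = subtopology ?C A"
      "subtopology (subtopology ?C (A \<union> D)) D = subtopology ?C D"
      by (simp_all add: subtopology_subtopology)
    have "continuous_map (subtopology ?C (A \<union> D)) T ?q"
    proof (rule continuous_map_on_two_closed)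
      show "closedin (subtopology ?C (A \<union> D)) A" "closedin (subtopology ?C (A \<union> D)) D"
        using A D AD by (auto simp: closedin_closed_subtopology)
      show "A \<union> D = topspace (subtopology ?C (A \<union> D))" using AC DC by auto
      show "continuous_map (subtopology (subtopology ?C (A \<union> D)) A) T ?q"
        unfolding eq by (rule continuous_map_eq[OF p]) (use pD tA in auto)
      show "continuous_map (subtopology (subtopology ?C (A \<union> D)) D) T ?q"
        unfolding eq by (rule continuous_map_eq[of _ _ "\<lambda>_. t"]) (use T(2) in auto)
    qed
    then obtain g where g: "continuous_map ?C T g" "\<forall>y\<in>A \<union> D. g y = ?q y"
      by (rule in_AE_D[OF T(1) AD])
    then show ?thesis using pD by (intro exI[of _ g]) auto
  qed
  have pC: "y \<in> A \<inter> C2 \<Longrightarrow> wedge_prl x0 (f y) = x0" "y \<in> A \<inter> C1 \<Longrightarrow> wedge_prr y0 (f y) = y0" for y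
    using C12(4,5) by (auto simp: A1_def A2_def)
  obtain gl where gl: "continuous_map ?C X gl" "\<forall>y\<in>A. gl y = wedge_prl x0 (f y)" "\<forall>y\<in>C2. gl y = x0"
    using one[OF AE(1) x0 C12(2) fl pC(1)] by blast
  obtain gr where gr: "continuous_map ?C Y gr" "\<forall>y\<in>A. gr y = wedge_prr y0 (f y)" "\<forall>y\<in>C1. gr y = y0"
    using one[OF AE(2) y0 C12(1) fr pC(2)] by blast
  define g where "g y = (if y \<in> C1 then Inl (gl y) else wedge_inr x0 y0 (gr y))" for y
  have g2: "g y = wedge_inr x0 y0 (gr y)" if "y \<in> C2" for y
    using that gl(3) gr(3) by (auto simp: g_def wedge_inr_def)
  have "continuous_map ?C ?K g"
  proof (rule continuous_map_on_two_closed[OF C12(1,2)])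
    show "C1 \<union> C2 = topspace ?C" using C12(3) by simp
    have "continuous_map (subtopology ?C C1) ?K (Inl \<circ> gl)"
      by (rule continuous_map_compose[OF continuous_map_from_subtopology[OF gl(1)] continuous_map_Inl_wedge])
    then show "continuous_map (subtopology ?C C1) ?K g"
      by (rule continuous_map_eq) (simp add: g_def)
    have "continuous_map (subtopology ?C C2) ?K (wedge_inr x0 y0 \<circ> gr)"
      by (rule continuous_map_compose[OF continuous_map_from_subtopology[OF gr(1)] continuous_map_inr_wedge])
    then show "continuous_map (subtopology ?C C2) ?K g"
      by (rule continuous_map_eq) (simp add: g2)
  qed
  moreover have "g y = f y" if y: "y \<in> A" for y
  proof (cases "y \<in> C1")
    case True
    then have "wedge_prr y0 (f y) = y0" using C12(4) y by (auto simp: A1_def)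
    then have "f y = Inl (wedge_prl x0 (f y))"
      using fcase[OF y] by (auto simp: wedge_inr_def A2_def)
    then show ?thesis using True gl(2) y by (simp add: g_def)
  next
    case False
    then have "y \<in> C2" using C12(3) AC y by blast
    then have "wedge_prl x0 (f y) = x0" using C12(5) y by (auto simp: A2_def)
    then have "f y = wedge_inr x0 y0 (wedge_prr y0 (f y))"
      using fcase[OF y] by (auto simp: wedge_inr_def A1_def)
    then show ?thesis using g2[OF \<open>y \<in> C2\<close>] gr(2) y by simp
  qed
  ultimately show "\<exists>g. continuous_map ?C ?K g \<and> (\<forall>x\<in>A. g x = f x)" by blast
qed

section \<open>The theorem\<close>

lemma finitely_dominated_retract:
  assumes K: "finitely_dominated K" and i: "continuous_map P K i" and r: "continuous_map K P r"
    and ri: "\<And>p. p \<in> topspace P \<Longrightarrow> r (i p) = p"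
  shows "finitely_dominated P"
proof -
  obtain F :: "(nat \<Rightarrow> real) topology" and E a b where F: "finite_CW_complex F E"
    and ab: "continuous_map K F a" "continuous_map F K b" "homotopic_with (\<lambda>h. True) K K (b \<circ> a) id"
    using K unfolding finitely_dominated_def dominated_by_def by blast
  have "homotopic_with (\<lambda>h. True) K P (r \<circ> (b \<circ> a)) (r \<circ> id)"
    using ab(3) r by (rule homotopic_with_compose_continuous_map_left) simp
  then have "homotopic_with (\<lambda>h. True) P P (r \<circ> (b \<circ> a) \<circ> i) (r \<circ> id \<circ> i)"
    using i by (rule homotopic_with_compose_continuous_map_right) simp
  moreover have "homotopic_with (\<lambda>h. True) P P (r \<circ> id \<circ> i) id"
    using continuous_map_compose[OF i r] by (intro homotopic_with_equal) (auto simp: ri o_def)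
  ultimately have "homotopic_with (\<lambda>h. True) P P ((r \<circ> b) \<circ> (a \<circ> i)) id"
    using homotopic_with_trans by (metis comp_assoc)
  moreover have "continuous_map P F (a \<circ> i)" "continuous_map F P (r \<circ> b)"
    using i r ab(1,2) continuous_map_compose by blast+
  ultimately have "dominated_by P F" unfolding dominated_by_def by blast
  then show ?thesis using finitely_dominatedI[OF F] by blast
qed

lemma metrizable_compactification_homeomorphic:
  assumes XY: "X homeomorphic_space Y" and C: "metrizable_compactification Y C"
  shows "metrizable_compactification X C"
proof -
  obtain h where h: "homeomorphic_map X Y h" using XY homeomorphic_space by blast
  obtain e where e: "embedding_map Y C e" "C closure_of (e ` topspace Y) = topspace C"
    using C unfolding metrizable_compactification_def by blast
  have hY: "h ` topspace X = topspace Y" using h by (rule homeomorphic_imp_surjective_map)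
  then have "embedding_map X Y h" using h by (simp add: embedding_map_def)
  then have "embedding_map X C (e \<circ> h)" using e(1) embedding_map_compose by blast
  moreover have "(e \<circ> h) ` topspace X = e ` topspace Y" using hY by (metis image_comp)
  ultimately show ?thesis
    using C e(2) unfolding metrizable_compactification_def by metis
qed

lemma in_AE_nsphere_ge:
  assumes "normal_space X" "in_AE (nsphere k) X" "k \<le> m"
  shows "in_AE (nsphere m) X"
  using assms(3) by (induction m rule: dec_induct) (use assms in_AE_nsphere_Suc in auto)

theorem mainTheorem2:
  fixes L :: "'a topology" and E :: "nat \<Rightarrow> 'a set set"
    and x0 :: 'a and s0 :: "nat \<Rightarrow> real" and K :: "('a + (nat \<Rightarrow> real)) topology"
  assumes "CW_complex L E"
    and "finite_type E"
    and "finite_fundamental_group L"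
    and "\<not> finitely_dominated L"
    and "{x0} \<in> E 0"
    and "s0 \<in> topspace (nsphere 2)"
    and "K = wedge L x0 (nsphere 2) s0"
  shows "\<not> finitely_dominated K \<and>
    (\<forall>X :: 'b topology. separable_space X \<and> metrizable_space X \<and> in_AE K X \<longrightarrow>
       (\<exists>C :: (nat \<Rightarrow> real) topology. metrizable_compactification X C \<and> in_AE K C))"
proof (intro conjI allI impI; (elim conjE)?)
  interpret finite_type_CW L E using assms(1,2) by unfold_locales
  have x0: "x0 \<in> topspace L" using cell_sub[OF assms(5)] by simp
  note s0 = assms(6) and K = assms(7)
  have T1: "closedin L {x0}" "closedin (nsphere 2) {s0}"
    using CW_complexD(1)[OF assms(1)] x0 s0
    by (auto intro!: closedin_Hausdorff_singleton simp: nsphere_eq Hausdorff_space_subtopology)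
  show "\<not> finitely_dominated K"
  proof
    assume "finitely_dominated K"
    then have "finitely_dominated L"
      unfolding K
      by (rule finitely_dominated_retract[OF _ continuous_map_Inl_wedge continuous_map_wedge_prl[OF x0]]) simp
    then show False using assms(4) by simp
  qed
  fix X :: "'b topology"
  assume X: "separable_space X" "metrizable_space X" and AE: "in_AE K X"
  obtain X' :: "(nat \<Rightarrow> real) set" where b: "\<And>x i. x \<in> X' \<Longrightarrow> \<bar>x i\<bar> \<le> 1"
    and XX': "X homeomorphic_space top_of_set X'"
    using separable_metrizable_in_cube[OF X] by blast
  have normal: "normal_space (top_of_set D)" for D :: "(nat \<Rightarrow> real) set"
    by (simp add: metrizable_imp_normal_space metrizable_space_subtopology metrizable_space_euclidean)
  have "in_AE K (top_of_set X')" using in_AE_homeomorphic_domain[OF XX' AE] .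
  then have LS: "in_AE L (top_of_set X')" "in_AE (nsphere 2) (top_of_set X')"
    unfolding K by (rule in_AE_wedgeD[OF _ x0 s0])+
  let ?P = "subtopology L (stage (cells_below 3))"
  have "in_AE ?P (top_of_set X')"
    using skeleton_in_AE[OF LS(1)] in_AE_nsphere_ge[OF normal LS(2)] by blast
  have "compact_space ?P" using compact_stage by (simp add: compact_space_subtopology)
  then obtain P1 :: "(nat \<Rightarrow> real) set" and U1 r1 where 1: "compact P1" "open U1" "P1 \<subseteq> U1" "continuous_on U1 r1"
    "r1 ` U1 \<subseteq> P1" "\<forall>p\<in>P1. r1 p = p" and h1: "?P homeomorphic_space top_of_set P1"
    by (rule nbhd_retract_model[OF nbhd_retract_stage])
  obtain P2 :: "(nat \<Rightarrow> real) set" and U2 r2 where 2: "compact P2" "open U2" "P2 \<subseteq> U2" "continuous_on U2 r2"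
    "r2 ` U2 \<subseteq> P2" "\<forall>p\<in>P2. r2 p = p" and h2: "nsphere 2 homeomorphic_space top_of_set P2"
    by (rule nbhd_retract_model[OF nbhd_retract_nsphere compact_nsphere])
  have AE12: "in_AE (top_of_set P1) (top_of_set X')" "in_AE (top_of_set P2) (top_of_set X')"
    using \<open>in_AE ?P (top_of_set X')\<close> LS(2) in_AE_homeomorphic_target[OF h1] in_AE_homeomorphic_target[OF h2] by blast+
  obtain C :: "(nat \<Rightarrow> real) set" where C: "compact C"
    "metrizable_compactification (top_of_set X') (top_of_set C)"
    and AEC: "\<forall>j :: nat. in_AE (top_of_set (if j = 0 then P1 else P2)) (top_of_set C)"
  proof (rule AE_compactification[where X = X' and P = "\<lambda>j. if j = 0 then P1 else P2"
        and U = "\<lambda>j. if j = 0 then U1 else U2" and r = "\<lambda>j. if j = 0 then r1 else r2"])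
    show "\<bar>x i\<bar> \<le> 1" if "x \<in> X'" for x i using b[OF that] .
    fix C :: "(nat \<Rightarrow> real) set"
    assume "compact C" "metrizable_compactification (top_of_set X') (top_of_set C)"
      "\<forall>j :: nat. in_AE (top_of_set (if j = 0 then P1 else P2)) (top_of_set C)"
    then show thesis by (rule that)
  qed (use 1 2 AE12 in \<open>auto split: if_splits\<close>)
  have "in_AE (top_of_set P1) (top_of_set C)" "in_AE (top_of_set P2) (top_of_set C)"
    using AEC[rule_format, of 0] AEC[rule_format, of 1] by simp_all
  then have C12: "in_AE ?P (top_of_set C)" "in_AE (nsphere 2) (top_of_set C)"
    using in_AE_homeomorphic_target[OF h1] in_AE_homeomorphic_target[OF h2] by blast+
  have "in_AE L (top_of_set C)"
    using in_AE_of_skeleton[OF C(1) _ C12(1)] in_AE_nsphere_ge[OF normal C12(2)] by blast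
  then have "in_AE K (top_of_set C)"
    unfolding K using C12(2) x0 s0 T1 by (intro in_AE_wedgeI)
  then show "\<exists>C :: (nat \<Rightarrow> real) topology. metrizable_compactification X C \<and> in_AE K C"
    using metrizable_compactification_homeomorphic[OF XX' C(2)] by blast
qed

end
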